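(* Let $((X^n(t))_{t\in[0,T]})_{n\in\mathbb{N}}$ be a family of $p$-dimensional, continuous, centered Gaussian processes, starting from zero, with independent components, which satisfies an LDP on $C([0,T],\mathbb{R}^p)$ with speed $\gamma_n$ and good rate function $$I(h)=\sum_{i=1}^p I_i(h_i),\qquad I_i(h_i)=\begin{cases}\frac12\|h_i\|^2_{\mathscr{H}_i} & h_i\in\mathscr{H}_i\\ +\infty & h_i\notin\mathscr{H}_i,\end{cases}$$ where $\mathscr{H}_i\subset C([0,T],\mathbb{R})$ is the reproducing kernel Hilbert space associated to some covariance function $k_{ii}$. Let $((A^n,B^n))_{n\in\mathbb{N}}$ be a $[0,+\infty)^p\times C([0,T],\mathbb{R}^p)$-valued random sequence, independent of $(X^n)_{n\in\mathbb{N}}$, and set $Z^n(t)=A^n\circ X^n(t)+B^n(t)$ for $t\in[0,T]$, $n\in\mathbb{N}$, where $u\circ v=(u_1v_1,\ldots,u_pv_p)$. Assume that: - $A^n=(\widetilde A^n_1,\ldots,\widetilde A^n_p)$, where, for each $i=1,\ldots,p$, $(\widetilde A^n_i)_{n\in\mathbb{N}}$ is a family of positive random variables satisfying the LDP on $[0,+\infty)$ with speed $\gamma_n$ and good rate function $x\mapsto d_ix^{\theta_i}$ ($x\ge0$), for some $d_1,\theta_1,\ldots,d_p,\theta_p>0$; - $(B^n)_{n\in\mathbb{N}}$ satisfies an LDP with speed $\gamma_n$ and good rate function $I_B$; - $(A^n)_{n\in\mathbb{N}}$ and $(B^n)_{n\in\mathbb{N}}$ are independent. Then $((A^n,B^n),Z^n)_{n\in\mathbb{N}}$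 satisfies an LDP with speed $\gamma_n$ and rate function $$I_{(A,B),Z}((a,b),z)=I_B(b)+\sum_{i=1}^p\{d_ia_i^{\theta_i}+J_i(z_i|(a_i,b_i))\},\qquad J_i(z_i|(a_i,b_i))=\begin{cases}\frac{1}{2a_i^2}\|z_i-b_i\|^2_{\mathscr{H}_i} & a_i>0\\ 0 & z_i-b_i=0\text{ and }a_i=0\\ +\infty&\text{otherwise;}\end{cases}$$ so in particular, setting $\mathcal{I}^+(a)=\{1\le i\le p:a_i>0\}$ and $\mathcal{I}^0(a)=\{1\le i\le p:a_i=0\}$, $$I_{(A,B),Z}((a,b),z)=\begin{cases}I_B(b)+\sum_{i\in\mathcal{I}^+(a)}\Big\{d_ia_i^{\theta_i}+\frac1{2a_i^2}\|z_i-b_i\|^2_{\mathscr{H}_i}\Big\}&\text{if }z_i-b_i=0\text{ for }i\in\mathcal{I}^0(a)\\ +\infty&\text{otherwise.}\end{cases}$$ Moreover $(Z^n)_{n\in\mathbb{N}}$ satisfies an LDP with speed $\gamma_n$ and the good rate function $$I_Z(z)=\inf_{(a,b)\in[0,+\infty)^p\times C([0,T],\mathbb{R}^p)}\Big\{I_B(b)+\sum_{i=1}^p\{d_ia_i^{\theta_i}+J_i(z_i|(a_i,b_i))\}\Big\}$$ $$=\inf_{b\in C([0,T],\mathbb{R}^p)}\Big\{I_B(b)+\sum_{i=1}^p\psi(d_i,\theta_i)\Big(\frac12\|z_i-b_i\|^2_{\mathscr{H}_i}\Big)^{\theta_i/(\theta_i+2)}\Big\}.$$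
   Context: $T>0$ and $p\ge1$ are fixed. $C([0,T],\mathbb{R}^p)$ carries the sup-norm; product spaces carry the product topology. For $d,\theta>0$, $$\psi(d,\theta):=2^{\theta/(\theta+2)}\Big(d(d\theta)^{-\theta/(\theta+2)}+\frac12(d\theta)^{2/(\theta+2)}\Big).$$ Large deviation principle (LDP): let $E$ be a topological space with Borel $\sigma$-algebra and $\gamma_n>0$ with $\gamma_n\to+\infty$ (the speed). A rate function is a lower semicontinuous $I:E\to[0,+\infty]$; it is good if $\{I\le a\}$ is compact for all $a\ge0$. Probability measures $(\mu_n)$ satisfy the LDP on $E$ with rate function $I$ and speed $\gamma_n$ if $\liminf_n\frac1{\gamma_n}\log\mu_n(\Theta)\ge-\inf_{x\in\Theta}I(x)$ for every open $\Theta$ and $\limsup_n\frac1{\gamma_n}\log\mu_n(\Gamma)\le-\inf_{x\in\Gamma}I(x)$ for every closed $\Gamma$. Random elements satisfy an LDP if their laws do. Reproducing kernel Hilbert space (RKHS): let $U=(U(t))_{t\in[0,T]}$ be a real continuous centered Gaussian process with covariance function $k$. Let $H$ be the $L^2$-closure of $\{\int_0^TU(t)\,d\lambda(t):\lambda\text{ a signed measure on }[0,T]\}$. The RKHS of $k$ is $\mathscr{H}=\{h: h(t)=\mathbb{E}[U(t)Y],\ Y\in H\}\subset C([0,T],\mathbb{R})$, with inner product transported from $L^2$ by the bijection $Y\mapsto\mathbb{E}[U(\cdot)Y]$. Equivalently it is the completion of the functions $x(t)=\int_0^Tk(t,s)\,d\lambda(s)$ under $\|x\|^2=\int_0^T\int_0^Tk(t,s)\,d\lambda(t)\,d\lambda(s)$.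 Conventions: $\|h\|^2_{\mathscr{H}_i}=+\infty$ if $h\notin\mathscr{H}_i$; a positive power of $+\infty$ is $+\infty$.
   Formalization: The formal statement additionally assumes that, for each n, the components of A^n are independent; without this the claim fails for p ≥ 2, e.g. when all components of A^n are equal. *)

theory Defs
  imports "HOL-Probability.Probability"
begin

section \<open>Large deviation principles on abstract topological spaces\<close>

definition borel_of :: "'a topology \<Rightarrow> 'a measure" where
  "borel_of E = sigma (topspace E) {S. openin E S}"

text \<open>Only arguments \<open>x \<ge> 0\<close> matter in the next two definitions; they fix
  \<open>log 0 = -\<infinity>\<close> and \<open>\<infinity>\<close> as the positive powers of \<open>\<infinity>\<close>.\<close>

definition log_ereal :: "real \<Rightarrow> ereal" where
  "log_ereal x = (if x = 0 then -\<infinity> else ereal (ln x))"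

definition powr_ereal :: "ereal \<Rightarrow> real \<Rightarrow> ereal" where
  "powr_ereal x r = (if x = \<infinity> then \<infinity> else ereal (real_of_ereal x powr r))"

definition rate_function :: "'a topology \<Rightarrow> ('a \<Rightarrow> ereal) \<Rightarrow> bool" where
  "rate_function E I \<longleftrightarrow>
     (\<forall>x\<in>topspace E. 0 \<le> I x) \<and> (\<forall>a. openin E {x \<in> topspace E. a < I x})"

definition good_rate_function :: "'a topology \<Rightarrow> ('a \<Rightarrow> ereal) \<Rightarrow> bool" where
  "good_rate_function E I \<longleftrightarrow>
     rate_function E I \<and> (\<forall>a\<ge>0. compactin E {x \<in> topspace E. I x \<le> ereal a})"

definition satisfies_ldp ::
    "'a topology \<Rightarrow> (nat \<Rightarrow> 'a measure) \<Rightarrow> (nat \<Rightarrow> real) \<Rightarrow> ('a \<Rightarrow> ereal) \<Rightarrow> bool" where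
  "satisfies_ldp E \<mu> \<gamma> I \<longleftrightarrow>
     (\<forall>n. prob_space (\<mu> n) \<and> sets (\<mu> n) = sets (borel_of E)) \<and>
     (\<forall>n. 0 < \<gamma> n) \<and> filterlim \<gamma> at_top sequentially \<and>
     rate_function E I \<and>
     (\<forall>G. openin E G \<longrightarrow>
        - (INF x\<in>G. I x) \<le> liminf (\<lambda>n. ereal (1 / \<gamma> n) * log_ereal (measure (\<mu> n) G))) \<and>
     (\<forall>F. closedin E F \<longrightarrow>
        limsup (\<lambda>n. ereal (1 / \<gamma> n) * log_ereal (measure (\<mu> n) F)) \<le> - (INF x\<in>F. I x))"

text \<open>Measurability is required explicitly, since \<^const>\<open>distr\<close> is meaningful only for
  measurable maps.\<close>

definition random_ldp ::
    "'w measure \<Rightarrow> 'a topology \<Rightarrow> (nat \<Rightarrow> 'w \<Rightarrow> 'a) \<Rightarrow> (nat \<Rightarrow> real) \<Rightarrow> ('a \<Rightarrow> ereal) \<Rightarrow> bool" where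
  "random_ldp M E Y \<gamma> I \<longleftrightarrow>
     (\<forall>n. Y n \<in> measurable M (borel_of E)) \<and>
     satisfies_ldp E (\<lambda>n. distr M (borel_of E) (Y n)) \<gamma> I"

text \<open>\<^const>\<open>prob_space.indep_var\<close> only relates random elements with values in the same type;
  this is the same notion without that restriction.\<close>

definition indep_rvs ::
    "'w measure \<Rightarrow> 'a measure \<Rightarrow> ('w \<Rightarrow> 'a) \<Rightarrow> 'b measure \<Rightarrow> ('w \<Rightarrow> 'b) \<Rightarrow> bool" where
  "indep_rvs M M1 Y1 M2 Y2 \<longleftrightarrow>
     Y1 \<in> measurable M M1 \<and> Y2 \<in> measurable M M2 \<and>
     prob_space.indep_set M
       {Y1 -` S \<inter> space M |S. S \<in> sets M1} {Y2 -` S \<inter> space M |S. S \<in> sets M2}"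

section \<open>Path spaces and Gaussian processes\<close>

text \<open>\<open>C([0,T], 'e)\<close> with the topology of the sup-norm. Its points are the continuous functions
  on \<open>[0,T]\<close> that are \<^const>\<open>extensional\<close>, i.e. take a fixed junk value off \<open>[0,T]\<close>;
  hence the restrictions in the operations on paths below.\<close>

definition path_space :: "real \<Rightarrow> (real \<Rightarrow> 'e::euclidean_space) topology" where
  "path_space T = mtopology_of (cfunspace (top_of_set {0..T}) euclidean_metric)"

lemma topspace_path_space:
  "topspace (path_space T :: (real \<Rightarrow> 'e::euclidean_space) topology) =
     {f \<in> extensional {0..T}. continuous_on {0..T} f}"
proof -
  have "bounded (f ` {0..T})" if "continuous_on {0..T} f" for f :: "real \<Rightarrow> 'e"
    using that by (simp add: compact_continuous_image compact_imp_bounded)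
  then show ?thesis
    by (auto simp: path_space_def)
qed

definition coord_path :: "real \<Rightarrow> 'p \<Rightarrow> (real \<Rightarrow> real ^ 'p) \<Rightarrow> real \<Rightarrow> real" where
  "coord_path T i h = (\<lambda>t\<in>{0..T}. h t $ i)"

definition path_diff :: "real \<Rightarrow> (real \<Rightarrow> real) \<Rightarrow> (real \<Rightarrow> real) \<Rightarrow> real \<Rightarrow> real" where
  "path_diff T f g = (\<lambda>t\<in>{0..T}. f t - g t)"

definition path_zero :: "real \<Rightarrow> real \<Rightarrow> real" where
  "path_zero T = (\<lambda>t\<in>{0..T}. 0)"

definition nonneg_orthant :: "(real ^ 'p::finite) topology" where
  "nonneg_orthant = top_of_set {a. \<forall>i. 0 \<le> a $ i}"

text \<open>Point masses count as (degenerate) Gaussian laws.\<close>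

definition gaussian_rv :: "'w measure \<Rightarrow> ('w \<Rightarrow> real) \<Rightarrow> bool" where
  "gaussian_rv M Y \<longleftrightarrow>
     Y \<in> borel_measurable M \<and>
     ((\<exists>\<mu> \<sigma>. 0 < \<sigma> \<and> distributed M lborel Y (normal_density \<mu> \<sigma>)) \<or> (\<exists>c. AE \<omega> in M. Y \<omega> = c))"

definition centered_gaussian_process ::
    "'w measure \<Rightarrow> real \<Rightarrow> ('w \<Rightarrow> real \<Rightarrow> 'e::euclidean_space) \<Rightarrow> bool" where
  "centered_gaussian_process M T X \<longleftrightarrow>
     X \<in> measurable M (borel_of (path_space T)) \<and>
     (\<forall>F c. finite F \<and> F \<subseteq> {0..T} \<longrightarrow> gaussian_rv M (\<lambda>\<omega>. \<Sum>t\<in>F. c t \<bullet> X \<omega> t)) \<and>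
     (\<forall>t\<in>{0..T}. (\<integral>\<omega>. X \<omega> t \<partial>M) = 0)"

definition has_covariance ::
    "'w measure \<Rightarrow> real \<Rightarrow> ('w \<Rightarrow> real \<Rightarrow> real) \<Rightarrow> (real \<Rightarrow> real \<Rightarrow> real) \<Rightarrow> bool" where
  "has_covariance M T U k \<longleftrightarrow> (\<forall>s\<in>{0..T}. \<forall>t\<in>{0..T}. (\<integral>\<omega>. U \<omega> s * U \<omega> t \<partial>M) = k s t)"

section \<open>The reproducing kernel Hilbert space of a Gaussian process\<close>

text \<open>A signed measure on \<open>[0,T]\<close> is written as a difference of two finite measures.\<close>

definition finite_measures_on :: "real \<Rightarrow> real measure set" where
  "finite_measures_on T = {\<mu>. finite_measure \<mu> \<and> sets \<mu> = sets (restrict_space borel {0..T})}"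

definition gaussian_functionals ::
    "'w measure \<Rightarrow> real \<Rightarrow> ('w \<Rightarrow> real \<Rightarrow> real) \<Rightarrow> ('w \<Rightarrow> real) set" where
  "gaussian_functionals M T U =
     {\<lambda>\<omega>. (\<integral>t. U \<omega> t \<partial>\<mu>) - (\<integral>t. U \<omega> t \<partial>\<nu>) |\<mu> \<nu>.
        \<mu> \<in> finite_measures_on T \<and> \<nu> \<in> finite_measures_on T}"

text \<open>The \<open>L\<^sup>2\<close>-closure, as a set of representatives of almost-sure equivalence classes.\<close>

definition gaussian_space ::
    "'w measure \<Rightarrow> real \<Rightarrow> ('w \<Rightarrow> real \<Rightarrow> real) \<Rightarrow> ('w \<Rightarrow> real) set" where
  "gaussian_space M T U =
     {Y \<in> borel_measurable M. integrable M (\<lambda>\<omega>. (Y \<omega>)\<^sup>2) \<and>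
        (\<forall>e>0. \<exists>V\<in>gaussian_functionals M T U. (\<integral>\<^sup>+\<omega>. ennreal ((Y \<omega> - V \<omega>)\<^sup>2) \<partial>M) < e)}"

definition rkhs_map ::
    "'w measure \<Rightarrow> real \<Rightarrow> ('w \<Rightarrow> real \<Rightarrow> real) \<Rightarrow> ('w \<Rightarrow> real) \<Rightarrow> real \<Rightarrow> real" where
  "rkhs_map M T U Y = (\<lambda>t\<in>{0..T}. \<integral>\<omega>. U \<omega> t * Y \<omega> \<partial>M)"

definition rkhs ::
    "'w measure \<Rightarrow> real \<Rightarrow> ('w \<Rightarrow> real \<Rightarrow> real) \<Rightarrow> (real \<Rightarrow> real) set" where
  "rkhs M T U = rkhs_map M T U ` gaussian_space M T U"

text \<open>The \<open>L\<^sup>2\<close>-norm of the preimage; the choice of representative made by \<^const>\<open>inv_into\<close>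
  is immaterial because \<^const>\<open>rkhs_map\<close> is injective up to almost-sure equality on
  \<^const>\<open>gaussian_space\<close>. Although stated for a process, \<^const>\<open>rkhs\<close> and \<open>rkhs_sqnorm\<close> depend
  on it only through its covariance function.\<close>

definition rkhs_sqnorm ::
    "'w measure \<Rightarrow> real \<Rightarrow> ('w \<Rightarrow> real \<Rightarrow> real) \<Rightarrow> (real \<Rightarrow> real) \<Rightarrow> ereal" where
  "rkhs_sqnorm M T U h =
     (if h \<in> rkhs M T U
      then ereal (\<integral>\<omega>. (inv_into (gaussian_space M T U) (rkhs_map M T U) h \<omega>)\<^sup>2 \<partial>M)
      else \<infinity>)"

section \<open>Rate functions\<close>

definition J_rate ::
    "'w measure \<Rightarrow> real \<Rightarrow> ('w \<Rightarrow> real \<Rightarrow> real) \<Rightarrow> (real \<Rightarrow> real) \<Rightarrow> real \<Rightarrow> (real \<Rightarrow> real) \<Rightarrow> ereal" where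
  "J_rate M T U z a b =
     (if a > 0 then ereal (1 / (2 * a\<^sup>2)) * rkhs_sqnorm M T U (path_diff T z b)
      else if path_diff T z b = path_zero T \<and> a = 0 then 0
      else \<infinity>)"

definition joint_rate ::
    "('p::finite \<Rightarrow> 'v measure) \<Rightarrow> real \<Rightarrow> ('p \<Rightarrow> 'v \<Rightarrow> real \<Rightarrow> real) \<Rightarrow>
     ('p \<Rightarrow> real) \<Rightarrow> ('p \<Rightarrow> real) \<Rightarrow> ((real \<Rightarrow> real ^ 'p) \<Rightarrow> ereal) \<Rightarrow>
     ((real ^ 'p) \<times> (real \<Rightarrow> real ^ 'p)) \<times> (real \<Rightarrow> real ^ 'p) \<Rightarrow> ereal" where
  "joint_rate N T U d \<theta> I_B = (\<lambda>((a, b), z).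
     I_B b + (\<Sum>i\<in>UNIV. ereal (d i * (a $ i) powr \<theta> i) +
       J_rate (N i) T (U i) (coord_path T i z) (a $ i) (coord_path T i b)))"

definition psi :: "real \<Rightarrow> real \<Rightarrow> real" where
  "psi d \<theta> = 2 powr (\<theta> / (\<theta> + 2)) *
     (d * (d * \<theta>) powr (- \<theta> / (\<theta> + 2)) + 1 / 2 * (d * \<theta>) powr (2 / (\<theta> + 2)))"

end

theory Submission
  imports Defs
begin

text \<open>
  The process \<open>Z\<close> is a continuous image of \<open>((A, B), X)\<close>: the map that sends \<open>((a, b), x)\<close> to
  \<open>((a, b), z)\<close>, where \<open>z\<close> has the components \<open>a\<^sub>i x\<^sub>i + b\<^sub>i\<close>, is continuous for the sup-norm. All
  three ingredients are independent and have good rate functions, so the theorem is the contraction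
  principle applied to a large deviation principle for a product, followed by a computation of
  infima.

  For the product, \<open>ldp_independent_vector\<close> combines the coordinates of \<open>A\<close>, and
  \<open>ldp_independent_product\<close> adjoins first \<open>B\<close> and then \<open>X\<close>. The upper bound for closed sets rests on
  compactness of the level sets (\<open>upper_bound_by_compact_cover\<close>). Second countability of the
  path space makes the pairs Borel measurable with respect to the product topology.

  In the fibre over \<open>((a, b), z)\<close> the coordinates of \<open>x\<close> with \<open>a\<^sub>i > 0\<close> are determined as
  \<open>(z\<^sub>i - b\<^sub>i) / a\<^sub>i\<close>, and the squared Hilbert space norm is homogeneous of degree two; the coordinates
  with \<open>a\<^sub>i = 0\<close> are free and cost nothing at the zero path. This gives the conditional rate
  (\<open>joint_rate_fibre_inf\<close>). Homogeneity requires that the norm does not depend on the preimage chosen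
  in its definition. Two preimages of one path differ by a variable orthogonal to all \<open>U t\<close>, hence by
  Fubini's theorem to all functionals \<open>\<integral> U d\<lambda>\<close> and to their limits; Fubini's theorem applies since the
  variances of \<open>U\<close> are bounded (\<open>gaussian_process_second_moments\<close>).

  A second contraction, along the projection to \<open>z\<close>, yields the principle for \<open>Z\<close>. Its rate function
  simplifies because the scales of different coordinates can be optimised separately: for \<open>s > 0\<close> the
  minimum of \<open>d a\<^sup>\<theta> + s / a\<^sup>2\<close> over \<open>a > 0\<close> is \<open>\<psi>(d, \<theta>) s\<^bsup>\<theta>/(\<theta>+2)\<^esup>\<close> (\<open>psi_lower_bound\<close>,
  \<open>psi_attained\<close>).
\<close>

section \<open>Borel sets of abstract topologies\<close>

lemma space_borel_of [simp]: "space (borel_of E) = topspace E"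
  unfolding borel_of_def by (rule space_measure_of) (auto dest: openin_subset)

lemma sets_borel_of: "sets (borel_of E) = sigma_sets (topspace E) {S. openin E S}"
  unfolding borel_of_def by (rule sets_measure_of) (auto dest: openin_subset)

lemma borel_of_openin: "openin E S \<Longrightarrow> S \<in> sets (borel_of E)"
  by (simp add: sets_borel_of sigma_sets.Basic)

lemma borel_of_closedin: "closedin E S \<Longrightarrow> S \<in> sets (borel_of E)"
proof -
  assume S: "closedin E S"
  have "topspace E - (topspace E - S) \<in> sets (borel_of E)"
    using S unfolding closedin_def sets_borel_of
    by (intro sigma_sets.Compl sigma_sets.Basic) auto
  then show ?thesis
    using closedin_subset[OF S] by (simp add: double_diff)
qed

lemma measurable_borel_of:
  assumes "f \<in> space M \<rightarrow> topspace E"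
    and "\<And>S. openin E S \<Longrightarrow> {\<omega> \<in> space M. f \<omega> \<in> S} \<in> sets M"
  shows "f \<in> measurable M (borel_of E)"
  unfolding borel_of_def
  using assms by (intro measurable_measure_of) (auto dest: openin_subset simp: vimage_def Int_def conj_commute)

lemma continuous_map_measurable:
  assumes "continuous_map E E' f"
  shows "f \<in> measurable (borel_of E) (borel_of E')"
proof (rule measurable_borel_of)
  show "f \<in> space (borel_of E) \<rightarrow> topspace E'"
    using continuous_map_funspace[OF assms] by simp
  fix S assume "openin E' S"
  then show "{x \<in> space (borel_of E). f x \<in> S} \<in> sets (borel_of E)"
    using openin_continuous_map_preimage[OF assms] by (simp add: borel_of_openin)
qed

lemma second_countable_euclidean:
  "second_countable (euclidean :: 'a::second_countable_topology topology)"
proof -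
  obtain B :: "'a set set" where B: "countable B" "topological_basis B"
    using ex_countable_basis by blast
  show ?thesis
    unfolding second_countable_def
  proof (intro exI conjI ballI allI impI)
    show "countable B" by (fact B)
    show "openin euclidean V" if "V \<in> B" for V
      using topological_basis_open[OF B(2) that] by simp
    show "\<exists>V\<in>B. x \<in> V \<and> V \<subseteq> W" if "openin euclidean W \<and> x \<in> W" for W x
    proof -
      from that have "open W" "x \<in> W" by simp_all
      then obtain V where "V \<in> B" "x \<in> V" "V \<subseteq> W" by (rule topological_basisE[OF B(2)])
      then show ?thesis by blast
    qed
  qed
qed

lemma countable_rectangle_base:
  assumes "second_countable E1" "second_countable E2"
  obtains \<C> where "countable \<C>"
    "\<And>p. p \<in> \<C> \<Longrightarrow> openin E1 (fst p) \<and> openin E2 (snd p)"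
    "\<And>S z. openin (prod_topology E1 E2) S \<Longrightarrow> z \<in> S \<Longrightarrow> \<exists>p\<in>\<C>. z \<in> fst p \<times> snd p \<and> fst p \<times> snd p \<subseteq> S"
proof -
  obtain \<B>1 where B1: "countable \<B>1" "\<And>V. V \<in> \<B>1 \<Longrightarrow> openin E1 V"
    "\<And>U x. openin E1 U \<Longrightarrow> x \<in> U \<Longrightarrow> \<exists>V\<in>\<B>1. x \<in> V \<and> V \<subseteq> U"
    using assms(1) by (auto simp: second_countable_def)
  obtain \<B>2 where B2: "countable \<B>2" "\<And>V. V \<in> \<B>2 \<Longrightarrow> openin E2 V"
    "\<And>U x. openin E2 U \<Longrightarrow> x \<in> U \<Longrightarrow> \<exists>V\<in>\<B>2. x \<in> V \<and> V \<subseteq> U"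
    using assms(2) by (auto simp: second_countable_def)
  show ?thesis
  proof (rule that[of "\<B>1 \<times> \<B>2"])
    show "countable (\<B>1 \<times> \<B>2)" using B1(1) B2(1) by (rule countable_SIGMA)
    show "openin E1 (fst p) \<and> openin E2 (snd p)" if "p \<in> \<B>1 \<times> \<B>2" for p
      using that B1(2)[of "fst p"] B2(2)[of "snd p"] by (simp add: mem_Times_iff)
    fix S z assume S: "openin (prod_topology E1 E2) S" and zS: "z \<in> S"
    obtain x y where z: "z = (x, y)" by fastforce
    have xy: "(x, y) \<in> S" using zS z by simp
    obtain U V where UV: "openin E1 U" "openin E2 V" "x \<in> U" "y \<in> V" "U \<times> V \<subseteq> S"
      using S[unfolded openin_prod_topology_alt, rule_format, OF xy] by blast
    obtain U' where U': "U' \<in> \<B>1" "x \<in> U'" "U' \<subseteq> U" using B1(3)[OF UV(1,3)] by blast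
    obtain V' where V': "V' \<in> \<B>2" "y \<in> V'" "V' \<subseteq> V" using B2(3)[OF UV(2,4)] by blast
    have "U' \<times> V' \<subseteq> S" using U'(3) V'(3) UV(5) by blast
    then show "\<exists>p\<in>\<B>1 \<times> \<B>2. z \<in> fst p \<times> snd p \<and> fst p \<times> snd p \<subseteq> S"
      using U'(1,2) V'(1,2) z by (intro bexI[of _ "(U', V')"]) simp_all
  qed
qed

lemma second_countable_prod_topology:
  assumes "second_countable E1" "second_countable E2"
  shows "second_countable (prod_topology E1 E2)"
proof -
  obtain \<C> where C: "countable \<C>" "\<And>p. p \<in> \<C> \<Longrightarrow> openin E1 (fst p) \<and> openin E2 (snd p)"
    "\<And>S z. openin (prod_topology E1 E2) S \<Longrightarrow> z \<in> S \<Longrightarrow> \<exists>p\<in>\<C>. z \<in> fst p \<times> snd p \<and> fst p \<times> snd p \<subseteq> S"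
    by (rule countable_rectangle_base[OF assms]) (rule that)
  define \<B> where "\<B> = (\<lambda>p. fst p \<times> snd p) ` \<C>"
  have "\<exists>W\<in>\<B>. z \<in> W \<and> W \<subseteq> S" if S: "openin (prod_topology E1 E2) S" and z: "z \<in> S" for S z
  proof -
    obtain p where p: "p \<in> \<C>" "z \<in> fst p \<times> snd p" "fst p \<times> snd p \<subseteq> S"
      using C(3)[OF S z] by blast
    then show ?thesis unfolding \<B>_def by (intro bexI[of _ "fst p \<times> snd p"] conjI imageI)
  qed
  moreover have "openin (prod_topology E1 E2) W" if W: "W \<in> \<B>" for W
  proof -
    obtain p where p: "W = fst p \<times> snd p" "p \<in> \<C>" using W unfolding \<B>_def by (rule imageE)
    then show ?thesis using C(2)[of p] by (simp add: openin_prod_Times_iff)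
  qed
  moreover have "countable \<B>" unfolding \<B>_def using C(1) by (rule countable_image)
  ultimately show ?thesis
    unfolding second_countable_def by (intro exI[of _ \<B>]) simp
qed

text \<open>Every open subset of the product is a countable union of measurable rectangles. In general
  the Borel sets of a product are not generated by rectangles, which is why second countability is
  assumed.\<close>

lemma measurable_Pair_borel_of:
  assumes E1: "second_countable E1" and E2: "second_countable E2"
    and f: "f \<in> measurable M (borel_of E1)" and g: "g \<in> measurable M (borel_of E2)"
  shows "(\<lambda>\<omega>. (f \<omega>, g \<omega>)) \<in> measurable M (borel_of (prod_topology E1 E2))"
proof (rule measurable_borel_of)
  show "(\<lambda>\<omega>. (f \<omega>, g \<omega>)) \<in> space M \<rightarrow> topspace (prod_topology E1 E2)"
    using measurable_space[OF f] measurable_space[OF g] by auto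
  fix S assume S: "openin (prod_topology E1 E2) S"
  obtain \<C> where C: "countable \<C>" "\<And>p. p \<in> \<C> \<Longrightarrow> openin E1 (fst p) \<and> openin E2 (snd p)"
    "\<And>S z. openin (prod_topology E1 E2) S \<Longrightarrow> z \<in> S \<Longrightarrow> \<exists>p\<in>\<C>. z \<in> fst p \<times> snd p \<and> fst p \<times> snd p \<subseteq> S"
    by (rule countable_rectangle_base[OF E1 E2]) (rule that)
  define D where "D = {p \<in> \<C>. fst p \<times> snd p \<subseteq> S}"
  have "z \<in> (\<Union>p\<in>D. fst p \<times> snd p)" if "z \<in> S" for z
  proof -
    obtain p where p: "p \<in> \<C>" "z \<in> fst p \<times> snd p" "fst p \<times> snd p \<subseteq> S"
      using C(3)[OF S \<open>z \<in> S\<close>] by blast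
    then have "p \<in> D" by (simp add: D_def)
    then show ?thesis using p(2) by (rule UN_I)
  qed
  moreover have "(\<Union>p\<in>D. fst p \<times> snd p) \<subseteq> S" by (simp add: D_def UN_subset_iff)
  ultimately have S_eq: "S = (\<Union>p\<in>D. fst p \<times> snd p)" by blast
  have "{\<omega> \<in> space M. f \<omega> \<in> fst p \<and> g \<omega> \<in> snd p} \<in> sets M" if "p \<in> D" for p
  proof -
    have "openin E1 (fst p)" "openin E2 (snd p)"
      using that C(2)[of p] by (simp_all add: D_def)
    then have "f -` fst p \<inter> space M \<in> sets M" "g -` snd p \<inter> space M \<in> sets M"
      using f g by (auto intro!: measurable_sets borel_of_openin)
    then have "(f -` fst p \<inter> space M) \<inter> (g -` snd p \<inter> space M) \<in> sets M" by blast
    then show ?thesis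
      by (rule back_subst[of "\<lambda>A. A \<in> sets M"]) auto
  qed
  moreover have "countable D" using C(1) by (simp add: D_def)
  ultimately have "(\<Union>p\<in>D. {\<omega> \<in> space M. f \<omega> \<in> fst p \<and> g \<omega> \<in> snd p}) \<in> sets M"
    by (intro sets.countable_UN') auto
  then show "{\<omega> \<in> space M. (f \<omega>, g \<omega>) \<in> S} \<in> sets M"
    by (rule back_subst[of "\<lambda>A. A \<in> sets M"]) (auto simp: S_eq)
qed

section \<open>Large deviation bounds as exponential estimates\<close>

lemma scaled_log_less_iff:
  assumes "0 \<le> p" "0 < g"
  shows "ereal (1 / g) * log_ereal p < ereal y \<longleftrightarrow> p < exp (y * g)"
proof (cases "p = 0")
  case True
  then show ?thesis using assms by (simp add: log_ereal_def)
next
  case False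
  then have "ln p / g < y \<longleftrightarrow> ln p < y * g" using assms by (simp add: pos_divide_less_eq)
  also have "\<dots> \<longleftrightarrow> p < exp (y * g)" using False assms
    using ln_less_cancel_iff[of p "exp (y * g)"] by simp
  finally show ?thesis using False by (simp add: log_ereal_def)
qed

lemma less_scaled_log_iff:
  assumes "0 \<le> p" "0 < g"
  shows "ereal y < ereal (1 / g) * log_ereal p \<longleftrightarrow> exp (y * g) < p"
proof (cases "p = 0")
  case True
  then show ?thesis using assms by (simp add: log_ereal_def)
next
  case False
  then have "y < ln p / g \<longleftrightarrow> y * g < ln p" using assms by (simp add: pos_less_divide_eq)
  also have "\<dots> \<longleftrightarrow> exp (y * g) < p" using False assms
    using ln_less_cancel_iff[of "exp (y * g)" p] by simp
  finally show ?thesis using False by (simp add: log_ereal_def)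
qed

lemma limsup_scaled_log_le_iff:
  assumes p: "\<And>n. 0 \<le> p n" and g: "\<And>n. 0 < \<gamma> n"
  shows "limsup (\<lambda>n. ereal (1 / \<gamma> n) * log_ereal (p n)) \<le> - c \<longleftrightarrow>
    (\<forall>\<alpha>. ereal \<alpha> < c \<longrightarrow> (\<forall>\<^sub>F n in sequentially. p n \<le> exp (- \<alpha> * \<gamma> n)))"
    (is "?L \<longleftrightarrow> ?R")
proof
  assume L: ?L
  show ?R
  proof (intro allI impI)
    fix \<alpha> assume "ereal \<alpha> < c"
    then have "- c < ereal (- \<alpha>)" by (metis ereal_less_uminus_reorder uminus_ereal.simps(1) ereal_uminus_uminus)
    with L have "limsup (\<lambda>n. ereal (1 / \<gamma> n) * log_ereal (p n)) < ereal (- \<alpha>)" by simp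
    then have "\<forall>\<^sub>F n in sequentially. ereal (1 / \<gamma> n) * log_ereal (p n) < ereal (- \<alpha>)"
      by (rule Limsup_lessD)
    then show "\<forall>\<^sub>F n in sequentially. p n \<le> exp (- \<alpha> * \<gamma> n)"
      unfolding scaled_log_less_iff[OF p g] by (rule eventually_mono) simp
  qed
next
  assume R: ?R
  show ?L
    unfolding Limsup_le_iff
  proof (intro allI impI)
    fix y assume "- c < y"
    then obtain x where x: "- c < ereal x" "ereal x < y" using ereal_dense2 by blast
    then have "ereal (- x) < c" by (metis ereal_uminus_less_reorder uminus_ereal.simps(1))
    with R have "\<forall>\<^sub>F n in sequentially. p n \<le> exp (- (- x) * \<gamma> n)" by blast
    then show "\<forall>\<^sub>F n in sequentially. ereal (1 / \<gamma> n) * log_ereal (p n) < y"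
    proof (rule eventually_mono)
      fix n assume "p n \<le> exp (- (- x) * \<gamma> n)"
      then have "\<not> ereal x < ereal (1 / \<gamma> n) * log_ereal (p n)"
        using less_scaled_log_iff[OF p g, of x n n] by simp
      then show "ereal (1 / \<gamma> n) * log_ereal (p n) < y" using x(2) by simp
    qed
  qed
qed

lemma le_liminf_scaled_log_iff:
  assumes p: "\<And>n. 0 \<le> p n" and g: "\<And>n. 0 < \<gamma> n"
  shows "- c \<le> liminf (\<lambda>n. ereal (1 / \<gamma> n) * log_ereal (p n)) \<longleftrightarrow>
    (\<forall>\<beta>. c < ereal \<beta> \<longrightarrow> (\<forall>\<^sub>F n in sequentially. exp (- \<beta> * \<gamma> n) \<le> p n))"
    (is "?L \<longleftrightarrow> ?R")
proof
  assume L: ?L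
  show ?R
  proof (intro allI impI)
    fix \<beta> assume "c < ereal \<beta>"
    then have "ereal (- \<beta>) < - c" by (metis ereal_minus_less_minus uminus_ereal.simps(1))
    with L have "ereal (- \<beta>) < liminf (\<lambda>n. ereal (1 / \<gamma> n) * log_ereal (p n))" by simp
    then have "\<forall>\<^sub>F n in sequentially. ereal (- \<beta>) < ereal (1 / \<gamma> n) * log_ereal (p n)"
      by (rule less_LiminfD)
    then show "\<forall>\<^sub>F n in sequentially. exp (- \<beta> * \<gamma> n) \<le> p n"
      unfolding less_scaled_log_iff[OF p g] by (rule eventually_mono) simp
  qed
next
  assume R: ?R
  show ?L
    unfolding le_Liminf_iff
  proof (intro allI impI)
    fix y assume "y < - c"
    then obtain x where x: "y < ereal x" "ereal x < - c" using ereal_dense2 by blast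
    then have "c < ereal (- x)" by (metis ereal_less_uminus_reorder uminus_ereal.simps(1))
    with R have "\<forall>\<^sub>F n in sequentially. exp (- (- x) * \<gamma> n) \<le> p n" by blast
    then show "\<forall>\<^sub>F n in sequentially. y < ereal (1 / \<gamma> n) * log_ereal (p n)"
    proof (rule eventually_mono)
      fix n assume "exp (- (- x) * \<gamma> n) \<le> p n"
      then have "\<not> ereal (1 / \<gamma> n) * log_ereal (p n) < ereal x"
        using scaled_log_less_iff[OF p g, of n n x] by simp
      then show "y < ereal (1 / \<gamma> n) * log_ereal (p n)" using x(1) by simp
    qed
  qed
qed

text \<open>Passing to exponential estimates for single events turns the extended-real limits into
  statements that multiply under independence and add up over finite unions. In the lower bound
  it is enough to look at one point of the open set.\<close>

lemma random_ldp_iff: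
  assumes M: "prob_space M"
  shows "random_ldp M E Y \<gamma> I \<longleftrightarrow>
    (\<forall>n. Y n \<in> measurable M (borel_of E)) \<and> (\<forall>n. 0 < \<gamma> n) \<and>
    filterlim \<gamma> at_top sequentially \<and> rate_function E I \<and>
    (\<forall>G x \<beta>. openin E G \<longrightarrow> x \<in> G \<longrightarrow> I x < ereal \<beta> \<longrightarrow>
       (\<forall>\<^sub>F n in sequentially. exp (- \<beta> * \<gamma> n) \<le> measure M {\<omega> \<in> space M. Y n \<omega> \<in> G})) \<and>
    (\<forall>F \<alpha> \<alpha>'. closedin E F \<longrightarrow> (\<forall>x\<in>F. ereal \<alpha> \<le> I x) \<longrightarrow> \<alpha>' < \<alpha> \<longrightarrow>
       (\<forall>\<^sub>F n in sequentially. measure M {\<omega> \<in> space M. Y n \<omega> \<in> F} \<le> exp (- \<alpha>' * \<gamma> n)))"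
    (is "_ \<longleftrightarrow> ?mble \<and> ?pos \<and> ?lim \<and> ?rate \<and> ?low \<and> ?up")
proof (cases "?mble \<and> ?pos")
  case False
  then show ?thesis by (auto simp: random_ldp_def satisfies_ldp_def)
next
  case True
  then have mb: "\<And>n. Y n \<in> measurable M (borel_of E)" and g: "\<And>n. 0 < \<gamma> n" by auto
  have P: "prob_space (distr M (borel_of E) (Y n))" for n
    using prob_space.prob_space_distr[OF M mb] .
  have m: "measure (distr M (borel_of E) (Y n)) S = measure M {\<omega> \<in> space M. Y n \<omega> \<in> S}"
    if "S \<in> sets (borel_of E)" for n S
    using measure_distr[OF mb that] by (simp add: vimage_def Int_def conj_commute)
  have low: "(- (INF x\<in>G. I x) \<le> liminf (\<lambda>n. ereal (1 / \<gamma> n) * log_ereal (measure (distr M (borel_of E) (Y n)) G)))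
     \<longleftrightarrow> (\<forall>x \<beta>. x \<in> G \<longrightarrow> I x < ereal \<beta> \<longrightarrow>
       (\<forall>\<^sub>F n in sequentially. exp (- \<beta> * \<gamma> n) \<le> measure M {\<omega> \<in> space M. Y n \<omega> \<in> G}))"
    if G: "openin E G" for G
    unfolding m[OF borel_of_openin[OF G]]
    by (subst le_liminf_scaled_log_iff[OF measure_nonneg g]) (auto simp: INF_less_iff)
  have up: "(limsup (\<lambda>n. ereal (1 / \<gamma> n) * log_ereal (measure (distr M (borel_of E) (Y n)) F)) \<le> - (INF x\<in>F. I x))
     \<longleftrightarrow> (\<forall>\<alpha> \<alpha>'. (\<forall>x\<in>F. ereal \<alpha> \<le> I x) \<longrightarrow> \<alpha>' < \<alpha> \<longrightarrow>
       (\<forall>\<^sub>F n in sequentially. measure M {\<omega> \<in> space M. Y n \<omega> \<in> F} \<le> exp (- \<alpha>' * \<gamma> n)))"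
    (is "?l \<longleftrightarrow> ?r") if F: "closedin E F" for F
  proof -
    have "?l \<longleftrightarrow> (\<forall>\<alpha>'. ereal \<alpha>' < (INF x\<in>F. I x) \<longrightarrow>
       (\<forall>\<^sub>F n in sequentially. measure M {\<omega> \<in> space M. Y n \<omega> \<in> F} \<le> exp (- \<alpha>' * \<gamma> n)))"
      unfolding m[OF borel_of_closedin[OF F]]
      by (rule limsup_scaled_log_le_iff[OF measure_nonneg g])
    also have "\<dots> \<longleftrightarrow> ?r"
    proof (intro iffI allI impI)
      fix \<alpha> \<alpha>' :: real
      assume *: "\<forall>\<alpha>'. ereal \<alpha>' < (INF x\<in>F. I x) \<longrightarrow>
       (\<forall>\<^sub>F n in sequentially. measure M {\<omega> \<in> space M. Y n \<omega> \<in> F} \<le> exp (- \<alpha>' * \<gamma> n))"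
        and "\<forall>x\<in>F. ereal \<alpha> \<le> I x" "\<alpha>' < \<alpha>"
      then have "ereal \<alpha> \<le> (INF x\<in>F. I x)" by (simp add: INF_greatest)
      with \<open>\<alpha>' < \<alpha>\<close> have "ereal \<alpha>' < (INF x\<in>F. I x)"
        by (metis ereal_less_le less_ereal.simps(1) order_less_le_trans)
      with * show "\<forall>\<^sub>F n in sequentially. measure M {\<omega> \<in> space M. Y n \<omega> \<in> F} \<le> exp (- \<alpha>' * \<gamma> n)"
        by blast
    next
      fix \<alpha>' assume *: ?r and "ereal \<alpha>' < (INF x\<in>F. I x)"
      then obtain \<alpha> where "ereal \<alpha>' < ereal \<alpha>" "ereal \<alpha> < (INF x\<in>F. I x)" using ereal_dense2 by blast
      then have "\<forall>x\<in>F. ereal \<alpha> \<le> I x" "\<alpha>' < \<alpha>"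
        by (auto intro: less_imp_le dest: less_INF_D)
      with * show "\<forall>\<^sub>F n in sequentially. measure M {\<omega> \<in> space M. Y n \<omega> \<in> F} \<le> exp (- \<alpha>' * \<gamma> n)"
        by blast
    qed
    finally show ?thesis .
  qed
  show ?thesis
    unfolding random_ldp_def satisfies_ldp_def using mb g P low up by auto
qed

lemma random_ldpD:
  assumes M: "prob_space M" and ldp: "random_ldp M E Y \<gamma> I"
  shows random_ldp_measurable: "Y n \<in> measurable M (borel_of E)"
    and random_ldp_speed_pos: "0 < \<gamma> n"
    and random_ldp_speed_at_top: "filterlim \<gamma> at_top sequentially"
    and random_ldp_rate: "rate_function E I"
    and random_ldp_lower: "openin E G \<Longrightarrow> x \<in> G \<Longrightarrow> I x < ereal \<beta> \<Longrightarrow>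
       \<forall>\<^sub>F n in sequentially. exp (- \<beta> * \<gamma> n) \<le> measure M {\<omega> \<in> space M. Y n \<omega> \<in> G}"
  using ldp unfolding random_ldp_iff[OF M] by simp_all

lemma random_ldp_upper:
  assumes M: "prob_space M" and ldp: "random_ldp M E Y \<gamma> I"
    and F: "closedin E F" "\<And>x. x \<in> F \<Longrightarrow> ereal \<alpha> \<le> I x" "\<alpha>' < \<alpha>"
  shows "\<forall>\<^sub>F n in sequentially. measure M {\<omega> \<in> space M. Y n \<omega> \<in> F} \<le> exp (- \<alpha>' * \<gamma> n)"
proof -
  have "\<forall>F \<alpha> \<alpha>'. closedin E F \<longrightarrow> (\<forall>x\<in>F. ereal \<alpha> \<le> I x) \<longrightarrow> \<alpha>' < \<alpha> \<longrightarrow>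
      (\<forall>\<^sub>F n in sequentially. measure M {\<omega> \<in> space M. Y n \<omega> \<in> F} \<le> exp (- \<alpha>' * \<gamma> n))"
    using ldp unfolding random_ldp_iff[OF M] by (elim conjE)
  from this[rule_format, OF F] show ?thesis .
qed

lemma prob_le_exp:
  assumes "prob_space M" "\<alpha> < 0" "0 < g"
  shows "measure M S \<le> exp (- \<alpha> * g)"
proof -
  have "0 \<le> - \<alpha> * g" using assms(2,3) by (simp add: mult_nonpos_nonneg less_imp_le)
  then have "1 \<le> exp (- \<alpha> * g)" by (simp only: one_le_exp_iff)
  then show ?thesis using order_trans[OF prob_space.prob_le_1[OF assms(1)]] by blast
qed

text \<open>The union over \<open>J\<close> costs the constant factor \<open>card J\<close>, which any loss in the rate
  absorbs because the speed tends to infinity.\<close>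

lemma eventually_sum_le_exp:
  assumes J: "finite J" and g: "filterlim \<gamma> at_top sequentially"
    and p: "\<And>j. j \<in> J \<Longrightarrow> \<forall>\<^sub>F n in sequentially. p j n \<le> exp (- \<alpha> * \<gamma> n)" and less: "\<alpha>' < \<alpha>"
  shows "\<forall>\<^sub>F n in sequentially. (\<Sum>j\<in>J. p j n) \<le> exp (- \<alpha>' * \<gamma> n :: real)"
proof -
  have "\<forall>\<^sub>F n in sequentially. \<forall>j\<in>J. p j n \<le> exp (- \<alpha> * \<gamma> n)"
    using J p by (simp add: eventually_ball_finite)
  moreover have "\<forall>\<^sub>F n in sequentially. real (card J) / (\<alpha> - \<alpha>') \<le> \<gamma> n"
    using g by (simp add: filterlim_at_top)
  ultimately show ?thesis
  proof eventually_elim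
    case (elim n)
    have "real (card J) \<le> (\<alpha> - \<alpha>') * \<gamma> n"
      using elim(2) less by (simp add: pos_divide_le_eq mult.commute)
    also have "\<dots> \<le> exp ((\<alpha> - \<alpha>') * \<gamma> n)"
      using exp_ge_add_one_self[of "(\<alpha> - \<alpha>') * \<gamma> n"] by linarith
    finally have c: "real (card J) \<le> exp ((\<alpha> - \<alpha>') * \<gamma> n)" .
    have "(\<Sum>j\<in>J. p j n) \<le> real (card J) * exp (- \<alpha> * \<gamma> n)"
      using elim(1) by (intro sum_bounded_above) auto
    also have "\<dots> \<le> exp ((\<alpha> - \<alpha>') * \<gamma> n) * exp (- \<alpha> * \<gamma> n)"
      using c by (intro mult_right_mono) auto
    also have "\<dots> = exp (- \<alpha>' * \<gamma> n)"
      by (simp add: exp_add[symmetric] algebra_simps)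
    finally show ?case .
  qed
qed

section \<open>Upper bounds from compact covers\<close>

lemma less_add_ereal_split:
  fixes x y :: ereal
  assumes "0 \<le> x" "0 \<le> y" "ereal a < x + y"
  obtains u v where "ereal u < x" "ereal v < y" "a < u + v"
proof -
  consider (xinf) "x = \<infinity>" | (yinf) "y = \<infinity>" | (fin) r s where "x = ereal r" "y = ereal s"
    using assms(1,2) by (cases x; cases y) auto
  then show ?thesis
  proof cases
    case xinf
    with assms(2) show ?thesis
      by (intro that[of "a + 2" "- 1"]) (auto intro: order_less_le_trans[of _ 0])
  next
    case yinf
    with assms(1) show ?thesis
      by (intro that[of "- 1" "a + 2"]) (auto intro: order_less_le_trans[of _ 0])
  next
    case fin
    with assms(3) have "a < r + s" by simp
    with fin show ?thesis
      by (intro that[of "r - (r + s - a) / 3" "s - (r + s - a) / 3"]) (auto simp: field_simps)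
  qed
qed

text \<open>Finitely many of the small neighbourhoods cover \<open>K\<close>. The part of \<open>F\<close> inside their union is
  handled by the local estimates, the part outside by the estimate for the complement of an open
  set around \<open>K\<close>. Both product theorems below reduce to this.\<close>

lemma upper_bound_by_compact_cover:
  assumes M: "prob_space M" and Y: "\<And>n. Y n \<in> measurable M (borel_of E)"
    and g: "filterlim \<gamma> at_top sequentially"
    and K: "compactin E K" and F: "closedin E F"
    and tail: "\<And>W. openin E W \<Longrightarrow> K \<subseteq> W \<Longrightarrow>
      \<forall>\<^sub>F n in sequentially. measure M {\<omega> \<in> space M. Y n \<omega> \<notin> W} \<le> exp (- \<alpha> * \<gamma> n)"
    and loc: "\<And>x. x \<in> K \<Longrightarrow> \<exists>V. openin E V \<and> x \<in> V \<and>
      (\<forall>\<^sub>F n in sequentially. measure M {\<omega> \<in> space M. Y n \<omega> \<in> V \<inter> F} \<le> exp (- \<alpha> * \<gamma> n))"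
    and less: "\<alpha>' < \<alpha>"
  shows "\<forall>\<^sub>F n in sequentially. measure M {\<omega> \<in> space M. Y n \<omega> \<in> F} \<le> exp (- \<alpha>' * \<gamma> n :: real)"
proof -
  interpret prob_space M by fact
  obtain V where V: "\<And>x. x \<in> K \<Longrightarrow> openin E (V x)" "\<And>x. x \<in> K \<Longrightarrow> x \<in> V x"
    "\<And>x. x \<in> K \<Longrightarrow> \<forall>\<^sub>F n in sequentially. measure M {\<omega> \<in> space M. Y n \<omega> \<in> V x \<inter> F} \<le> exp (- \<alpha> * \<gamma> n)"
    using bchoice[of K "\<lambda>x V. openin E V \<and> x \<in> V \<and>
      (\<forall>\<^sub>F n in sequentially. measure M {\<omega> \<in> space M. Y n \<omega> \<in> V \<inter> F} \<le> exp (- \<alpha> * \<gamma> n))"] loc by blast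
  have "\<exists>\<F>. finite \<F> \<and> \<F> \<subseteq> V ` K \<and> K \<subseteq> \<Union>\<F>"
  proof -
    have "(\<forall>U\<in>V ` K. openin E U) \<and> K \<subseteq> \<Union>(V ` K)" using V(1,2) by blast
    then show ?thesis using K[unfolded compactin_def] by blast
  qed
  then obtain D where D: "finite D" "D \<subseteq> K" "K \<subseteq> (\<Union>x\<in>D. V x)"
    by (metis finite_subset_image)
  define W where "W = (\<Union>x\<in>D. V x)"
  have W: "openin E W" "K \<subseteq> W"
    using V(1) D by (auto simp: W_def)
  have mW: "{\<omega> \<in> space M. Y n \<omega> \<notin> W} \<in> sets M" for n
    using measurable_sets[OF Y borel_of_openin[OF W(1)], of n]
    by (auto simp: vimage_def Int_def conj_commute intro: sets.sets_Collect_neg)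
  have mV: "{\<omega> \<in> space M. Y n \<omega> \<in> V x \<inter> F} \<in> sets M" if "x \<in> D" for n x
    using measurable_sets[OF Y sets.Int[OF borel_of_openin borel_of_closedin[OF F]], of "V x" n] V(1) D(2) that
    by (auto simp: vimage_def Int_def conj_commute)
  define p where "p j n = (case j of None \<Rightarrow> prob {\<omega> \<in> space M. Y n \<omega> \<notin> W}
    | Some x \<Rightarrow> prob {\<omega> \<in> space M. Y n \<omega> \<in> V x \<inter> F})" for j n
  have "\<forall>\<^sub>F n in sequentially. (\<Sum>j\<in>insert None (Some ` D). p j n) \<le> exp (- \<alpha>' * \<gamma> n)"
  proof (rule eventually_sum_le_exp[OF _ g _ less])
    show "\<forall>\<^sub>F n in sequentially. p j n \<le> exp (- \<alpha> * \<gamma> n)" if "j \<in> insert None (Some ` D)" for j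
      using that tail[OF W] V(3) D(2) by (auto simp: p_def)
  qed (use D in auto)
  then show ?thesis
  proof (rule eventually_mono)
    fix n assume le: "(\<Sum>j\<in>insert None (Some ` D). p j n) \<le> exp (- \<alpha>' * \<gamma> n)"
    have sum_eq: "(\<Sum>j\<in>insert None (Some ` D). p j n) = prob {\<omega> \<in> space M. Y n \<omega> \<notin> W} +
        (\<Sum>x\<in>D. prob {\<omega> \<in> space M. Y n \<omega> \<in> V x \<inter> F})"
      using D(1) by (subst sum.insert) (auto simp: p_def sum.reindex)
    have "prob {\<omega> \<in> space M. Y n \<omega> \<in> F} \<le>
        prob ({\<omega> \<in> space M. Y n \<omega> \<notin> W} \<union> (\<Union>x\<in>D. {\<omega> \<in> space M. Y n \<omega> \<in> V x \<inter> F}))"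
      using mW mV D(1) by (intro finite_measure_mono sets.Un sets.finite_UN) (auto simp: W_def)
    also have "\<dots> \<le> prob {\<omega> \<in> space M. Y n \<omega> \<notin> W} + prob (\<Union>x\<in>D. {\<omega> \<in> space M. Y n \<omega> \<in> V x \<inter> F})"
      using mW mV D(1) by (intro measure_Un_le sets.finite_UN) auto
    also have "prob (\<Union>x\<in>D. {\<omega> \<in> space M. Y n \<omega> \<in> V x \<inter> F}) \<le> (\<Sum>x\<in>D. prob {\<omega> \<in> space M. Y n \<omega> \<in> V x \<inter> F})"
      using mV D(1) by (intro finite_measure_subadditive_finite) auto
    finally show "prob {\<omega> \<in> space M. Y n \<omega> \<in> F} \<le> exp (- \<alpha>' * \<gamma> n)"
      using le sum_eq by simp
  qed
qed

text \<open>Semicontinuity bounds the rate below near \<open>x\<close>, but the large deviation upper bound speaks of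
  closed sets; regularity supplies a closed neighbourhood in between.\<close>

lemma local_upper_bound:
  assumes M: "prob_space M" and ldp: "random_ldp M E Y \<gamma> I" and E: "regular_space E"
    and x: "x \<in> topspace E" and u: "ereal u < I x" and less: "u' < u"
  obtains V where "openin E V" "x \<in> V"
    "\<forall>\<^sub>F n in sequentially. measure M {\<omega> \<in> space M. Y n \<omega> \<in> V} \<le> exp (- u' * \<gamma> n)"
proof -
  interpret prob_space M by fact
  have W: "openin E {y \<in> topspace E. ereal u < I y}" (is "openin E ?W")
    using random_ldp_rate[OF M ldp] by (simp add: rate_function_def)
  have xW: "x \<in> ?W" using x u by simp
  obtain V C where VC: "openin E V" "closedin E C" "x \<in> V" "V \<subseteq> C" "C \<subseteq> ?W"
    using E[folded neighbourhood_base_of_closedin, unfolded neighbourhood_base_of, rule_format, OF conjI[OF W xW]]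
    by blast
  have "\<forall>\<^sub>F n in sequentially. prob {\<omega> \<in> space M. Y n \<omega> \<in> C} \<le> exp (- u' * \<gamma> n)"
    using VC(5) by (intro random_ldp_upper[OF M ldp VC(2) _ less]) (auto intro: less_imp_le)
  moreover have "prob {\<omega> \<in> space M. Y n \<omega> \<in> V} \<le> prob {\<omega> \<in> space M. Y n \<omega> \<in> C}" for n
  proof (rule finite_measure_mono)
    show "{\<omega> \<in> space M. Y n \<omega> \<in> C} \<in> events"
      using measurable_sets[OF random_ldp_measurable[OF M ldp] borel_of_closedin[OF VC(2)], of n]
      by (simp add: vimage_def Int_def conj_commute)
  qed (use VC in auto)
  ultimately have "\<forall>\<^sub>F n in sequentially. prob {\<omega> \<in> space M. Y n \<omega> \<in> V} \<le> exp (- u' * \<gamma> n)"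
    by (auto elim!: eventually_mono intro: order_trans)
  with VC show ?thesis by (intro that) auto
qed

lemma upper_bound_outside_level_set:
  assumes M: "prob_space M" and ldp: "random_ldp M E Y \<gamma> I"
    and W: "openin E W" "{x \<in> topspace E. I x \<le> ereal \<alpha>} \<subseteq> W" and less: "\<alpha>' < \<alpha>"
  shows "\<forall>\<^sub>F n in sequentially. measure M {\<omega> \<in> space M. Y n \<omega> \<notin> W} \<le> exp (- \<alpha>' * \<gamma> n)"
proof -
  have "closedin E (topspace E - W)" using W(1) by blast
  moreover have "ereal \<alpha> \<le> I x" if "x \<in> topspace E - W" for x using that W(2) by force
  ultimately have "\<forall>\<^sub>F n in sequentially. measure M {\<omega> \<in> space M. Y n \<omega> \<in> topspace E - W} \<le> exp (- \<alpha>' * \<gamma> n)"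
    using less by (rule random_ldp_upper[OF M ldp])
  moreover have "{\<omega> \<in> space M. Y n \<omega> \<in> topspace E - W} = {\<omega> \<in> space M. Y n \<omega> \<notin> W}" for n
    using measurable_space[OF random_ldp_measurable[OF M ldp]] by auto
  ultimately show ?thesis by simp
qed

section \<open>Products of independent sequences\<close>

lemma good_rate_function_product:
  assumes g1: "good_rate_function E1 I1" and g2: "good_rate_function E2 I2"
  shows "good_rate_function (prod_topology E1 E2) (\<lambda>(x, y). I1 x + I2 y)"
proof -
  let ?I = "\<lambda>(x, y). I1 x + I2 y"
  have nn: "\<And>x. x \<in> topspace E1 \<Longrightarrow> 0 \<le> I1 x" "\<And>y. y \<in> topspace E2 \<Longrightarrow> 0 \<le> I2 y"
    and lsc: "\<And>a. openin E1 {x \<in> topspace E1. a < I1 x}" "\<And>a. openin E2 {x \<in> topspace E2. a < I2 x}"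
    and cpt: "\<And>a. 0 \<le> a \<Longrightarrow> compactin E1 {x \<in> topspace E1. I1 x \<le> ereal a}"
      "\<And>a. 0 \<le> a \<Longrightarrow> compactin E2 {x \<in> topspace E2. I2 x \<le> ereal a}"
    using g1 g2 by (auto simp: good_rate_function_def rate_function_def)
  have opn: "openin (prod_topology E1 E2) {p \<in> topspace (prod_topology E1 E2). a < ?I p}" for a
    unfolding openin_prod_topology_alt
  proof (intro allI impI)
    fix x y assume "(x, y) \<in> {p \<in> topspace (prod_topology E1 E2). a < ?I p}"
    then have xy: "x \<in> topspace E1" "y \<in> topspace E2" "a < I1 x + I2 y" by auto
    obtain a' where a': "a \<le> ereal a'" "ereal a' < I1 x + I2 y"
      using ereal_dense2[OF xy(3)] less_imp_le by blast
    obtain u v where uv: "ereal u < I1 x" "ereal v < I2 y" "a' < u + v"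
      using less_add_ereal_split[OF nn(1)[OF xy(1)] nn(2)[OF xy(2)] a'(2)] by blast
    have "a < I1 x' + I2 y'" if "ereal u < I1 x'" "ereal v < I2 y'" for x' y'
    proof -
      have "a \<le> ereal a'" by (fact a')
      also have "ereal a' < ereal u + ereal v" using uv(3) by simp
      also have "\<dots> \<le> I1 x' + I2 y'" using that by (intro add_mono less_imp_le)
      finally show ?thesis .
    qed
    then show "\<exists>U V. openin E1 U \<and> openin E2 V \<and> x \<in> U \<and> y \<in> V \<and>
        U \<times> V \<subseteq> {p \<in> topspace (prod_topology E1 E2). a < ?I p}"
      using lsc xy uv
      by (intro exI[of _ "{x \<in> topspace E1. ereal u < I1 x}"] exI[of _ "{x \<in> topspace E2. ereal v < I2 x}"]) auto
  qed
  have "compactin (prod_topology E1 E2) {p \<in> topspace (prod_topology E1 E2). ?I p \<le> ereal a}" if a: "0 \<le> a" for a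
  proof (rule closed_compactin)
    show "compactin (prod_topology E1 E2) ({x \<in> topspace E1. I1 x \<le> ereal a} \<times> {x \<in> topspace E2. I2 x \<le> ereal a})"
      unfolding compactin_Times using cpt[OF a] by blast
    show "{p \<in> topspace (prod_topology E1 E2). ?I p \<le> ereal a} \<subseteq>
        {x \<in> topspace E1. I1 x \<le> ereal a} \<times> {x \<in> topspace E2. I2 x \<le> ereal a}"
      using nn by (auto intro: order_trans[OF add_increasing2] order_trans[OF add_increasing])
    have eq: "{p \<in> topspace (prod_topology E1 E2). ?I p \<le> ereal a} =
      topspace (prod_topology E1 E2) - {p \<in> topspace (prod_topology E1 E2). ereal a < ?I p}" by auto
    show "closedin (prod_topology E1 E2) {p \<in> topspace (prod_topology E1 E2). ?I p \<le> ereal a}"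
      unfolding eq by (rule closedin_diff[OF closedin_topspace opn])
  qed
  then show ?thesis
    using opn nn by (auto simp: good_rate_function_def rate_function_def)
qed

text \<open>For the upper bound at level \<open>\<alpha>\<close> the compact set \<open>{I1 \<le> \<alpha>} \<times> {I2 \<le> \<alpha>}\<close> plays the role that
  exponential tightness plays in the usual proof: by Wallace's theorem every open set around it
  contains an open box \<open>U \<times> V\<close> around it, and leaving \<open>U\<close> or leaving \<open>V\<close> has rate at least \<open>\<alpha>\<close>.
  Near a point of the compact set, independence multiplies the two local estimates.\<close>

theorem ldp_independent_product:
  assumes M: "prob_space M"
    and ldp1: "random_ldp M E1 Y1 \<gamma> I1" and ldp2: "random_ldp M E2 Y2 \<gamma> I2"
    and good1: "good_rate_function E1 I1" and good2: "good_rate_function E2 I2"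
    and reg1: "regular_space E1" and reg2: "regular_space E2"
    and Y: "\<And>n. (\<lambda>\<omega>. (Y1 n \<omega>, Y2 n \<omega>)) \<in> measurable M (borel_of (prod_topology E1 E2))"
    and indep: "\<And>n S1 S2. S1 \<in> sets (borel_of E1) \<Longrightarrow> S2 \<in> sets (borel_of E2) \<Longrightarrow>
      measure M {\<omega> \<in> space M. Y1 n \<omega> \<in> S1 \<and> Y2 n \<omega> \<in> S2} =
      measure M {\<omega> \<in> space M. Y1 n \<omega> \<in> S1} * measure M {\<omega> \<in> space M. Y2 n \<omega> \<in> S2}"
  shows "random_ldp M (prod_topology E1 E2) (\<lambda>n \<omega>. (Y1 n \<omega>, Y2 n \<omega>)) \<gamma> (\<lambda>(x, y). I1 x + I2 y)"
proof -
  interpret prob_space M by fact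
  let ?E = "prod_topology E1 E2" and ?Y = "\<lambda>n \<omega>. (Y1 n \<omega>, Y2 n \<omega>)" and ?I = "\<lambda>(x, y). I1 x + I2 y"
  have Y1: "\<And>n. Y1 n \<in> measurable M (borel_of E1)" and Y2: "\<And>n. Y2 n \<in> measurable M (borel_of E2)"
    and g: "filterlim \<gamma> at_top sequentially" and gpos: "\<And>n. 0 < \<gamma> n"
    using random_ldpD(1-3)[OF M ldp1] random_ldpD(1)[OF M ldp2] by auto
  have nn: "\<And>x. x \<in> topspace E1 \<Longrightarrow> 0 \<le> I1 x" "\<And>y. y \<in> topspace E2 \<Longrightarrow> 0 \<le> I2 y"
    using random_ldp_rate[OF M ldp1] random_ldp_rate[OF M ldp2] by (auto simp: rate_function_def)
  have mE: "{\<omega> \<in> space M. ?Y n \<omega> \<in> S} \<in> events" if "S \<in> sets (borel_of ?E)" for n S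
    using measurable_sets[OF Y that] by (simp add: vimage_def Int_def conj_commute)
  have rate: "rate_function ?E ?I"
    using good_rate_function_product[OF good1 good2] by (simp add: good_rate_function_def)
  have low: "\<forall>\<^sub>F n in sequentially. exp (- \<beta> * \<gamma> n) \<le> prob {\<omega> \<in> space M. ?Y n \<omega> \<in> G}"
    if G: "openin ?E G" "z \<in> G" "?I z < ereal \<beta>" for G z \<beta>
  proof -
    obtain x y where z: "z = (x, y)" by fastforce
    have xy_in: "(x, y) \<in> G" using G(2) z by simp
    obtain U V where UV: "openin E1 U" "openin E2 V" "x \<in> U" "y \<in> V" "U \<times> V \<subseteq> G"
      using G(1)[unfolded openin_prod_topology_alt, rule_format, OF xy_in] by blast
    then have nnx: "0 \<le> I1 x" and nny: "0 \<le> I2 y" using nn openin_subset by blast+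
    have lt: "I1 x + I2 y < ereal \<beta>" using G(3) z by simp
    then obtain r s where rs: "I1 x = ereal r" "I2 y = ereal s" using nnx nny by (cases "I1 x"; cases "I2 y") auto
    define \<delta> where "\<delta> = (\<beta> - r - s) / 2"
    have \<delta>: "0 < \<delta>" using lt rs by (simp add: \<delta>_def)
    have "I1 x < ereal (r + \<delta>)" "I2 y < ereal (s + \<delta>)" using \<delta> rs by simp_all
    from random_ldp_lower[OF M ldp1 UV(1,3) this(1)] random_ldp_lower[OF M ldp2 UV(2,4) this(2)]
    show ?thesis
    proof eventually_elim
      case (elim n)
      have "exp (- \<beta> * \<gamma> n) = exp (- (r + \<delta>) * \<gamma> n) * exp (- (s + \<delta>) * \<gamma> n)"
        unfolding exp_add[symmetric] by (simp add: \<delta>_def field_simps)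
      also have "\<dots> \<le> prob {\<omega> \<in> space M. Y1 n \<omega> \<in> U} * prob {\<omega> \<in> space M. Y2 n \<omega> \<in> V}"
        using elim by (intro mult_mono) auto
      also have "\<dots> = prob {\<omega> \<in> space M. Y1 n \<omega> \<in> U \<and> Y2 n \<omega> \<in> V}"
        using UV by (simp add: indep borel_of_openin)
      also have "\<dots> \<le> prob {\<omega> \<in> space M. ?Y n \<omega> \<in> G}"
        using UV(5) by (intro finite_measure_mono mE borel_of_openin G) auto
      finally show ?case .
    qed
  qed
  have up: "\<forall>\<^sub>F n in sequentially. prob {\<omega> \<in> space M. ?Y n \<omega> \<in> F} \<le> exp (- \<alpha>' * \<gamma> n)"
    if F: "closedin ?E F" "\<forall>z\<in>F. ereal \<alpha> \<le> ?I z" and less: "\<alpha>' < \<alpha>" for F \<alpha> \<alpha>'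
  proof (cases "\<alpha>' < 0")
    case True
    show ?thesis by (intro always_eventually allI prob_le_exp[OF M True gpos])
  next
    case False
    \<comment> \<open>The rate drops from \<open>\<alpha>\<close> to \<open>\<alpha>2\<close> in the tail estimates, to \<open>b\<close> in their sum and to \<open>\<alpha>'\<close> in
      the finite cover.\<close>
    define \<alpha>2 where "\<alpha>2 = (\<alpha>' + \<alpha>) / 2"
    define b where "b = (\<alpha>' + \<alpha>2) / 2"
    have b: "\<alpha>' < b" "b < \<alpha>2" "\<alpha>2 < \<alpha>" "0 \<le> \<alpha>" using less False by (simp_all add: b_def \<alpha>2_def)
    let ?K1 = "{x \<in> topspace E1. I1 x \<le> ereal \<alpha>}" and ?K2 = "{x \<in> topspace E2. I2 x \<le> ereal \<alpha>}"
    have K: "compactin E1 ?K1" "compactin E2 ?K2"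
      using good1 good2 b by (auto simp: good_rate_function_def)
    show ?thesis
    proof (rule upper_bound_by_compact_cover[OF M Y g _ F(1) _ _ b(1)])
      show "compactin ?E (?K1 \<times> ?K2)" using K by (simp add: compactin_Times)
    next
      fix W assume W: "openin ?E W" "?K1 \<times> ?K2 \<subseteq> W"
      obtain U V where UV: "openin E1 U" "openin E2 V" "?K1 \<subseteq> U" "?K2 \<subseteq> V" "U \<times> V \<subseteq> W"
        using Wallace_theorem_prod_topology[OF K W] by blast
      have m1: "{\<omega> \<in> space M. Y1 n \<omega> \<notin> U} \<in> events" "{\<omega> \<in> space M. Y2 n \<omega> \<notin> V} \<in> events" for n
        using measurable_sets[OF Y1 borel_of_openin[OF UV(1)], of n] measurable_sets[OF Y2 borel_of_openin[OF UV(2)], of n]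
        by (auto simp: vimage_def Int_def conj_commute intro: sets.sets_Collect_neg)
      let ?p = "\<lambda>j n. if j then prob {\<omega> \<in> space M. Y1 n \<omega> \<notin> U} else prob {\<omega> \<in> space M. Y2 n \<omega> \<notin> V}"
      have "\<forall>\<^sub>F n in sequentially. ?p j n \<le> exp (- \<alpha>2 * \<gamma> n)" for j
        using upper_bound_outside_level_set[OF M ldp1 UV(1,3) b(3)] upper_bound_outside_level_set[OF M ldp2 UV(2,4) b(3)]
        by (cases j) auto
      then have "\<forall>\<^sub>F n in sequentially. (\<Sum>j\<in>UNIV. ?p j n) \<le> exp (- b * \<gamma> n)"
        by (intro eventually_sum_le_exp[OF _ g _ b(2)]) auto
      then show "\<forall>\<^sub>F n in sequentially. prob {\<omega> \<in> space M. ?Y n \<omega> \<notin> W} \<le> exp (- b * \<gamma> n)"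
      proof (rule eventually_mono)
        fix n assume le: "(\<Sum>j\<in>UNIV. ?p j n) \<le> exp (- b * \<gamma> n)"
        have "prob {\<omega> \<in> space M. ?Y n \<omega> \<notin> W} \<le>
            prob ({\<omega> \<in> space M. Y1 n \<omega> \<notin> U} \<union> {\<omega> \<in> space M. Y2 n \<omega> \<notin> V})"
          using UV(5) m1 by (intro finite_measure_mono) auto
        also have "\<dots> \<le> prob {\<omega> \<in> space M. Y1 n \<omega> \<notin> U} + prob {\<omega> \<in> space M. Y2 n \<omega> \<notin> V}"
          using m1 by (rule measure_Un_le)
        finally show "prob {\<omega> \<in> space M. ?Y n \<omega> \<notin> W} \<le> exp (- b * \<gamma> n)"
          using le by (simp add: UNIV_bool)
      qed
    next
      fix z assume "z \<in> ?K1 \<times> ?K2"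
      then obtain x y where z: "z = (x, y)" and xy: "x \<in> topspace E1" "y \<in> topspace E2" by auto
      show "\<exists>V. openin ?E V \<and> z \<in> V \<and>
        (\<forall>\<^sub>F n in sequentially. prob {\<omega> \<in> space M. ?Y n \<omega> \<in> V \<inter> F} \<le> exp (- b * \<gamma> n))"
      proof (cases "z \<in> F")
        case False
        have "openin ?E (topspace ?E - F)" using F(1) by blast
        moreover have "z \<in> topspace ?E - F" using False xy z by simp
        ultimately show ?thesis by (intro exI[of _ "topspace ?E - F"]) auto
      next
        case True
        then have "ereal \<alpha> \<le> I1 x + I2 y" using F(2) z by auto
        moreover have "ereal b < ereal \<alpha>" using b by simp
        ultimately have "ereal b < I1 x + I2 y" by (rule order_less_le_trans[rotated])
        then obtain u v where uv: "ereal u < I1 x" "ereal v < I2 y" "b < u + v"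
          using less_add_ereal_split[OF nn(1)[OF xy(1)] nn(2)[OF xy(2)]] by blast
        define \<delta> where "\<delta> = (u + v - b) / 2"
        have \<delta>: "0 < \<delta>" using uv by (simp add: \<delta>_def)
        obtain U where U: "openin E1 U" "x \<in> U"
          "\<forall>\<^sub>F n in sequentially. prob {\<omega> \<in> space M. Y1 n \<omega> \<in> U} \<le> exp (- (u - \<delta>) * \<gamma> n)"
          using local_upper_bound[OF M ldp1 reg1 xy(1) uv(1), of "u - \<delta>"] \<delta> by auto
        obtain V where V: "openin E2 V" "y \<in> V"
          "\<forall>\<^sub>F n in sequentially. prob {\<omega> \<in> space M. Y2 n \<omega> \<in> V} \<le> exp (- (v - \<delta>) * \<gamma> n)"
          using local_upper_bound[OF M ldp2 reg2 xy(2) uv(2), of "v - \<delta>"] \<delta> by auto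
        have UV: "openin ?E (U \<times> V)" using U V by (simp add: openin_prod_Times_iff)
        from U(3) V(3) have "\<forall>\<^sub>F n in sequentially. prob {\<omega> \<in> space M. ?Y n \<omega> \<in> (U \<times> V) \<inter> F} \<le> exp (- b * \<gamma> n)"
        proof eventually_elim
          case (elim n)
          have "prob {\<omega> \<in> space M. ?Y n \<omega> \<in> (U \<times> V) \<inter> F} \<le> prob {\<omega> \<in> space M. ?Y n \<omega> \<in> U \<times> V}"
            by (intro finite_measure_mono mE borel_of_openin[OF UV]) auto
          also have "\<dots> = prob {\<omega> \<in> space M. Y1 n \<omega> \<in> U} * prob {\<omega> \<in> space M. Y2 n \<omega> \<in> V}"
            using U V by (simp add: indep[symmetric] borel_of_openin)
          also have "\<dots> \<le> exp (- (u - \<delta>) * \<gamma> n) * exp (- (v - \<delta>) * \<gamma> n)"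
            using elim by (intro mult_mono) auto
          also have "\<dots> = exp (- b * \<gamma> n)"
            unfolding exp_add[symmetric] by (simp add: \<delta>_def field_simps)
          finally show ?case .
        qed
        with UV U V z show ?thesis by (intro exI[of _ "U \<times> V"]) auto
      qed
    qed
  qed
  show ?thesis
    unfolding random_ldp_iff[OF M] using Y g gpos rate low up by simp
qed

section \<open>The contraction principle\<close>

text \<open>The level sets of \<open>I'\<close> are governed by the images of those of \<open>I\<close>, which are compact and hence
  closed: \<open>{I' \<le> a}\<close> lies in the image of \<open>{I \<le> c}\<close> for every \<open>c > a\<close>. The slack \<open>c - a\<close> avoids
  the question whether the infimum over a fibre is attained.\<close>

theorem contraction_principle:
  assumes M: "prob_space M" and ldp: "random_ldp M E Y \<gamma> I" and good: "good_rate_function E I"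
    and f: "continuous_map E E' f" and E': "Hausdorff_space E'"
    and I': "\<And>y. y \<in> topspace E' \<Longrightarrow> I' y = (INF x\<in>{x \<in> topspace E. f x = y}. I x)"
  shows "random_ldp M E' (\<lambda>n \<omega>. f (Y n \<omega>)) \<gamma> I'" and "good_rate_function E' I'"
proof -
  have nn: "0 \<le> I x" if "x \<in> topspace E" for x
    using good that by (auto simp: good_rate_function_def rate_function_def)
  have cpt: "compactin E' (f ` {x \<in> topspace E. I x \<le> ereal c})" if "0 \<le> c" for c
    using good f that by (auto simp: good_rate_function_def intro: image_compactin)
  have nn': "0 \<le> I' y" if "y \<in> topspace E'" for y
    using nn by (auto simp: I'[OF that] intro!: INF_greatest)
  have above: "ereal c \<le> I' y" if "y \<in> topspace E'" "y \<notin> f ` {x \<in> topspace E. I x \<le> ereal c}" for c y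
    using that by (force simp: I'[OF that(1)] intro!: INF_greatest)
  have below: "I' (f x) \<le> I x" if "x \<in> topspace E" for x
    using that continuous_map_funspace[OF f] by (subst I') (auto intro: INF_lower)
  have opn: "openin E' {y \<in> topspace E'. a < I' y}" for a
  proof (cases "a < 0")
    case True
    then have "{y \<in> topspace E'. a < I' y} = topspace E'" using nn' by (auto intro: order_less_le_trans)
    then show ?thesis by simp
  next
    case False
    show ?thesis
    proof (subst openin_subopen, intro ballI)
      fix y assume y: "y \<in> {y \<in> topspace E'. a < I' y}"
      then obtain c where c: "a < ereal c" "ereal c < I' y" using ereal_dense2 by blast
      have "0 \<le> c" using False c(1) by (metis ereal_less_eq(5) less_le_not_le linorder_not_le order_trans)
      let ?T = "topspace E' - f ` {x \<in> topspace E. I x \<le> ereal c}"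
      have "openin E' ?T"
        using compactin_imp_closedin[OF E' cpt[OF \<open>0 \<le> c\<close>]] by blast
      moreover have "y \<in> ?T" using y c(2) below by force
      moreover have "?T \<subseteq> {y \<in> topspace E'. a < I' y}"
        using above[of _ c] c(1) by (auto intro: order_less_le_trans)
      ultimately show "\<exists>T. openin E' T \<and> y \<in> T \<and> T \<subseteq> {y \<in> topspace E'. a < I' y}" by blast
    qed
  qed
  then have rate: "rate_function E' I'" using nn' by (simp add: rate_function_def)
  have "compactin E' {y \<in> topspace E'. I' y \<le> ereal a}" if "0 \<le> a" for a
  proof (rule closed_compactin)
    show "compactin E' (f ` {x \<in> topspace E. I x \<le> ereal (a + 1)})" using that by (intro cpt) simp
    show "{y \<in> topspace E'. I' y \<le> ereal a} \<subseteq> f ` {x \<in> topspace E. I x \<le> ereal (a + 1)}"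
    proof
      fix y assume y: "y \<in> {y \<in> topspace E'. I' y \<le> ereal a}"
      have "ereal a < ereal (a + 1)" by simp
      with y have "\<not> ereal (a + 1) \<le> I' y" by (auto simp del: less_ereal.simps ereal_less_eq dest: order_trans)
      then show "y \<in> f ` {x \<in> topspace E. I x \<le> ereal (a + 1)}"
        using above[of y "a + 1"] y by blast
    qed
    have "{y \<in> topspace E'. I' y \<le> ereal a} = topspace E' - {y \<in> topspace E'. ereal a < I' y}" by auto
    then show "closedin E' {y \<in> topspace E'. I' y \<le> ereal a}"
      by (simp add: closedin_diff opn)
  qed
  with rate show "good_rate_function E' I'" by (simp add: good_rate_function_def)
  have sp: "Y n \<omega> \<in> topspace E" if "\<omega> \<in> space M" for n \<omega>
    using measurable_space[OF random_ldp_measurable[OF M ldp] that] by simp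
  have pre: "{\<omega> \<in> space M. f (Y n \<omega>) \<in> S} = {\<omega> \<in> space M. Y n \<omega> \<in> {x \<in> topspace E. f x \<in> S}}" for n S
    using sp by auto
  have low: "\<forall>\<^sub>F n in sequentially. exp (- \<beta> * \<gamma> n) \<le> measure M {\<omega> \<in> space M. f (Y n \<omega>) \<in> G}"
    if G: "openin E' G" "y \<in> G" "I' y < ereal \<beta>" for G y \<beta>
  proof -
    have y: "y \<in> topspace E'" using G openin_subset by blast
    then obtain x where "x \<in> topspace E" "f x = y" "I x < ereal \<beta>"
      using G(3) by (auto simp: I' INF_less_iff)
    then show ?thesis
      unfolding pre
      using G(2) by (intro random_ldp_lower[OF M ldp openin_continuous_map_preimage[OF f G(1)], of x]) auto
  qed
  have up: "\<forall>\<^sub>F n in sequentially. measure M {\<omega> \<in> space M. f (Y n \<omega>) \<in> F} \<le> exp (- \<alpha>' * \<gamma> n)"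
    if F: "closedin E' F" "\<forall>y\<in>F. ereal \<alpha> \<le> I' y" "\<alpha>' < \<alpha>" for F \<alpha> \<alpha>'
  proof -
    have "ereal \<alpha> \<le> I x" if "x \<in> {x \<in> topspace E. f x \<in> F}" for x
      using that F(2) below[of x] by (auto intro: order_trans)
    then show ?thesis
      unfolding pre by (rule random_ldp_upper[OF M ldp closedin_continuous_map_preimage[OF f F(1)] _ F(3)])
  qed
  have "(\<lambda>\<omega>. f (Y n \<omega>)) \<in> measurable M (borel_of E')" for n
    using measurable_compose[OF random_ldp_measurable[OF M ldp] continuous_map_measurable[OF f]] .
  then show "random_ldp M E' (\<lambda>n \<omega>. f (Y n \<omega>)) \<gamma> I'"
    unfolding random_ldp_iff[OF M]
    using random_ldp_speed_pos[OF M ldp] random_ldp_speed_at_top[OF M ldp] rate low up by simp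
qed

section \<open>Vectors with independent nonnegative components\<close>

lemma openin_orthant_box:
  fixes U :: "'p::finite \<Rightarrow> real set"
  assumes "\<And>i. openin (top_of_set {0..}) (U i)"
  shows "openin nonneg_orthant {a. \<forall>i. a $ i \<in> U i}"
proof -
  obtain S where S: "\<And>i. open (S i)" "\<And>i. U i = {0..} \<inter> S i"
    using assms unfolding openin_open by metis
  have "{a. \<forall>i. a $ i \<in> U i} = {a. \<forall>i. 0 \<le> a $ i} \<inter> {a. \<forall>i. a $ i \<in> S i}"
    using S(2) by auto
  then show ?thesis
    unfolding nonneg_orthant_def using open_vector_box[of S] S(1) by (auto simp: openin_open)
qed

lemma orthant_box_nbhd:
  fixes a :: "real ^ 'p::finite"
  assumes "openin nonneg_orthant G" "a \<in> G"
  obtains U where "\<And>i. openin (top_of_set {0..}) (U i)" "\<And>i. a $ i \<in> U i"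
    "{a. \<forall>i. a $ i \<in> U i} \<subseteq> G"
proof -
  obtain S where S: "open S" "G = {a. \<forall>i. 0 \<le> a $ i} \<inter> S"
    using assms(1) unfolding nonneg_orthant_def openin_open by blast
  then have "a \<in> S" and a0: "\<And>i. 0 \<le> a $ i" using assms(2) by auto
  then obtain B where B: "\<forall>i. open (B i) \<and> a $ i \<in> B i" "\<forall>y. (\<forall>i. y $ i \<in> B i) \<longrightarrow> y \<in> S"
    using S(1) unfolding open_vec_def by blast
  show ?thesis
  proof (rule that[of "\<lambda>i. {0..} \<inter> B i"])
    show "openin (top_of_set {0..}) ({0..} \<inter> B i)" for i using B(1) by (auto simp: openin_open)
    show "a $ i \<in> {0..} \<inter> B i" for i using B(1) a0 by simp
    show "{a. \<forall>i. a $ i \<in> {0..} \<inter> B i} \<subseteq> G" using B(2) S(2) by auto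
  qed
qed

lemma rate_function_orthant_sum:
  fixes J :: "'p::finite \<Rightarrow> real \<Rightarrow> real"
  assumes J: "\<And>i. rate_function (top_of_set {0..}) (\<lambda>x. ereal (J i x))"
  shows "rate_function nonneg_orthant (\<lambda>a. ereal (\<Sum>i\<in>UNIV. J i (a $ i)))"
proof -
  have nn: "0 \<le> J i x" if "0 \<le> x" for i x
    using J[of i] that by (auto simp: rate_function_def)
  have lsc: "openin (top_of_set {0..}) {x \<in> {0..}. ereal u < ereal (J i x)}" for i u
    using J[of i] by (simp only: rate_function_def topspace_euclidean_subtopology)
  have "openin nonneg_orthant {a \<in> topspace nonneg_orthant. c < ereal (\<Sum>i\<in>UNIV. J i (a $ i))}" for c
  proof (cases c)
    case (real r)
    show ?thesis
    proof (subst openin_subopen, intro ballI)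
      fix a assume "a \<in> {a \<in> topspace nonneg_orthant. c < ereal (\<Sum>i\<in>UNIV. J i (a $ i))}"
      then have a: "\<And>i. 0 \<le> a $ i" "r < (\<Sum>i\<in>UNIV. J i (a $ i))"
        using real by (auto simp: nonneg_orthant_def)
      define \<delta> where "\<delta> = ((\<Sum>i\<in>UNIV. J i (a $ i)) - r) / CARD('p)"
      have \<delta>: "0 < \<delta>" using a(2) by (simp add: \<delta>_def)
      let ?V = "{b. \<forall>i. b $ i \<in> {x \<in> {0..}. ereal (J i (a $ i) - \<delta>) < ereal (J i x)}}"
      have "r < (\<Sum>i\<in>UNIV. J i (b $ i))" if "b \<in> ?V" for b
      proof -
        have "r = (\<Sum>i\<in>UNIV. J i (a $ i) - \<delta>)" by (simp add: sum_subtractf \<delta>_def)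
        also have "\<dots> < (\<Sum>i\<in>UNIV. J i (b $ i))" using that by (intro sum_strict_mono) auto
        finally show ?thesis .
      qed
      then have "?V \<subseteq> {a \<in> topspace nonneg_orthant. c < ereal (\<Sum>i\<in>UNIV. J i (a $ i))}"
        using real by (auto simp: nonneg_orthant_def)
      moreover have "a \<in> ?V" using a \<delta> by simp
      moreover have "openin nonneg_orthant ?V" by (intro openin_orthant_box lsc)
      ultimately show "\<exists>T. openin nonneg_orthant T \<and> a \<in> T \<and>
          T \<subseteq> {a \<in> topspace nonneg_orthant. c < ereal (\<Sum>i\<in>UNIV. J i (a $ i))}" by blast
    qed
  qed auto
  moreover have "0 \<le> ereal (\<Sum>i\<in>UNIV. J i (a $ i))" if "a \<in> topspace nonneg_orthant" for a
    using that nn by (auto simp: nonneg_orthant_def intro!: sum_nonneg)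
  ultimately show ?thesis by (simp add: rate_function_def)
qed

lemma good_rate_functions_uniform_bound:
  fixes J :: "'p::finite \<Rightarrow> real \<Rightarrow> real"
  assumes good: "\<And>i. good_rate_function (top_of_set {0..}) (\<lambda>x. ereal (J i x))" and \<alpha>: "0 \<le> \<alpha>"
  shows "\<exists>c\<ge>0. \<forall>i x. c \<le> x \<longrightarrow> \<alpha> < J i x"
proof -
  have "\<exists>c. \<forall>x\<ge>0. J i x \<le> \<alpha> \<longrightarrow> x \<le> c" for i
  proof -
    have "compactin (top_of_set {0..}) {x \<in> {0..}. ereal (J i x) \<le> ereal \<alpha>}"
      using good[of i] \<alpha> unfolding good_rate_function_def topspace_euclidean_subtopology by blast
    then have "bounded {x \<in> {0..}. J i x \<le> \<alpha>}"
      by (simp add: compactin_subtopology compact_imp_bounded)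
    then obtain c where "\<forall>x\<in>{x \<in> {0..}. J i x \<le> \<alpha>}. norm x \<le> c" unfolding bounded_iff by blast
    then show ?thesis by (intro exI[of _ c]) auto
  qed
  then obtain c where c: "\<And>i x. 0 \<le> x \<Longrightarrow> J i x \<le> \<alpha> \<Longrightarrow> x \<le> c i" by metis
  let ?c = "1 + (\<Sum>i\<in>UNIV. \<bar>c i\<bar>)"
  have le: "\<bar>c i\<bar> \<le> (\<Sum>i\<in>UNIV. \<bar>c i\<bar>)" for i by (intro member_le_sum) auto
  show ?thesis
  proof (intro exI[of _ ?c] conjI allI impI)
    show "0 \<le> ?c" by (simp add: sum_nonneg)
    fix i x assume "?c \<le> x"
    then have "0 \<le> x" "c i < x" using le[of i] by linarith+
    then show "\<alpha> < J i x" using c[of x i] by linarith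
  qed
qed

lemma good_rate_function_orthant_sum:
  fixes J :: "'p::finite \<Rightarrow> real \<Rightarrow> real"
  assumes good: "\<And>i. good_rate_function (top_of_set {0..}) (\<lambda>x. ereal (J i x))"
  shows "good_rate_function nonneg_orthant (\<lambda>a. ereal (\<Sum>i\<in>UNIV. J i (a $ i)))"
proof -
  let ?I = "\<lambda>a. ereal (\<Sum>i\<in>UNIV. J i (a $ i))"
  have rate: "rate_function nonneg_orthant ?I"
    using good by (intro rate_function_orthant_sum) (simp add: good_rate_function_def)
  have nn: "0 \<le> J i x" if "0 \<le> x" for i x
    using good[of i] that by (auto simp: good_rate_function_def rate_function_def)
  have "compactin nonneg_orthant {a \<in> topspace nonneg_orthant. ?I a \<le> ereal \<alpha>}" if \<alpha>: "0 \<le> \<alpha>" for \<alpha>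
  proof -
    obtain c where c: "0 \<le> c" "\<And>i x. c \<le> x \<Longrightarrow> \<alpha> < J i x"
      using good_rate_functions_uniform_bound[where J = J, OF good \<alpha>] by auto
    show ?thesis
    proof (rule closed_compactin)
      show "compactin nonneg_orthant (cbox 0 (\<chi> i. c))"
        by (auto simp: nonneg_orthant_def compactin_subtopology mem_box_cart)
      show "{a \<in> topspace nonneg_orthant. ?I a \<le> ereal \<alpha>} \<subseteq> cbox 0 (\<chi> i. c)"
      proof
        fix a assume "a \<in> {a \<in> topspace nonneg_orthant. ?I a \<le> ereal \<alpha>}"
        then have a: "\<And>i. 0 \<le> a $ i" "(\<Sum>i\<in>UNIV. J i (a $ i)) \<le> \<alpha>" by (auto simp: nonneg_orthant_def)
        have "J i (a $ i) \<le> (\<Sum>i\<in>UNIV. J i (a $ i))" for i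
          by (intro member_le_sum) (auto simp: a nn)
        then have "\<not> c \<le> a $ i" for i using c(2)[of "a $ i" i] a(2) by (meson not_less order_trans)
        then show "a \<in> cbox 0 (\<chi> i. c)" using a(1) by (auto simp: mem_box_cart not_le intro: less_imp_le)
      qed
      have eq: "{a \<in> topspace nonneg_orthant. ?I a \<le> ereal \<alpha>} =
        topspace nonneg_orthant - {a \<in> topspace nonneg_orthant. ereal \<alpha> < ?I a}" by auto
      show "closedin nonneg_orthant {a \<in> topspace nonneg_orthant. ?I a \<le> ereal \<alpha>}"
        unfolding eq using rate[unfolded rate_function_def] by (intro closedin_diff closedin_topspace) blast
    qed
  qed
  with rate show ?thesis by (simp add: good_rate_function_def)
qed

text \<open>The components live in one space \<open>\<real>\<^sup>p\<close>, so this is not literally an iterated product. The cube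
  \<open>[0, c]\<^sup>p\<close> serves as the compact set: outside of it one coordinate is at least \<open>c\<close>, and \<open>c\<close> is
  chosen so large that this alone has rate above \<open>\<alpha>\<close>.\<close>

theorem ldp_independent_vector:
  fixes A :: "nat \<Rightarrow> 'w \<Rightarrow> real ^ 'p::finite" and J :: "'p \<Rightarrow> real \<Rightarrow> real"
  assumes M: "prob_space M" and A: "\<And>n. A n \<in> measurable M (borel_of nonneg_orthant)"
    and indep: "\<And>n. prob_space.indep_vars M (\<lambda>i. borel) (\<lambda>i \<omega>. A n \<omega> $ i) UNIV"
    and ldp: "\<And>i. random_ldp M (top_of_set {0..}) (\<lambda>n \<omega>. A n \<omega> $ i) \<gamma> (\<lambda>x. ereal (J i x))"
    and good: "\<And>i. good_rate_function (top_of_set {0..}) (\<lambda>x. ereal (J i x))"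
  shows "random_ldp M nonneg_orthant A \<gamma> (\<lambda>a. ereal (\<Sum>i\<in>UNIV. J i (a $ i)))"
proof -
  interpret prob_space M by fact
  let ?I = "\<lambda>a. ereal (\<Sum>i\<in>UNIV. J i (a $ i))"
  note gpos = random_ldp_speed_pos[OF M ldp] and g = random_ldp_speed_at_top[OF M ldp]
  have mA: "{\<omega> \<in> space M. A n \<omega> \<in> S} \<in> events" if "S \<in> sets (borel_of nonneg_orthant)" for n S
    using measurable_sets[OF A that] by (simp add: vimage_def Int_def conj_commute)
  have A0: "0 \<le> A n \<omega> $ i" if "\<omega> \<in> space M" for n \<omega> i
    using measurable_space[OF A that] by (simp add: nonneg_orthant_def)
  have mAi: "{\<omega> \<in> space M. A n \<omega> $ i \<in> S} \<in> events" if "openin (top_of_set {0..}) S" for n i S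
    using measurable_sets[OF random_ldp_measurable[OF M ldp[of i]] borel_of_openin[OF that], of n]
    by (simp add: vimage_def Int_def conj_commute)
  have mA_ge: "{\<omega> \<in> space M. A n \<omega> $ i \<in> {c..}} \<in> events" if "0 \<le> c" for n i c
  proof -
    have "closedin (top_of_set {0..}) {c..}" using that by (intro closed_subset) auto
    from measurable_sets[OF random_ldp_measurable[OF M ldp[of i]] borel_of_closedin[OF this], of n]
    show ?thesis by (simp add: vimage_def Int_def conj_commute)
  qed
  have box: "prob {\<omega> \<in> space M. A n \<omega> \<in> {a. \<forall>i. a $ i \<in> U i}} = (\<Prod>i\<in>UNIV. prob {\<omega> \<in> space M. A n \<omega> $ i \<in> U i})"
    if opn: "\<And>i. openin (top_of_set {0..}) (U i)" for U n
  proof -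
    have "U i \<in> sets borel" for i
    proof -
      obtain S where "open S" "U i = {0..} \<inter> S" using opn[of i] by (auto simp: openin_open)
      then show ?thesis by auto
    qed
    then have "prob (\<Inter>i\<in>UNIV. (\<lambda>\<omega>. A n \<omega> $ i) -` U i \<inter> space M) = (\<Prod>i\<in>UNIV. prob ((\<lambda>\<omega>. A n \<omega> $ i) -` U i \<inter> space M))"
      by (intro indep_varsD_finite[OF indep]) auto
    moreover have "(\<Inter>i\<in>UNIV. (\<lambda>\<omega>. A n \<omega> $ i) -` U i \<inter> space M) = {\<omega> \<in> space M. A n \<omega> \<in> {a. \<forall>i. a $ i \<in> U i}}"
      by auto
    moreover have "(\<lambda>\<omega>. A n \<omega> $ i) -` U i \<inter> space M = {\<omega> \<in> space M. A n \<omega> $ i \<in> U i}" for i by auto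
    ultimately show ?thesis by simp
  qed
  have rate: "rate_function nonneg_orthant ?I"
    using good_rate_function_orthant_sum[where J = J, OF good] by (simp add: good_rate_function_def)
  have low: "\<forall>\<^sub>F n in sequentially. exp (- \<beta> * \<gamma> n) \<le> prob {\<omega> \<in> space M. A n \<omega> \<in> G}"
    if G: "openin nonneg_orthant G" "a \<in> G" "?I a < ereal \<beta>" for G a \<beta>
  proof -
    obtain U where U: "\<And>i. openin (top_of_set {0..}) (U i)" "\<And>i. a $ i \<in> U i"
      "{a. \<forall>i. a $ i \<in> U i} \<subseteq> G" using orthant_box_nbhd[OF G(1,2)] by metis
    define \<delta> where "\<delta> = (\<beta> - (\<Sum>i\<in>UNIV. J i (a $ i))) / CARD('p)"
    have \<delta>: "0 < \<delta>" using G(3) by (simp add: \<delta>_def)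
    have "\<forall>\<^sub>F n in sequentially. exp (- (J i (a $ i) + \<delta>) * \<gamma> n) \<le> prob {\<omega> \<in> space M. A n \<omega> $ i \<in> U i}" for i
      using \<delta> by (intro random_ldp_lower[OF M ldp U(1,2)]) simp
    then have "\<forall>\<^sub>F n in sequentially. \<forall>i. exp (- (J i (a $ i) + \<delta>) * \<gamma> n) \<le> prob {\<omega> \<in> space M. A n \<omega> $ i \<in> U i}"
      by (simp add: eventually_all_finite)
    then show ?thesis
    proof eventually_elim
      case (elim n)
      have "\<beta> = (\<Sum>i\<in>UNIV. J i (a $ i) + \<delta>)" by (simp add: sum.distrib \<delta>_def)
      then have "- \<beta> * \<gamma> n = (\<Sum>i\<in>UNIV. - (J i (a $ i) + \<delta>) * \<gamma> n)"
        by (simp only: sum_distrib_right sum_negf[symmetric] mult_minus_left)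
      then have "exp (- \<beta> * \<gamma> n) = (\<Prod>i\<in>UNIV. exp (- (J i (a $ i) + \<delta>) * \<gamma> n))"
        by (simp only: exp_sum finite_class.finite_UNIV)
      also have "\<dots> \<le> (\<Prod>i\<in>UNIV. prob {\<omega> \<in> space M. A n \<omega> $ i \<in> U i})"
        using elim by (intro prod_mono) (simp only: exp_ge_zero simp_thms)
      also have "\<dots> = prob {\<omega> \<in> space M. A n \<omega> \<in> {a. \<forall>i. a $ i \<in> U i}}" by (rule box[OF U(1), symmetric])
      also have "\<dots> \<le> prob {\<omega> \<in> space M. A n \<omega> \<in> G}"
        using U(3) by (intro finite_measure_mono mA borel_of_openin G) auto
      finally show ?case .
    qed
  qed
  have up: "\<forall>\<^sub>F n in sequentially. prob {\<omega> \<in> space M. A n \<omega> \<in> F} \<le> exp (- \<alpha>' * \<gamma> n)"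
    if F: "closedin nonneg_orthant F" "\<forall>a\<in>F. ereal \<alpha> \<le> ?I a" and less: "\<alpha>' < \<alpha>" for F \<alpha> \<alpha>'
  proof (cases "\<alpha>' < 0")
    case True
    show ?thesis by (intro always_eventually allI prob_le_exp[OF M True gpos])
  next
    case False
    define \<alpha>2 where "\<alpha>2 = (\<alpha>' + \<alpha>) / 2"
    define b where "b = (\<alpha>' + \<alpha>2) / 2"
    have b: "\<alpha>' < b" "b < \<alpha>2" "\<alpha>2 < \<alpha>" "b < \<alpha>" "0 \<le> \<alpha>" using less False by (simp_all add: b_def \<alpha>2_def field_simps)
    obtain c where c: "0 \<le> c" "\<And>i x. c \<le> x \<Longrightarrow> \<alpha> < J i x"
      using good_rate_functions_uniform_bound[where J = J, OF good b(5)] by auto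
    let ?K = "cbox 0 (\<chi> i. c) :: (real ^ 'p) set"
    show ?thesis
    proof (rule upper_bound_by_compact_cover[OF M A g _ F(1) _ _ b(1)])
      show "compactin nonneg_orthant ?K"
        by (auto simp: nonneg_orthant_def compactin_subtopology mem_box_cart)
    next
      fix W assume W: "openin nonneg_orthant W" "?K \<subseteq> W"
      have "\<forall>\<^sub>F n in sequentially. prob {\<omega> \<in> space M. A n \<omega> $ i \<in> {c..}} \<le> exp (- \<alpha>2 * \<gamma> n)" for i
      proof (rule random_ldp_upper[OF M ldp _ _ b(3)])
        show "closedin (top_of_set {0..}) {c..}" using c(1) by (intro closed_subset) auto
        show "ereal \<alpha> \<le> ereal (J i x)" if "x \<in> {c..}" for x using c(2)[of x i] that by simp
      qed
      then have "\<forall>\<^sub>F n in sequentially. (\<Sum>i\<in>UNIV. prob {\<omega> \<in> space M. A n \<omega> $ i \<in> {c..}}) \<le> exp (- b * \<gamma> n)"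
        by (intro eventually_sum_le_exp[OF _ g _ b(2)]) auto
      then show "\<forall>\<^sub>F n in sequentially. prob {\<omega> \<in> space M. A n \<omega> \<notin> W} \<le> exp (- b * \<gamma> n)"
      proof (rule eventually_mono)
        fix n assume le: "(\<Sum>i\<in>UNIV. prob {\<omega> \<in> space M. A n \<omega> $ i \<in> {c..}}) \<le> exp (- b * \<gamma> n)"
        have "\<exists>i. c \<le> A n \<omega> $ i" if "\<omega> \<in> space M" "A n \<omega> \<notin> W" for \<omega>
        proof -
          have "A n \<omega> \<notin> ?K" using that(2) W(2) by blast
          then show ?thesis using A0[OF that(1)] by (auto simp: mem_box_cart) (meson linear)
        qed
        then have "{\<omega> \<in> space M. A n \<omega> \<notin> W} \<subseteq> (\<Union>i\<in>UNIV. {\<omega> \<in> space M. A n \<omega> $ i \<in> {c..}})" by auto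
        then have "prob {\<omega> \<in> space M. A n \<omega> \<notin> W} \<le> prob (\<Union>i\<in>UNIV. {\<omega> \<in> space M. A n \<omega> $ i \<in> {c..}})"
          using mA_ge[OF c(1)] by (intro finite_measure_mono) auto
        also have "\<dots> \<le> (\<Sum>i\<in>UNIV. prob {\<omega> \<in> space M. A n \<omega> $ i \<in> {c..}})"
          using mA_ge[OF c(1)] by (intro finite_measure_subadditive_finite) auto
        finally show "prob {\<omega> \<in> space M. A n \<omega> \<notin> W} \<le> exp (- b * \<gamma> n)" using le by simp
      qed
    next
      fix a assume "a \<in> ?K"
      then have a0: "\<And>i. 0 \<le> a $ i" by (auto simp: mem_box_cart)
      show "\<exists>V. openin nonneg_orthant V \<and> a \<in> V \<and>
        (\<forall>\<^sub>F n in sequentially. prob {\<omega> \<in> space M. A n \<omega> \<in> V \<inter> F} \<le> exp (- b * \<gamma> n))"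
      proof (cases "a \<in> F")
        case False
        have "openin nonneg_orthant (topspace nonneg_orthant - F)" using F(1) by blast
        moreover have "a \<in> topspace nonneg_orthant - F" using False a0 by (simp add: nonneg_orthant_def)
        ultimately show ?thesis by (intro exI[of _ "topspace nonneg_orthant - F"]) auto
      next
        case True
        then have J: "\<alpha> \<le> (\<Sum>i\<in>UNIV. J i (a $ i))" using F(2) by auto
        define \<delta> where "\<delta> = ((\<Sum>i\<in>UNIV. J i (a $ i)) - b) / CARD('p)"
        have \<delta>: "0 < \<delta>" using J b by (simp add: \<delta>_def)
        have ex: "\<forall>i. \<exists>V. openin (top_of_set {0..}) V \<and> a $ i \<in> V \<and>
          (\<forall>\<^sub>F n in sequentially. prob {\<omega> \<in> space M. A n \<omega> $ i \<in> V} \<le> exp (- (J i (a $ i) - \<delta>) * \<gamma> n))"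
        proof (rule allI)
          fix i
          show "\<exists>V. openin (top_of_set {0..}) V \<and> a $ i \<in> V \<and>
          (\<forall>\<^sub>F n in sequentially. prob {\<omega> \<in> space M. A n \<omega> $ i \<in> V} \<le> exp (- (J i (a $ i) - \<delta>) * \<gamma> n))"
          proof (rule local_upper_bound[OF M ldp[of i], where x = "a $ i"
              and u = "J i (a $ i) - \<delta> / 2" and u' = "J i (a $ i) - \<delta>"])
          show "regular_space (top_of_set {0::real..})"
            by (intro metrizable_imp_regular_space metrizable_space_subtopology metrizable_space_euclidean)
          qed (use a0 \<delta> in auto)
        qed
        from choice[OF ex] obtain U where "\<forall>i. openin (top_of_set {0..}) (U i) \<and> a $ i \<in> U i \<and>
          (\<forall>\<^sub>F n in sequentially. prob {\<omega> \<in> space M. A n \<omega> $ i \<in> U i} \<le> exp (- (J i (a $ i) - \<delta>) * \<gamma> n))" ..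
        then have U: "\<And>i. openin (top_of_set {0..}) (U i)" "\<And>i. a $ i \<in> U i"
          "\<And>i. \<forall>\<^sub>F n in sequentially. prob {\<omega> \<in> space M. A n \<omega> $ i \<in> U i} \<le> exp (- (J i (a $ i) - \<delta>) * \<gamma> n)"
          by simp_all
        let ?V = "{a. \<forall>i. a $ i \<in> U i}"
        have V: "openin nonneg_orthant ?V" by (rule openin_orthant_box[OF U(1)])
        have "\<forall>\<^sub>F n in sequentially. \<forall>i. prob {\<omega> \<in> space M. A n \<omega> $ i \<in> U i} \<le> exp (- (J i (a $ i) - \<delta>) * \<gamma> n)"
          using U(3) by (simp add: eventually_all_finite)
        then have "\<forall>\<^sub>F n in sequentially. prob {\<omega> \<in> space M. A n \<omega> \<in> ?V \<inter> F} \<le> exp (- b * \<gamma> n)"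
        proof eventually_elim
          case (elim n)
          have "prob {\<omega> \<in> space M. A n \<omega> \<in> ?V \<inter> F} \<le> prob {\<omega> \<in> space M. A n \<omega> \<in> ?V}"
            by (intro finite_measure_mono mA borel_of_openin[OF V]) auto
          also have "\<dots> = (\<Prod>i\<in>UNIV. prob {\<omega> \<in> space M. A n \<omega> $ i \<in> U i})" by (rule box[OF U(1)])
          also have "\<dots> \<le> (\<Prod>i\<in>UNIV. exp (- (J i (a $ i) - \<delta>) * \<gamma> n))"
            using elim by (intro prod_mono) (simp only: measure_nonneg simp_thms)
          also have "\<dots> = exp (- b * \<gamma> n)"
          proof -
            have "b = (\<Sum>i\<in>UNIV. J i (a $ i) - \<delta>)" by (simp add: sum_subtractf \<delta>_def)
            then have "- b * \<gamma> n = (\<Sum>i\<in>UNIV. - (J i (a $ i) - \<delta>) * \<gamma> n)"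
              by (simp only: sum_distrib_right sum_negf[symmetric] mult_minus_left)
            then show ?thesis by (simp only: exp_sum finite_class.finite_UNIV)
          qed
          finally show ?case .
        qed
        with V U(2) show ?thesis by (intro exI[of _ ?V]) auto
      qed
    qed
  qed
  show ?thesis
    unfolding random_ldp_iff[OF M] using A g gpos rate low up by simp
qed

section \<open>The path space\<close>

definition path_ball :: "real \<Rightarrow> (real \<Rightarrow> 'e::euclidean_space) \<Rightarrow> real \<Rightarrow> (real \<Rightarrow> 'e) set" where
  "path_ball T = (let m = cfunspace (top_of_set {0..T}) euclidean_metric in
     Metric_space.mball (mspace m) (mdist m))"

lemma mspace_path: "mspace (cfunspace (top_of_set {0..T}) euclidean_metric) = topspace (path_space T)"
  by (simp add: path_space_def del: mspace_cfunspace)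

lemma path_ball_iff:
  fixes f g :: "real \<Rightarrow> 'e::euclidean_space"
  shows "g \<in> path_ball T f r \<longleftrightarrow> f \<in> topspace (path_space T) \<and> g \<in> topspace (path_space T) \<and>
     mdist (cfunspace (top_of_set {0..T}) euclidean_metric) f g < r"
proof -
  interpret Metric_space "mspace (cfunspace (top_of_set {0..T}) euclidean_metric)"
    "mdist (cfunspace (top_of_set {0..T}) (euclidean_metric :: 'e metric))"
    by (rule Metric_space_mspace_mdist)
  show ?thesis unfolding path_ball_def Let_def in_mball unfolding mspace_path by simp
qed

lemma openin_path_ball: "openin (path_space T) (path_ball T f r)"
proof -
  interpret Metric_space "mspace (cfunspace (top_of_set {0..T}) euclidean_metric)"
    "mdist (cfunspace (top_of_set {0..T}) (euclidean_metric :: 'a metric))"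
    by (rule Metric_space_mspace_mdist)
  show ?thesis
    unfolding path_ball_def Let_def path_space_def mtopology_of_def by (rule openin_mball)
qed

lemma openin_path_space_ballE:
  assumes "openin (path_space T) G" "f \<in> G"
  obtains r where "0 < r" "path_ball T f r \<subseteq> G"
proof -
  interpret Metric_space "mspace (cfunspace (top_of_set {0..T}) euclidean_metric)"
    "mdist (cfunspace (top_of_set {0..T}) (euclidean_metric :: 'a metric))"
    by (rule Metric_space_mspace_mdist)
  have "openin mtopology G" using assms(1) by (simp add: path_space_def mtopology_of_def)
  then have "\<exists>r>0. mball f r \<subseteq> G" using assms(2) unfolding openin_mtopology by blast
  then show ?thesis using that by (auto simp: path_ball_def Let_def)
qed

lemma path_ballD:
  assumes "g \<in> path_ball T f r" "t \<in> {0..T}"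
  shows "dist (f t) (g t) < r"
proof -
  have "f \<in> mspace (cfunspace (top_of_set {0..T}) euclidean_metric)"
    "g \<in> mspace (cfunspace (top_of_set {0..T}) euclidean_metric)"
    using assms(1) unfolding path_ball_iff mspace_path by auto
  then have "mdist euclidean_metric (f t) (g t) \<le> mdist (cfunspace (top_of_set {0..T}) euclidean_metric) f g"
    using assms(2) by (intro mdist_cfunspace_imp_mdist_le[OF _ _ order_refl]) auto
  then show ?thesis using assms(1) by (simp add: path_ball_iff)
qed

lemma path_ball_subset: "path_ball T f r \<subseteq> topspace (path_space T)"
  using openin_subset[OF openin_path_ball] .

lemma path_ballI:
  assumes "f \<in> topspace (path_space T)" "g \<in> topspace (path_space T)"
    and "0 \<le> s" "s < r" "\<And>t. t \<in> {0..T} \<Longrightarrow> dist (f t) (g t) \<le> s"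
  shows "g \<in> path_ball T f r"
proof -
  have "mdist (cfunspace (top_of_set {0..T}) euclidean_metric) f g \<le> s"
    using assms(3,5) by (intro mdist_cfunspace_le) auto
  then show ?thesis using assms by (simp add: path_ball_iff)
qed

lemma continuous_map_to_path_space:
  fixes f :: "'x \<Rightarrow> real \<Rightarrow> 'e::euclidean_space"
  assumes "f \<in> topspace X \<rightarrow> topspace (path_space T)"
    and "\<And>x \<epsilon>. x \<in> topspace X \<Longrightarrow> 0 < \<epsilon> \<Longrightarrow>
      \<exists>U. openin X U \<and> x \<in> U \<and> (\<forall>y\<in>U. \<forall>t\<in>{0..T}. dist (f x t) (f y t) \<le> \<epsilon>)"
  shows "continuous_map X (path_space T) f"
  unfolding continuous_map_def
proof (intro conjI allI impI)
  fix G :: "(real \<Rightarrow> 'e) set" assume G: "openin (path_space T) G"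
  show "openin X {x \<in> topspace X. f x \<in> G}"
  proof (subst openin_subopen, intro ballI)
    fix x assume x: "x \<in> {x \<in> topspace X. f x \<in> G}"
    then obtain r where r: "0 < r" "path_ball T (f x) r \<subseteq> G" using openin_path_space_ballE[OF G] by auto
    obtain U where U: "openin X U" "x \<in> U" "\<forall>y\<in>U. \<forall>t\<in>{0..T}. dist (f x t) (f y t) \<le> r / 2"
      using assms(2)[of x "r / 2"] x r(1) by auto
    have "f y \<in> G" if "y \<in> U" for y
    proof -
      have y: "y \<in> topspace X" using U(1) that openin_subset by blast
      have "f y \<in> path_ball T (f x) r"
        using U(3) that r(1) x y assms(1) by (intro path_ballI[of _ _ _ "r / 2"]) auto
      then show ?thesis using r(2) by blast
    qed
    with U openin_subset[OF U(1)] show "\<exists>W. openin X W \<and> x \<in> W \<and> W \<subseteq> {x \<in> topspace X. f x \<in> G}" by blast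
  qed
qed (use assms(1) in auto)

lemma continuous_map_path_eval:
  assumes t: "t \<in> {0..T}"
  shows "continuous_map (path_space T) euclidean (\<lambda>f :: real \<Rightarrow> 'e::euclidean_space. f t)"
  unfolding continuous_map_def
proof (intro conjI allI impI)
  fix S :: "'e set" assume S: "openin euclidean S"
  show "openin (path_space T) {f \<in> topspace (path_space T). f t \<in> S}"
  proof (subst openin_subopen, intro ballI)
    fix f assume f: "f \<in> {f \<in> topspace (path_space T). f t \<in> S}"
    then have "open S" "f t \<in> S" using S by simp_all
    then obtain e where e: "0 < e" "ball (f t) e \<subseteq> S" by (rule openE)
    have "f \<in> path_ball T f e" using f e by (intro path_ballI[of _ _ _ 0]) auto
    moreover have "path_ball T f e \<subseteq> {f \<in> topspace (path_space T). f t \<in> S}"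
    proof
      fix g assume g: "g \<in> path_ball T f e"
      then have "g t \<in> ball (f t) e" using path_ballD[OF g t] by simp
      then show "g \<in> {f \<in> topspace (path_space T). f t \<in> S}" using e g path_ball_subset by blast
    qed
    ultimately show "\<exists>W. openin (path_space T) W \<and> f \<in> W \<and> W \<subseteq> {f \<in> topspace (path_space T). f t \<in> S}"
      by (intro exI[of _ "path_ball T f e"] conjI openin_path_ball)
  qed
qed auto

lemma metrizable_path_space: "metrizable_space (path_space T)"
proof -
  interpret Metric_space "mspace (cfunspace (top_of_set {0..T}) euclidean_metric)"
    "mdist (cfunspace (top_of_set {0..T}) (euclidean_metric :: 'a metric))"
    by (rule Metric_space_mspace_mdist)
  show ?thesis unfolding path_space_def mtopology_of_def by (rule metrizable_space_mtopology)
qed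

text \<open>The approximants are not written down: for every choice of finitely many values in a
  countable dense set and of a mesh, one path that follows these values on the mesh up to a given
  error is picked, if there is any. By uniform continuity every path is close to such a pick.\<close>

lemma path_space_countable_dense:
  obtains D :: "(real \<Rightarrow> 'e::euclidean_space) set" where "countable D" "D \<subseteq> topspace (path_space T)"
    "\<And>f \<epsilon>. f \<in> topspace (path_space T) \<Longrightarrow> 0 < \<epsilon> \<Longrightarrow> \<exists>g\<in>D. \<forall>t\<in>{0..T}. dist (f t) (g t) < \<epsilon>"
proof -
  obtain Q :: "'e set" where Q: "countable Q" "\<And>X. open X \<Longrightarrow> X \<noteq> {} \<Longrightarrow> \<exists>q\<in>Q. q \<in> X"
    by (rule countable_dense_setE) blast
  define S where "S n qs m = {f \<in> topspace (path_space T).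
      \<forall>t\<in>{0..T}. dist (f t) (qs ! nat \<lfloor>t * real n\<rfloor>) < inverse (real (Suc m))}" for n :: nat and qs :: "'e list" and m :: nat
  define I where "I = {(n, qs, m) \<in> UNIV \<times> lists Q \<times> UNIV. S n qs m \<noteq> {}}"
  define D where "D = (\<lambda>(n, qs, m). SOME f. f \<in> S n qs m) ` I"
  have some: "(SOME f. f \<in> S n qs m) \<in> S n qs m" if "S n qs m \<noteq> {}" for n qs m
    using that someI_ex[of "\<lambda>f. f \<in> S n qs m"] by blast
  have "countable I"
    unfolding I_def
    by (rule countable_subset[of _ "UNIV \<times> lists Q \<times> UNIV"]) (auto intro!: countable_SIGMA countable_lists Q)
  then have "countable D" unfolding D_def by (rule countable_image)
  moreover have "D \<subseteq> topspace (path_space T)"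
    using some by (fastforce simp: D_def I_def S_def)
  moreover have "\<exists>g\<in>D. \<forall>t\<in>{0..T}. dist (f t) (g t) < \<epsilon>" if f: "f \<in> topspace (path_space T)" and \<epsilon>: "0 < \<epsilon>" for f \<epsilon>
  proof -
    obtain m where m: "inverse (real (Suc m)) < \<epsilon> / 2" using reals_Archimedean[of "\<epsilon> / 2"] \<epsilon> by auto
    define e where "e = inverse (real (Suc m)) / 2"
    have e: "0 < e" by (simp add: e_def)
    have "uniformly_continuous_on {0..T} f"
      using f by (intro compact_uniformly_continuous) (auto simp: topspace_path_space)
    then obtain \<delta> where \<delta>: "0 < \<delta>" "\<And>s t. s \<in> {0..T} \<Longrightarrow> t \<in> {0..T} \<Longrightarrow> dist t s < \<delta> \<Longrightarrow> dist (f t) (f s) < e"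
      unfolding uniformly_continuous_on_def using e by metis
    obtain n where n: "inverse (real (Suc n)) < \<delta>" using reals_Archimedean[OF \<delta>(1)] by auto
    let ?n = "Suc n"
    have "\<exists>q\<in>Q. q \<in> ball (f x) e" for x using e by (intro Q(2)) auto
    then obtain q where q: "\<And>x. q x \<in> Q" "\<And>x. dist (f x) (q x) < e" by (metis mem_ball)
    define qs where "qs = map (\<lambda>k. q (real k / real ?n)) [0..<Suc (nat \<lfloor>T * real ?n\<rfloor>)]"
    have "dist (f t) (qs ! nat \<lfloor>t * real ?n\<rfloor>) < inverse (real (Suc m))" if t: "t \<in> {0..T}" for t
    proof -
      define k where "k = nat \<lfloor>t * real ?n\<rfloor>"
      have k: "real k \<le> t * real ?n" "t * real ?n < real k + 1"
        using t by (auto simp: k_def)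
      have "\<lfloor>t * real ?n\<rfloor> \<le> \<lfloor>T * real ?n\<rfloor>" using t by (intro floor_mono mult_right_mono) auto
      then have "k < Suc (nat \<lfloor>T * real ?n\<rfloor>)" by (simp add: k_def nat_mono le_imp_less_Suc)
      then have qk: "qs ! k = q (real k / real ?n)" unfolding qs_def by (simp del: upt_Suc)
      have le: "real k / real ?n \<le> t" using k(1) by (simp add: pos_divide_le_eq)
      have "t < (real k + 1) / real ?n" using k(2) by (simp only: pos_less_divide_eq of_nat_0_less_iff zero_less_Suc)
      then have "t - real k / real ?n < inverse (real ?n)" by (simp add: add_divide_distrib inverse_eq_divide)
      then have "dist t (real k / real ?n) < \<delta>" using le n by (simp add: dist_real_def)
      moreover have "real k / real ?n \<in> {0..T}" using le t by auto
      ultimately have "dist (f t) (f (real k / real ?n)) < e" using \<delta>(2) t by blast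
      then have "dist (f t) (q (real k / real ?n)) < e + e"
        using q(2)[of "real k / real ?n"] dist_triangle[of "f t" "q (real k / real ?n)" "f (real k / real ?n)"] by linarith
      then show ?thesis using qk by (simp add: k_def e_def)
    qed
    then have fS: "f \<in> S ?n qs m" using f by (simp add: S_def)
    moreover have "qs \<in> lists Q" using q(1) by (auto simp: qs_def)
    ultimately have "(?n, qs, m) \<in> I" by (auto simp: I_def)
    then have "(SOME g. g \<in> S ?n qs m) \<in> D" by (force simp: D_def)
    moreover have "dist (f t) ((SOME g. g \<in> S ?n qs m) t) < \<epsilon>" if t: "t \<in> {0..T}" for t
    proof -
      have gS: "(SOME g. g \<in> S ?n qs m) \<in> S ?n qs m" using some fS by blast
      have "dist (f t) (qs ! nat \<lfloor>t * real ?n\<rfloor>) < inverse (real (Suc m))"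
        "dist ((SOME g. g \<in> S ?n qs m) t) (qs ! nat \<lfloor>t * real ?n\<rfloor>) < inverse (real (Suc m))"
        using fS gS t unfolding S_def by blast+
      then show ?thesis
        using m dist_triangle2[of "f t" "(SOME g. g \<in> S ?n qs m) t" "qs ! nat \<lfloor>t * real ?n\<rfloor>"] by linarith
    qed
    ultimately show ?thesis by blast
  qed
  ultimately show ?thesis by (rule that)
qed

lemma second_countable_path_space: "second_countable (path_space T :: (real \<Rightarrow> 'e::euclidean_space) topology)"
proof -
  obtain D :: "(real \<Rightarrow> 'e) set" where D: "countable D" "D \<subseteq> topspace (path_space T)"
    "\<And>f \<epsilon>. f \<in> topspace (path_space T) \<Longrightarrow> 0 < \<epsilon> \<Longrightarrow> \<exists>g\<in>D. \<forall>t\<in>{0..T}. dist (f t) (g t) < \<epsilon>"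
    using path_space_countable_dense[where T = T and 'e = 'e] by blast
  define \<B> where "\<B> = (\<lambda>(g, n). path_ball T g (inverse (real (Suc n)))) ` (D \<times> UNIV)"
  have "\<exists>V\<in>\<B>. f \<in> V \<and> V \<subseteq> G" if G: "openin (path_space T) G" and f: "f \<in> G" for G f
  proof -
    have ft: "f \<in> topspace (path_space T)" using G f openin_subset by blast
    obtain r where r: "0 < r" "path_ball T f r \<subseteq> G" by (rule openin_path_space_ballE[OF G f])
    obtain n where n: "inverse (real (Suc n)) < r / 2" using reals_Archimedean[of "r / 2"] r(1) by auto
    let ?e = "inverse (real (Suc n))"
    have e: "0 < ?e" by simp
    obtain g where g: "g \<in> D" "\<forall>t\<in>{0..T}. dist (f t) (g t) < ?e / 2" using D(3)[OF ft, of "?e / 2"] e by auto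
    have gt: "g \<in> topspace (path_space T)" using g(1) D(2) by blast
    have "f \<in> path_ball T g ?e"
      using g(2) e by (intro path_ballI[OF gt ft, of "?e / 2"]) (auto simp: dist_commute intro: less_imp_le)
    moreover have "path_ball T g ?e \<subseteq> path_ball T f r"
    proof
      fix h assume h: "h \<in> path_ball T g ?e"
      show "h \<in> path_ball T f r"
      proof (rule path_ballI[OF ft])
        show "h \<in> topspace (path_space T)" using h path_ball_subset by blast
        show "?e / 2 + ?e < r" using n e by linarith
        show "dist (f t) (h t) \<le> ?e / 2 + ?e" if "t \<in> {0..T}" for t
          using dist_triangle[of "f t" "h t" "g t"] path_ballD[OF h that] g(2) that by force
      qed (use e in linarith)
    qed
    moreover have "path_ball T g ?e \<in> \<B>" using g(1) by (force simp: \<B>_def)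
    ultimately show ?thesis using r(2) by blast
  qed
  moreover have "countable \<B>" unfolding \<B>_def using D(1) by (intro countable_image countable_SIGMA) auto
  moreover have "openin (path_space T) V" if "V \<in> \<B>" for V
    using that openin_path_ball by (auto simp: \<B>_def)
  ultimately show ?thesis unfolding second_countable_def by (intro exI[of _ \<B>]) simp
qed

section \<open>The reproducing kernel Hilbert space of a Gaussian process\<close>

lemma sets_borel_of_euclidean: "sets (borel_of euclidean) = sets borel"
  by (simp add: borel_of_def borel_def)

lemma restrict_in_path_space:
  assumes "continuous_on {0..T} f"
  shows "restrict f {0..T} \<in> topspace (path_space T)"
proof -
  have "continuous_on {0..T} (restrict f {0..T})"
    by (rule continuous_on_eq[OF assms]) simp
  then show ?thesis by (simp add: topspace_path_space)
qed

text \<open>The normal density is at most \<open>1 / sqrt (2 * pi * \<sigma>\<^sup>2)\<close>, so the interval \<open>[-K, K]\<close> can carry mass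
  one half only if \<open>\<sigma>\<close> is at most a multiple of \<open>K\<close>.\<close>

lemma gaussian_rv_variance_bound:
  assumes M: "prob_space M" and Y: "gaussian_rv M Y" and mean: "(\<integral>\<omega>. Y \<omega> \<partial>M) = 0"
    and K: "0 < K" and P: "1 / 2 < measure M {\<omega> \<in> space M. \<bar>Y \<omega>\<bar> \<le> K}"
  shows "integrable M (\<lambda>\<omega>. (Y \<omega>)\<^sup>2)" and "(\<integral>\<omega>. (Y \<omega>)\<^sup>2 \<partial>M) \<le> 16 * K\<^sup>2"
proof -
  interpret prob_space M by fact
  have [measurable]: "Y \<in> borel_measurable M" using Y by (simp add: gaussian_rv_def)
  from Y consider (normal) \<mu> \<sigma> where "0 < \<sigma>" "distributed M lborel Y (normal_density \<mu> \<sigma>)"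
    | (const) c where "AE \<omega> in M. Y \<omega> = c"
    by (auto simp: gaussian_rv_def)
  then have "integrable M (\<lambda>\<omega>. (Y \<omega>)\<^sup>2) \<and> (\<integral>\<omega>. (Y \<omega>)\<^sup>2 \<partial>M) \<le> 16 * K\<^sup>2"
  proof cases
    case const
    have "(\<integral>\<omega>. Y \<omega> \<partial>M) = (\<integral>\<omega>. c \<partial>M)" using const by (intro integral_cong_AE) auto
    then have "c = 0" using mean by (simp add: prob_space)
    with const have ae: "AE \<omega> in M. (Y \<omega>)\<^sup>2 = 0" by auto
    have "integrable M (\<lambda>\<omega>. (Y \<omega>)\<^sup>2)" using ae by (subst integrable_cong_AE[of _ _ "\<lambda>_. 0"]) auto
    moreover have "(\<integral>\<omega>. (Y \<omega>)\<^sup>2 \<partial>M) = 0" using ae by (subst integral_cong_AE[of _ _ "\<lambda>_. 0"]) auto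
    ultimately show ?thesis by simp
  next
    case normal
    have \<mu>: "\<mu> = 0" using normal_distributed_expectation[OF normal(1,2)] mean by simp
    have int: "integrable M (\<lambda>\<omega>. (Y \<omega>)\<^sup>2)"
      using distributed_integrable[OF normal(2), of "\<lambda>x. x\<^sup>2"] integrable_normal_moment[OF normal(1), of 0 2] \<mu> by simp
    have var: "(\<integral>\<omega>. (Y \<omega>)\<^sup>2 \<partial>M) = \<sigma>\<^sup>2"
      using normal_distributed_variance[OF normal(1,2)] mean by simp
    have s: "0 < sqrt (2 * pi * \<sigma>\<^sup>2)" using normal(1) by simp
    have dens: "normal_density \<mu> \<sigma> x \<le> 1 / sqrt (2 * pi * \<sigma>\<^sup>2)" for x
    proof -
      have "exp (- (x - \<mu>)\<^sup>2 / (2 * \<sigma>\<^sup>2)) \<le> 1" by simp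
      then have "1 / sqrt (2 * pi * \<sigma>\<^sup>2) * exp (- (x - \<mu>)\<^sup>2 / (2 * \<sigma>\<^sup>2)) \<le> 1 / sqrt (2 * pi * \<sigma>\<^sup>2) * 1"
        using s by (intro mult_left_mono) auto
      then show ?thesis by (simp add: normal_density_def)
    qed
    have "emeasure M (Y -` {- K..K} \<inter> space M) = (\<integral>\<^sup>+x. ennreal (normal_density \<mu> \<sigma> x) * indicator {- K..K} x \<partial>lborel)"
      by (rule distributed_emeasure[OF normal(2)]) simp
    also have "\<dots> \<le> (\<integral>\<^sup>+x. ennreal (1 / sqrt (2 * pi * \<sigma>\<^sup>2)) * indicator {- K..K} x \<partial>lborel)"
      using dens by (intro nn_integral_mono mult_right_mono ennreal_leI) auto
    also have "\<dots> = ennreal (1 / sqrt (2 * pi * \<sigma>\<^sup>2)) * ennreal (2 * K)"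
      using K by (subst nn_integral_cmult_indicator) auto
    also have "\<dots> = ennreal (2 * K / sqrt (2 * pi * \<sigma>\<^sup>2))"
      using K s by (subst ennreal_mult[symmetric]) auto
    finally have "measure M (Y -` {- K..K} \<inter> space M) \<le> 2 * K / sqrt (2 * pi * \<sigma>\<^sup>2)"
      using K s by (simp add: emeasure_eq_measure)
    moreover have "Y -` {- K..K} \<inter> space M = {\<omega> \<in> space M. \<bar>Y \<omega>\<bar> \<le> K}" by (auto simp: abs_le_iff)
    ultimately have "1 / 2 < 2 * K / sqrt (2 * pi * \<sigma>\<^sup>2)" using P by simp
    then have "sqrt (2 * pi * \<sigma>\<^sup>2) < 4 * K" using s by (simp add: field_simps)
    then have "(sqrt (2 * pi * \<sigma>\<^sup>2))\<^sup>2 \<le> (4 * K)\<^sup>2" using s by (intro power_mono) auto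
    then have le: "2 * pi * \<sigma>\<^sup>2 \<le> 16 * K\<^sup>2" by (simp add: power_mult_distrib)
    have "1 * \<sigma>\<^sup>2 \<le> (2 * pi) * \<sigma>\<^sup>2" using pi_gt3 by (intro mult_right_mono) auto
    with le int var show ?thesis by simp
  qed
  then show "integrable M (\<lambda>\<omega>. (Y \<omega>)\<^sup>2)" "(\<integral>\<omega>. (Y \<omega>)\<^sup>2 \<partial>M) \<le> 16 * K\<^sup>2" by auto
qed

lemma process_eval_measurable:
  assumes "U \<in> measurable M (borel_of (path_space T))" "t \<in> {0..T}"
  shows "(\<lambda>\<omega>. U \<omega> t :: 'e::euclidean_space) \<in> borel_measurable M"
proof -
  have "(\<lambda>\<omega>. U \<omega> t) \<in> measurable M (borel_of (euclidean :: 'e topology))"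
    using measurable_compose[OF assms(1) continuous_map_measurable[OF continuous_map_path_eval[OF assms(2)]]] .
  then show ?thesis by (simp add: measurable_cong_sets[OF refl sets_borel_of_euclidean])
qed

text \<open>All coordinates stay below a common level with probability above one half, because the
  paths are bounded. A centered Gaussian variable of large variance would leave that level.\<close>

lemma gaussian_process_second_moments:
  fixes U :: "'v \<Rightarrow> real \<Rightarrow> real"
  assumes M: "prob_space M" and U: "centered_gaussian_process M T U"
  obtains C where "\<And>t. t \<in> {0..T} \<Longrightarrow> integrable M (\<lambda>\<omega>. (U \<omega> t)\<^sup>2)"
    "\<And>t. t \<in> {0..T} \<Longrightarrow> (\<integral>\<omega>. (U \<omega> t)\<^sup>2 \<partial>M) \<le> C"
proof -
  interpret prob_space M by fact
  have Um: "U \<in> measurable M (borel_of (path_space T))" using U by (simp add: centered_gaussian_process_def)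
  have zero: "path_zero T \<in> topspace (path_space T)"
    unfolding path_zero_def by (intro restrict_in_path_space continuous_on_const)
  let ?B = "\<lambda>k. {\<omega> \<in> space M. U \<omega> \<in> path_ball T (path_zero T) (real k)}"
  have mB: "?B k \<in> events" for k
    using measurable_sets[OF Um borel_of_openin[OF openin_path_ball]] by (simp add: vimage_def Int_def conj_commute)
  have sub: "?B j \<subseteq> ?B k" if "j \<le> k" for j k using that by (auto simp: path_ball_iff)
  have "incseq ?B" using sub by (intro monoI)
  moreover have "(\<Union>k. ?B k) = space M"
  proof -
    have "\<exists>k. U \<omega> \<in> path_ball T (path_zero T) (real k)" if "\<omega> \<in> space M" for \<omega>
    proof -
      have "U \<omega> \<in> topspace (path_space T)" using measurable_space[OF Um that] by simp
      then show ?thesis using zero reals_Archimedean2 by (auto simp: path_ball_iff)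
    qed
    then show ?thesis by blast
  qed
  ultimately have "(\<lambda>k. prob (?B k)) \<longlonglongrightarrow> 1"
    using finite_Lim_measure_incseq[of ?B] mB by (auto simp: prob_space)
  then have "\<forall>\<^sub>F k in sequentially. 1 / 2 < prob (?B k)" by (rule order_tendstoD) simp
  then obtain k where k: "1 / 2 < prob (?B k)" by (auto simp: eventually_sequentially)
  define K where "K = real k + 1"
  have K: "0 < K" by (simp add: K_def)
  have gauss: "gaussian_rv M (\<lambda>\<omega>. U \<omega> t)" if t: "t \<in> {0..T}" for t
  proof -
    have lin: "gaussian_rv M (\<lambda>\<omega>. \<Sum>s\<in>F. c s \<bullet> U \<omega> s)" if "finite F" "F \<subseteq> {0..T}" for F c
      using U that by (simp add: centered_gaussian_process_def)
    have "gaussian_rv M (\<lambda>\<omega>. \<Sum>s\<in>{t}. 1 \<bullet> U \<omega> s)"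
      using t by (intro lin) simp_all
    then show ?thesis by simp
  qed
  have P: "1 / 2 < prob {\<omega> \<in> space M. \<bar>U \<omega> t\<bar> \<le> K}" if t: "t \<in> {0..T}" for t
  proof -
    have "prob (?B k) \<le> prob {\<omega> \<in> space M. \<bar>U \<omega> t\<bar> \<le> K}"
    proof (rule finite_measure_mono)
      show "?B k \<subseteq> {\<omega> \<in> space M. \<bar>U \<omega> t\<bar> \<le> K}"
        using path_ballD[OF _ t, of _ "path_zero T" "real k"] t by (force simp: path_zero_def K_def)
      have [measurable]: "(\<lambda>\<omega>. U \<omega> t) \<in> borel_measurable M" by (rule process_eval_measurable[OF Um t])
      show "{\<omega> \<in> space M. \<bar>U \<omega> t\<bar> \<le> K} \<in> events" by measurable
    qed
    with k show ?thesis by simp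
  qed
  have mean: "(\<integral>\<omega>. U \<omega> t \<partial>M) = 0" if "t \<in> {0..T}" for t
    using U that by (simp add: centered_gaussian_process_def)
  show ?thesis
    by (rule that[of "16 * K\<^sup>2"]) (use gaussian_rv_variance_bound[OF M gauss mean K P] in auto)
qed

text \<open>Sampling a continuous path on a mesh of width \<open>1 / (n + 1)\<close> gives functions that are
  measurable in both variables and converge to the path.\<close>

lemma process_jointly_measurable:
  fixes U :: "'v \<Rightarrow> real \<Rightarrow> real"
  assumes Um: "U \<in> measurable M (borel_of (path_space T))"
    and \<mu>: "sets \<mu> = sets (restrict_space borel {0..T})"
  shows "(\<lambda>(t, \<omega>). U \<omega> t) \<in> borel_measurable (\<mu> \<Otimes>\<^sub>M M)"
proof -
  have sp: "space \<mu> = {0..T}" using sets_eq_imp_space_eq[OF \<mu>] by (simp add: space_restrict_space)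
  \<comment> \<open>Extended by \<open>0\<close>, the sampled values are measurable at every real mesh point.\<close>
  define V where "V \<omega> s = (if s \<in> {0..T} then U \<omega> s else 0)" for \<omega> s
  have V: "(\<lambda>p. V (snd p) s) \<in> borel_measurable (\<mu> \<Otimes>\<^sub>M M)" for s
  proof (cases "s \<in> {0..T}")
    case True
    then show ?thesis
      using measurable_compose[OF measurable_snd process_eval_measurable[OF Um True]] by (simp add: V_def)
  next
    case False
    then have "V \<omega> s = 0" for \<omega> by (simp only: V_def if_False)
    then show ?thesis by simp
  qed
  have floor: "(\<lambda>p. \<lfloor>fst p * real (Suc n)\<rfloor>) \<in> measurable (\<mu> \<Otimes>\<^sub>M M) (count_space UNIV)" for n
  proof -
    have "(\<lambda>x::real. x) \<in> measurable \<mu> borel"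
      unfolding measurable_cong_sets[OF \<mu> refl] by (rule measurable_restrict_space1) simp
    then have [measurable]: "fst \<in> borel_measurable (\<mu> \<Otimes>\<^sub>M M)"
      using measurable_compose[OF measurable_fst, of "\<lambda>x. x" \<mu> borel M] by simp
    show ?thesis by measurable
  qed
  have meas: "(\<lambda>p. V (snd p) (real_of_int \<lfloor>fst p * real (Suc n)\<rfloor> / real (Suc n))) \<in> borel_measurable (\<mu> \<Otimes>\<^sub>M M)" for n
    by (rule measurable_compose_countable[where f = "\<lambda>i p. V (snd p) (real_of_int i / real (Suc n))", OF V floor])
  have lim: "(\<lambda>n. V (snd p) (real_of_int \<lfloor>fst p * real (Suc n)\<rfloor> / real (Suc n))) \<longlonglongrightarrow> (\<lambda>(t, \<omega>). U \<omega> t) p"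
    if p: "p \<in> space (\<mu> \<Otimes>\<^sub>M M)" for p
  proof -
    obtain t \<omega> where p_eq: "p = (t, \<omega>)" by fastforce
    have t: "t \<in> {0..T}" and \<omega>: "\<omega> \<in> space M" using p by (auto simp: p_eq space_pair_measure sp)
    let ?r = "\<lambda>n. real_of_int \<lfloor>t * real (Suc n)\<rfloor> / real (Suc n)"
    have up: "?r n \<le> t" for n by (simp add: pos_divide_le_eq)
    have low: "t - inverse (real (Suc n)) \<le> ?r n" for n
    proof -
      have "t * real (Suc n) - 1 \<le> real_of_int \<lfloor>t * real (Suc n)\<rfloor>" by linarith
      then have "(t * real (Suc n) - 1) / real (Suc n) \<le> ?r n" by (intro divide_right_mono) auto
      then show ?thesis by (simp add: diff_divide_distrib inverse_eq_divide)
    qed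
    have "?r \<longlonglongrightarrow> t"
    proof (rule tendsto_sandwich[of "\<lambda>n. t - inverse (real (Suc n))" ?r sequentially "\<lambda>_. t"])
      show "\<forall>\<^sub>F n in sequentially. t - inverse (real (Suc n)) \<le> ?r n"
        using low by (intro always_eventually allI)
      show "\<forall>\<^sub>F n in sequentially. ?r n \<le> t"
        using up by (intro always_eventually allI)
      show "(\<lambda>n. t - inverse (real (Suc n))) \<longlonglongrightarrow> t"
        using tendsto_diff[OF tendsto_const LIMSEQ_inverse_real_of_nat, of t] by simp
    qed simp
    moreover have r: "?r n \<in> {0..T}" for n using t up[of n] by auto
    moreover have "continuous_on {0..T} (U \<omega>)"
      using measurable_space[OF Um \<omega>] by (simp add: topspace_path_space)
    ultimately have "(\<lambda>n. U \<omega> (?r n)) \<longlonglongrightarrow> U \<omega> t"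
      using t by (intro continuous_on_tendsto_compose[of "{0..T}" "U \<omega>"]) auto
    then show ?thesis using r by (simp add: p_eq V_def)
  qed
  show ?thesis by (rule borel_measurable_LIMSEQ_real[OF lim meas])
qed

lemma product_le_squares: "\<bar>x * y\<bar> \<le> x\<^sup>2 + (y::real)\<^sup>2"
proof -
  have "0 \<le> (\<bar>x\<bar> - \<bar>y\<bar>)\<^sup>2" by simp
  then have "2 * (\<bar>x\<bar> * \<bar>y\<bar>) \<le> x\<^sup>2 + y\<^sup>2" by (simp add: power2_diff)
  moreover have "0 \<le> \<bar>x\<bar> * \<bar>y\<bar>" by simp
  ultimately show ?thesis unfolding abs_mult by linarith
qed

lemma integrable_mult_L2:
  fixes X Y :: "'v \<Rightarrow> real"
  assumes "X \<in> borel_measurable M" "Y \<in> borel_measurable M"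
    and "integrable M (\<lambda>\<omega>. (X \<omega>)\<^sup>2)" "integrable M (\<lambda>\<omega>. (Y \<omega>)\<^sup>2)"
  shows "integrable M (\<lambda>\<omega>. X \<omega> * Y \<omega>)"
proof (rule Bochner_Integration.integrable_bound)
  show "integrable M (\<lambda>\<omega>. (X \<omega>)\<^sup>2 + (Y \<omega>)\<^sup>2)" using assms by simp
  show "AE \<omega> in M. norm (X \<omega> * Y \<omega>) \<le> norm ((X \<omega>)\<^sup>2 + (Y \<omega>)\<^sup>2)"
    using product_le_squares[of "X _" "Y _"] by (intro AE_I2) simp
qed (use assms in simp)

locale gaussian_process = prob_space M for M :: "'v measure" +
  fixes T :: real and U :: "'v \<Rightarrow> real \<Rightarrow> real"
  assumes gaussian: "centered_gaussian_process M T U"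
begin

lemma path_measurable: "U \<in> measurable M (borel_of (path_space T))"
  using gaussian by (simp add: centered_gaussian_process_def)

lemma eval_measurable: "t \<in> {0..T} \<Longrightarrow> (\<lambda>\<omega>. U \<omega> t) \<in> borel_measurable M"
  by (rule process_eval_measurable[OF path_measurable])

lemma eval_square_integrable: "t \<in> {0..T} \<Longrightarrow> integrable M (\<lambda>\<omega>. (U \<omega> t)\<^sup>2)"
  by (rule gaussian_process_second_moments[OF prob_space_axioms gaussian])

lemma eval_mult_integrable:
  assumes "t \<in> {0..T}" "D \<in> borel_measurable M" "integrable M (\<lambda>\<omega>. (D \<omega>)\<^sup>2)"
  shows "integrable M (\<lambda>\<omega>. U \<omega> t * D \<omega>)"
  using assms by (intro integrable_mult_L2 eval_measurable eval_square_integrable)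

lemma integral_path_orthogonal:
  assumes D: "D \<in> borel_measurable M" "integrable M (\<lambda>\<omega>. (D \<omega>)\<^sup>2)"
    and orth: "\<And>t. t \<in> {0..T} \<Longrightarrow> (\<integral>\<omega>. U \<omega> t * D \<omega> \<partial>M) = 0"
    and \<mu>: "\<mu> \<in> finite_measures_on T"
  shows "(\<lambda>\<omega>. \<integral>t. U \<omega> t \<partial>\<mu>) \<in> borel_measurable M"
    and "integrable M (\<lambda>\<omega>. (\<integral>t. U \<omega> t \<partial>\<mu>) * D \<omega>)"
    and "(\<integral>\<omega>. (\<integral>t. U \<omega> t \<partial>\<mu>) * D \<omega> \<partial>M) = 0"
proof -
  have fin: "finite_measure \<mu>" and sets: "sets \<mu> = sets (restrict_space borel {0..T})"
    using \<mu> by (auto simp: finite_measures_on_def)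
  interpret \<mu>: finite_measure \<mu> by fact
  interpret P: pair_sigma_finite \<mu> M ..
  have sp: "space \<mu> = {0..T}" using sets_eq_imp_space_eq[OF sets] by (simp add: space_restrict_space)
  have U [measurable]: "(\<lambda>(t, \<omega>). U \<omega> t) \<in> borel_measurable (\<mu> \<Otimes>\<^sub>M M)"
    by (rule process_jointly_measurable[OF path_measurable sets])
  note D(1) [measurable]
  let ?f = "\<lambda>(t, \<omega>). U \<omega> t * D \<omega>"
  have f [measurable]: "?f \<in> borel_measurable (\<mu> \<Otimes>\<^sub>M M)"
  proof -
    have "?f = (\<lambda>p. (\<lambda>(t, \<omega>). U \<omega> t) p * D (snd p))" by auto
    then show ?thesis by simp
  qed
  have swap: "(\<lambda>(\<omega>, t). U \<omega> t) \<in> borel_measurable (M \<Otimes>\<^sub>M \<mu>)"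
    using measurable_pair_swap[OF U] by (simp add: case_prod_beta')
  show W [measurable]: "(\<lambda>\<omega>. \<integral>t. U \<omega> t \<partial>\<mu>) \<in> borel_measurable M"
    by (rule \<mu>.borel_measurable_lebesgue_integral[OF swap])
  obtain C where C: "\<And>t. t \<in> {0..T} \<Longrightarrow> (\<integral>\<omega>. (U \<omega> t)\<^sup>2 \<partial>M) \<le> C"
    using gaussian_process_second_moments[OF prob_space_axioms gaussian] by metis
  have int: "integrable (\<mu> \<Otimes>\<^sub>M M) ?f"
  proof (rule P.Fubini_integrable[OF f])
    have meas: "(\<lambda>t. \<integral>\<omega>. norm (?f (t, \<omega>)) \<partial>M) \<in> borel_measurable \<mu>"
      by (rule borel_measurable_lebesgue_integral) simp
    have "(\<integral>\<omega>. norm (?f (t, \<omega>)) \<partial>M) \<le> C + (\<integral>\<omega>. (D \<omega>)\<^sup>2 \<partial>M)" if t: "t \<in> {0..T}" for t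
    proof -
      have "(\<integral>\<omega>. norm (?f (t, \<omega>)) \<partial>M) \<le> (\<integral>\<omega>. (U \<omega> t)\<^sup>2 + (D \<omega>)\<^sup>2 \<partial>M)"
        using t D eval_square_integrable eval_mult_integrable product_le_squares by (intro integral_mono) auto
      also have "\<dots> \<le> C + (\<integral>\<omega>. (D \<omega>)\<^sup>2 \<partial>M)"
        using C[OF t] t D eval_square_integrable by simp
      finally show ?thesis .
    qed
    then show "integrable \<mu> (\<lambda>t. \<integral>\<omega>. norm (?f (t, \<omega>)) \<partial>M)"
      using meas by (intro \<mu>.integrable_const_bound[of _ "C + (\<integral>\<omega>. (D \<omega>)\<^sup>2 \<partial>M)"]) (auto simp: sp)
    show "AE t in \<mu>. integrable M (\<lambda>\<omega>. ?f (t, \<omega>))"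
      using eval_mult_integrable[OF _ D] by (auto simp: sp)
  qed
  have eq: "(\<integral>t. ?f (t, \<omega>) \<partial>\<mu>) = (\<integral>t. U \<omega> t \<partial>\<mu>) * D \<omega>" for \<omega> by simp
  show "integrable M (\<lambda>\<omega>. (\<integral>t. U \<omega> t \<partial>\<mu>) * D \<omega>)"
    using P.integrable_snd[OF int] by simp
  have "(\<integral>\<omega>. (\<integral>t. ?f (t, \<omega>) \<partial>\<mu>) \<partial>M) = (\<integral>t. (\<integral>\<omega>. ?f (t, \<omega>) \<partial>M) \<partial>\<mu>)"
    using int by (intro P.Fubini_integral) (simp add: case_prod_beta')
  also have "\<dots> = (\<integral>t. 0 \<partial>\<mu>)" using orth by (intro Bochner_Integration.integral_cong) (auto simp: sp)
  finally show "(\<integral>\<omega>. (\<integral>t. U \<omega> t \<partial>\<mu>) * D \<omega> \<partial>M) = 0" unfolding eq by simp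
qed

lemma functional_measurable:
  assumes "V \<in> gaussian_functionals M T U" shows "V \<in> borel_measurable M"
proof -
  obtain \<mu> \<nu> where V: "V = (\<lambda>\<omega>. (\<integral>t. U \<omega> t \<partial>\<mu>) - (\<integral>t. U \<omega> t \<partial>\<nu>))"
    "\<mu> \<in> finite_measures_on T" "\<nu> \<in> finite_measures_on T"
    using assms by (auto simp: gaussian_functionals_def)
  show ?thesis unfolding V(1)
    by (intro borel_measurable_diff integral_path_orthogonal(1)[of "\<lambda>_. 0"] V) auto
qed

text \<open>Orthogonality to all coordinates passes to the functionals by Fubini's theorem and to
  their \<open>L\<^sup>2\<close>-limits by continuity of the inner product.\<close>

lemma gaussian_space_orthogonal:
  assumes D: "D \<in> borel_measurable M" "integrable M (\<lambda>\<omega>. (D \<omega>)\<^sup>2)"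
    and orth: "\<And>t. t \<in> {0..T} \<Longrightarrow> (\<integral>\<omega>. U \<omega> t * D \<omega> \<partial>M) = 0"
    and Y: "Y \<in> gaussian_space M T U"
  shows "(\<integral>\<omega>. Y \<omega> * D \<omega> \<partial>M) = 0"
proof -
  have Ym: "Y \<in> borel_measurable M" and Y2: "integrable M (\<lambda>\<omega>. (Y \<omega>)\<^sup>2)"
    and dense: "\<And>e. 0 < e \<Longrightarrow> \<exists>V\<in>gaussian_functionals M T U. (\<integral>\<^sup>+\<omega>. ennreal ((Y \<omega> - V \<omega>)\<^sup>2) \<partial>M) < e"
    using Y by (auto simp: gaussian_space_def)
  define c where "c = (\<integral>\<omega>. (D \<omega>)\<^sup>2 \<partial>M)"
  have c: "0 \<le> c" by (simp add: c_def)
  have bound: "\<bar>\<integral>\<omega>. Y \<omega> * D \<omega> \<partial>M\<bar> \<le> \<delta> * (1 + c)" if \<delta>: "0 < \<delta>" for \<delta>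
  proof -
    obtain V where V: "V \<in> gaussian_functionals M T U" "(\<integral>\<^sup>+\<omega>. ennreal ((Y \<omega> - V \<omega>)\<^sup>2) \<partial>M) < ennreal (\<delta>\<^sup>2)"
      using dense[of "ennreal (\<delta>\<^sup>2)"] \<delta> by auto
    note Vm = functional_measurable[OF V(1)]
    have i: "integrable M (\<lambda>\<omega>. (Y \<omega> - V \<omega>)\<^sup>2)"
      using V(2) Ym Vm by (intro integrableI_nonneg) (auto elim: order.strict_trans)
    have i_le: "(\<integral>\<omega>. (Y \<omega> - V \<omega>)\<^sup>2 \<partial>M) \<le> \<delta>\<^sup>2"
      using V(2) \<delta> by (subst integral_eq_nn_integral) (use Ym Vm in \<open>auto intro!: enn2real_leI\<close>)
    have iD: "integrable M (\<lambda>\<omega>. (Y \<omega> - V \<omega>) * D \<omega>)"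
      using D Ym Vm i by (intro integrable_mult_L2) auto
    obtain \<mu> \<nu> where mn: "V = (\<lambda>\<omega>. (\<integral>t. U \<omega> t \<partial>\<mu>) - (\<integral>t. U \<omega> t \<partial>\<nu>))"
      "\<mu> \<in> finite_measures_on T" "\<nu> \<in> finite_measures_on T"
      using V(1) by (auto simp: gaussian_functionals_def)
    have VD_eq: "V \<omega> * D \<omega> = (\<integral>t. U \<omega> t \<partial>\<mu>) * D \<omega> - (\<integral>t. U \<omega> t \<partial>\<nu>) * D \<omega>" for \<omega>
      by (simp add: mn(1) left_diff_distrib)
    have VD: "integrable M (\<lambda>\<omega>. V \<omega> * D \<omega>)" "(\<integral>\<omega>. V \<omega> * D \<omega> \<partial>M) = 0"
      unfolding VD_eq using integral_path_orthogonal(2,3)[OF D orth mn(2)] integral_path_orthogonal(2,3)[OF D orth mn(3)]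
      by simp_all
    have "(\<integral>\<omega>. Y \<omega> * D \<omega> \<partial>M) = (\<integral>\<omega>. (Y \<omega> - V \<omega>) * D \<omega> + V \<omega> * D \<omega> \<partial>M)"
      by (simp add: left_diff_distrib)
    also have "\<dots> = (\<integral>\<omega>. (Y \<omega> - V \<omega>) * D \<omega> \<partial>M)" using iD VD by simp
    finally have eq: "(\<integral>\<omega>. Y \<omega> * D \<omega> \<partial>M) = (\<integral>\<omega>. (Y \<omega> - V \<omega>) * D \<omega> \<partial>M)" .
    \<comment> \<open>The weight \<open>\<delta>\<close> makes both summands of order \<open>\<delta>\<close> after integration.\<close>
    have pt: "\<bar>(Y \<omega> - V \<omega>) * D \<omega>\<bar> \<le> (Y \<omega> - V \<omega>)\<^sup>2 / \<delta> + \<delta> * (D \<omega>)\<^sup>2" for \<omega>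
    proof -
      define y where "y = Y \<omega> - V \<omega>"
      have "\<bar>(y / \<delta>) * D \<omega>\<bar> \<le> (y / \<delta>)\<^sup>2 + (D \<omega>)\<^sup>2" by (rule product_le_squares)
      then have "\<delta> * \<bar>(y / \<delta>) * D \<omega>\<bar> \<le> \<delta> * ((y / \<delta>)\<^sup>2 + (D \<omega>)\<^sup>2)"
        using \<delta> by (intro mult_left_mono) auto
      moreover have "\<delta> * \<bar>(y / \<delta>) * D \<omega>\<bar> = \<bar>y * D \<omega>\<bar>" using \<delta> by (simp add: abs_mult)
      moreover have "\<delta> * ((y / \<delta>)\<^sup>2 + (D \<omega>)\<^sup>2) = y\<^sup>2 / \<delta> + \<delta> * (D \<omega>)\<^sup>2"
        using \<delta> by (simp add: power2_eq_square field_simps)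
      ultimately show ?thesis by (simp add: y_def)
    qed
    have "\<bar>\<integral>\<omega>. (Y \<omega> - V \<omega>) * D \<omega> \<partial>M\<bar> \<le> (\<integral>\<omega>. \<bar>(Y \<omega> - V \<omega>) * D \<omega>\<bar> \<partial>M)" by (rule integral_abs_bound)
    also have "\<dots> \<le> (\<integral>\<omega>. (Y \<omega> - V \<omega>)\<^sup>2 / \<delta> + \<delta> * (D \<omega>)\<^sup>2 \<partial>M)"
      using pt iD i D by (intro integral_mono) auto
    also have "\<dots> = (\<integral>\<omega>. (Y \<omega> - V \<omega>)\<^sup>2 \<partial>M) / \<delta> + \<delta> * c" using i D by (simp add: c_def)
    also have "\<dots> \<le> \<delta>\<^sup>2 / \<delta> + \<delta> * c" using i_le \<delta> by (intro add_mono divide_right_mono) auto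
    also have "\<dots> = \<delta> * (1 + c)" using \<delta> by (simp add: power2_eq_square algebra_simps)
    finally show ?thesis unfolding eq .
  qed
  show ?thesis
  proof (rule ccontr)
    let ?x = "\<bar>\<integral>\<omega>. Y \<omega> * D \<omega> \<partial>M\<bar>"
    assume "(\<integral>\<omega>. Y \<omega> * D \<omega> \<partial>M) \<noteq> 0"
    then have x: "0 < ?x" by simp
    have "?x \<le> ?x / (2 * (1 + c)) * (1 + c)" using x c by (intro bound) auto
    also have "\<dots> = ?x / 2" using c by (simp add: field_simps)
    finally show False using x by simp
  qed
qed

lemma gaussian_spaceD:
  assumes "Y \<in> gaussian_space M T U"
  shows "Y \<in> borel_measurable M" "integrable M (\<lambda>\<omega>. (Y \<omega>)\<^sup>2)"
  using assms by (auto simp: gaussian_space_def)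

text \<open>The preimages of a path differ by an element orthogonal to the whole Gaussian space,
  hence to both of them; so the norm does not depend on the chosen preimage.\<close>

lemma rkhs_map_eq_imp_norm_eq:
  assumes Y1: "Y1 \<in> gaussian_space M T U" and Y2: "Y2 \<in> gaussian_space M T U"
    and eq: "rkhs_map M T U Y1 = rkhs_map M T U Y2"
  shows "(\<integral>\<omega>. (Y1 \<omega>)\<^sup>2 \<partial>M) = (\<integral>\<omega>. (Y2 \<omega>)\<^sup>2 \<partial>M)"
proof -
  note [measurable] = gaussian_spaceD(1)[OF Y1] gaussian_spaceD(1)[OF Y2]
  note sq = gaussian_spaceD(2)[OF Y1] gaussian_spaceD(2)[OF Y2]
  have i12: "integrable M (\<lambda>\<omega>. Y1 \<omega> * Y2 \<omega>)" using sq by (intro integrable_mult_L2) auto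
  let ?D = "\<lambda>\<omega>. Y1 \<omega> - Y2 \<omega>"
  have D: "?D \<in> borel_measurable M" "integrable M (\<lambda>\<omega>. (?D \<omega>)\<^sup>2)"
    using sq i12 by (auto simp: power2_diff mult.assoc)
  have orth: "(\<integral>\<omega>. U \<omega> t * ?D \<omega> \<partial>M) = 0" if t: "t \<in> {0..T}" for t
  proof -
    have "(\<integral>\<omega>. U \<omega> t * Y1 \<omega> \<partial>M) = (\<integral>\<omega>. U \<omega> t * Y2 \<omega> \<partial>M)"
      using fun_cong[OF eq, of t] t by (simp add: rkhs_map_def)
    then show ?thesis
      using eval_mult_integrable[OF t gaussian_spaceD[OF Y1]] eval_mult_integrable[OF t gaussian_spaceD[OF Y2]]
      by (simp add: right_diff_distrib)
  qed
  have "(\<integral>\<omega>. Y1 \<omega> * ?D \<omega> \<partial>M) = 0" "(\<integral>\<omega>. Y2 \<omega> * ?D \<omega> \<partial>M) = 0"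
    by (rule gaussian_space_orthogonal[OF D orth Y1] gaussian_space_orthogonal[OF D orth Y2]; assumption)+
  then show ?thesis
    using sq i12 by (simp add: right_diff_distrib power2_eq_square mult.commute)
qed

lemma rkhs_sqnorm_map:
  assumes Y: "Y \<in> gaussian_space M T U"
  shows "rkhs_sqnorm M T U (rkhs_map M T U Y) = ereal (\<integral>\<omega>. (Y \<omega>)\<^sup>2 \<partial>M)"
proof -
  let ?Y = "inv_into (gaussian_space M T U) (rkhs_map M T U) (rkhs_map M T U Y)"
  have "rkhs_map M T U Y \<in> rkhs_map M T U ` gaussian_space M T U" using Y by simp
  then have "?Y \<in> gaussian_space M T U" "rkhs_map M T U ?Y = rkhs_map M T U Y"
    by (rule inv_into_into, rule f_inv_into_f)
  from rkhs_map_eq_imp_norm_eq[OF this(1) Y this(2)] show ?thesis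
    using Y by (simp add: rkhs_sqnorm_def rkhs_def)
qed

lemma rkhs_sqnorm_zero: "rkhs_sqnorm M T U (path_zero T) = 0"
proof -
  have "null_measure (restrict_space borel {0..T}) \<in> finite_measures_on T"
    by (auto simp: finite_measures_on_def intro!: finite_measureI)
  then have "(\<lambda>\<omega>. (\<integral>t. U \<omega> t \<partial>null_measure (restrict_space borel {0..T})) -
      (\<integral>t. U \<omega> t \<partial>null_measure (restrict_space borel {0..T}))) \<in> gaussian_functionals M T U"
    unfolding gaussian_functionals_def by blast
  then have "(\<lambda>\<omega>. 0) \<in> gaussian_functionals M T U" by simp
  then have "(\<lambda>\<omega>. 0) \<in> gaussian_space M T U"
    by (auto simp: gaussian_space_def intro!: bexI[of _ "\<lambda>\<omega>. 0"])
  from rkhs_sqnorm_map[OF this] show ?thesis by (simp add: rkhs_map_def path_zero_def zero_ereal_def)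
qed

lemma rkhs_sqnorm_eq_zero_imp:
  assumes "rkhs_sqnorm M T U h = 0"
  shows "h = path_zero T"
proof -
  have "h \<in> rkhs M T U" using assms by (auto simp: rkhs_sqnorm_def split: if_splits)
  then obtain Y where Y: "Y \<in> gaussian_space M T U" "h = rkhs_map M T U Y" by (auto simp: rkhs_def)
  then have "(\<integral>\<omega>. (Y \<omega>)\<^sup>2 \<partial>M) = 0" using rkhs_sqnorm_map[OF Y(1)] assms by (simp add: zero_ereal_def)
  then have "AE \<omega> in M. Y \<omega> = 0"
    using integral_nonneg_eq_0_iff_AE[OF gaussian_spaceD(2)[OF Y(1)]] by simp
  then have "(\<integral>\<omega>. U \<omega> t * Y \<omega> \<partial>M) = 0" if "t \<in> {0..T}" for t
    using gaussian_spaceD(1)[OF Y(1)] eval_measurable[OF that]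
    by (subst integral_cong_AE[of _ _ "\<lambda>_. 0"]) auto
  then show ?thesis by (auto simp: Y(2) rkhs_map_def path_zero_def)
qed

text \<open>Outside the sample space the paths of \<open>U\<close> are arbitrary functions, hence the restriction to
  \<open>\<omega> \<in> space M\<close>.\<close>

lemma finite_measures_on_scale:
  assumes \<mu>: "\<mu> \<in> finite_measures_on T" and c: "0 \<le> c"
  shows "density \<mu> (\<lambda>_. ennreal c) \<in> finite_measures_on T"
    and "\<omega> \<in> space M \<Longrightarrow> (\<integral>t. U \<omega> t \<partial>density \<mu> (\<lambda>_. ennreal c)) = c * (\<integral>t. U \<omega> t \<partial>\<mu>)"
proof -
  have fin: "finite_measure \<mu>" and sets: "sets \<mu> = sets (restrict_space borel {0..T})"
    using \<mu> by (auto simp: finite_measures_on_def)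
  interpret \<mu>: finite_measure \<mu> by fact
  have "finite_measure (density \<mu> (\<lambda>_. ennreal c))"
    by (rule finite_measureI) (simp add: emeasure_density_const ennreal_mult_eq_top_iff \<mu>.emeasure_finite)
  then show "density \<mu> (\<lambda>_. ennreal c) \<in> finite_measures_on T"
    using sets by (simp add: finite_measures_on_def)
  assume "\<omega> \<in> space M"
  then have "continuous_on {0..T} (U \<omega>)"
    using measurable_space[OF path_measurable] by (simp add: topspace_path_space)
  then have "U \<omega> \<in> borel_measurable \<mu>"
    unfolding measurable_cong_sets[OF sets refl] by (rule borel_measurable_continuous_on_restrict)
  then show "(\<integral>t. U \<omega> t \<partial>density \<mu> (\<lambda>_. ennreal c)) = c * (\<integral>t. U \<omega> t \<partial>\<mu>)"
    using c by (subst integral_real_density) auto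
qed

lemma gaussian_space_scale:
  assumes Y: "Y \<in> gaussian_space M T U" and c: "0 < c"
  shows "(\<lambda>\<omega>. c * Y \<omega>) \<in> gaussian_space M T U"
proof -
  have "\<exists>V\<in>gaussian_functionals M T U. (\<integral>\<^sup>+\<omega>. ennreal ((c * Y \<omega> - V \<omega>)\<^sup>2) \<partial>M) < e" if e: "0 < e" for e
  proof -
    have "0 < e / ennreal (c\<^sup>2)" using e c by (simp add: ennreal_zero_less_divide)
    then obtain V where V: "V \<in> gaussian_functionals M T U"
      "(\<integral>\<^sup>+\<omega>. ennreal ((Y \<omega> - V \<omega>)\<^sup>2) \<partial>M) < e / ennreal (c\<^sup>2)"
      using Y unfolding gaussian_space_def by blast
    obtain \<mu> \<nu> where mn: "V = (\<lambda>\<omega>. (\<integral>t. U \<omega> t \<partial>\<mu>) - (\<integral>t. U \<omega> t \<partial>\<nu>))"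
      "\<mu> \<in> finite_measures_on T" "\<nu> \<in> finite_measures_on T"
      using V(1) by (auto simp: gaussian_functionals_def)
    define W where "W = (\<lambda>\<omega>. (\<integral>t. U \<omega> t \<partial>density \<mu> (\<lambda>_. ennreal c)) - (\<integral>t. U \<omega> t \<partial>density \<nu> (\<lambda>_. ennreal c)))"
    have W: "W \<in> gaussian_functionals M T U"
      unfolding W_def gaussian_functionals_def
      using finite_measures_on_scale(1)[OF mn(2), of c] finite_measures_on_scale(1)[OF mn(3), of c] c
      by (intro CollectI exI[of _ "density \<mu> (\<lambda>_. ennreal c)"] exI[of _ "density \<nu> (\<lambda>_. ennreal c)"]) simp
    have WV: "W \<omega> = c * V \<omega>" if "\<omega> \<in> space M" for \<omega>
      using finite_measures_on_scale(2)[OF mn(2) _ that, of c] finite_measures_on_scale(2)[OF mn(3) _ that, of c] c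
      by (simp add: W_def mn(1) right_diff_distrib)
    have "(\<integral>\<^sup>+\<omega>. ennreal ((c * Y \<omega> - W \<omega>)\<^sup>2) \<partial>M) = (\<integral>\<^sup>+\<omega>. ennreal (c\<^sup>2) * ennreal ((Y \<omega> - V \<omega>)\<^sup>2) \<partial>M)"
      using WV by (intro nn_integral_cong)
        (simp add: ennreal_mult[symmetric] power_mult_distrib[symmetric] right_diff_distrib)
    also have "\<dots> = ennreal (c\<^sup>2) * (\<integral>\<^sup>+\<omega>. ennreal ((Y \<omega> - V \<omega>)\<^sup>2) \<partial>M)"
      using gaussian_spaceD(1)[OF Y] functional_measurable[OF V(1)] by (intro nn_integral_cmult) auto
    also have "\<dots> < ennreal (c\<^sup>2) * (e / ennreal (c\<^sup>2))"
      using c by (intro ennreal_mult_strict_left_mono V(2)) auto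
    also have "\<dots> = e" using c by (simp add: ennreal_times_divide ennreal_mult_divide_eq mult.commute)
    finally show ?thesis using W by blast
  qed
  then show ?thesis
    using gaussian_spaceD[OF Y] by (auto simp: gaussian_space_def power_mult_distrib)
qed

lemma rkhs_map_scale: "rkhs_map M T U (\<lambda>\<omega>. c * Y \<omega>) = (\<lambda>t\<in>{0..T}. c * rkhs_map M T U Y t)"
  by (auto simp: rkhs_map_def mult.left_commute intro!: restrict_ext)

lemma rkhs_sqnorm_scale:
  assumes c: "0 < c" and h: "h \<in> extensional {0..T}"
  shows "rkhs_sqnorm M T U (\<lambda>t\<in>{0..T}. c * h t) = ereal (c\<^sup>2) * rkhs_sqnorm M T U h"
proof (cases "h \<in> rkhs M T U")
  case True
  then obtain Y where Y: "Y \<in> gaussian_space M T U" "h = rkhs_map M T U Y" by (auto simp: rkhs_def)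
  show ?thesis
    unfolding Y(2) rkhs_map_scale[symmetric] rkhs_sqnorm_map[OF gaussian_space_scale[OF Y(1) c]] rkhs_sqnorm_map[OF Y(1)]
    by (simp add: power_mult_distrib)
next
  case False
  have "(\<lambda>t\<in>{0..T}. c * h t) \<notin> rkhs M T U"
  proof
    assume "(\<lambda>t\<in>{0..T}. c * h t) \<in> rkhs M T U"
    then obtain Y where Y: "Y \<in> gaussian_space M T U" "(\<lambda>t\<in>{0..T}. c * h t) = rkhs_map M T U Y" by (auto simp: rkhs_def)
    have "h = (\<lambda>t\<in>{0..T}. inverse c * (\<lambda>t\<in>{0..T}. c * h t) t)"
      using c h by (auto simp: extensional_def restrict_def)
    then have "h = rkhs_map M T U (\<lambda>\<omega>. inverse c * Y \<omega>)" unfolding Y(2) rkhs_map_scale .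
    moreover have "(\<lambda>\<omega>. inverse c * Y \<omega>) \<in> gaussian_space M T U" using c by (intro gaussian_space_scale Y) simp
    ultimately show False using False by (auto simp: rkhs_def)
  qed
  with False c show ?thesis by (simp add: rkhs_sqnorm_def)
qed

end

lemma rkhs_sqnorm_nonneg: "0 \<le> rkhs_sqnorm M T U h"
  by (simp add: rkhs_sqnorm_def)

section \<open>Minimising over the scale\<close>

text \<open>Both powers of \<open>t\<close> lie above the tangents of \<open>exp\<close> in the variable \<open>ln t\<close>, and the
  logarithms cancel.\<close>

lemma powr_inequality:
  fixes t \<theta> :: real
  assumes t: "0 < t" and \<theta>: "0 < \<theta>"
  shows "2 + \<theta> \<le> 2 * t powr \<theta> + \<theta> / t\<^sup>2"
proof -
  have "1 + \<theta> * ln t \<le> t powr \<theta>"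
    using exp_ge_add_one_self[of "\<theta> * ln t"] t by (simp add: powr_def)
  moreover have "1 - 2 * ln t \<le> 1 / t\<^sup>2"
  proof -
    have "exp (- 2 * ln t) = inverse (exp (ln t) * exp (ln t))"
      by (simp add: exp_minus exp_add[symmetric])
    then show ?thesis
      using exp_ge_add_one_self[of "- 2 * ln t"] t by (simp add: power2_eq_square inverse_eq_divide)
  qed
  then have "\<theta> * (1 - 2 * ln t) \<le> \<theta> * (1 / t\<^sup>2)" using \<theta> by (intro mult_left_mono) auto
  ultimately show ?thesis by (simp add: algebra_simps)
qed

lemma psi_pos: "0 < d \<Longrightarrow> 0 < \<theta> \<Longrightarrow> 0 < psi d \<theta>"
  by (simp add: psi_def add_pos_pos)

text \<open>The zero in \<open>a\<close> of the derivative of \<open>d * a powr \<theta> + s / a\<^sup>2\<close>.\<close>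

definition optimal_scale :: "real \<Rightarrow> real \<Rightarrow> real \<Rightarrow> real" where
  "optimal_scale d \<theta> s = (2 * s / (d * \<theta>)) powr (1 / (\<theta> + 2))"

lemma psi_attained:
  assumes d: "0 < d" and \<theta>: "0 < \<theta>" and s: "0 < s"
  defines "a \<equiv> optimal_scale d \<theta> s"
  shows "d * a powr \<theta> + s / a\<^sup>2 = psi d \<theta> * s powr (\<theta> / (\<theta> + 2))"
proof -
  define p where "p = \<theta> / (\<theta> + 2)"
  define q where "q = 2 / (\<theta> + 2)"
  have pq: "p = 1 - q" using \<theta> by (simp add: p_def q_def field_simps)
  let ?D = "d * \<theta>"
  have D: "0 < ?D" using d \<theta> by simp
  have a\<theta>: "a powr \<theta> = 2 powr p * s powr p * ?D powr (- p)"
    using D s by (simp add: a_def optimal_scale_def powr_powr p_def powr_divide powr_mult powr_minus divide_simps)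
  have a2: "s / a\<^sup>2 = 1 / 2 * 2 powr p * s powr p * ?D powr q"
  proof -
    have apos: "0 < a" using d \<theta> s by (simp add: a_def optimal_scale_def)
    have "a\<^sup>2 = a powr 2" using apos by simp
    also have "\<dots> = (2 * s / ?D) powr q" by (simp add: a_def optimal_scale_def powr_powr q_def)
    also have "\<dots> = 2 powr q * s powr q / ?D powr q" using D s by (simp add: powr_divide powr_mult)
    finally have "s / a\<^sup>2 = s / s powr q * (1 / 2 powr q) * ?D powr q" using s D by (simp add: field_simps)
    also have "s / s powr q = s powr p" using s by (simp add: pq powr_diff)
    also have "1 / 2 powr q = 1 / 2 * 2 powr p" by (simp add: pq powr_diff)
    finally show ?thesis by (simp add: mult_ac)
  qed
  have "psi d \<theta> = 2 powr p * (d * ?D powr (- p) + 1 / 2 * ?D powr q)"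
    by (simp add: psi_def p_def q_def)
  then show ?thesis unfolding a\<theta> a2 p_def[symmetric] by (simp add: algebra_simps)
qed

text \<open>Measured in units of the stationary point, \<open>a = optimal_scale d \<theta> s * t\<close>, the claim becomes
  the inequality in \<open>t\<close> above.\<close>

lemma psi_lower_bound:
  assumes d: "0 < d" and \<theta>: "0 < \<theta>" and s: "0 < s" and a: "0 < a"
  shows "psi d \<theta> * s powr (\<theta> / (\<theta> + 2)) \<le> d * a powr \<theta> + s / a\<^sup>2"
proof -
  let ?o = "optimal_scale d \<theta> s"
  define c where "c = s / ?o\<^sup>2"
  have o: "0 < ?o" using d \<theta> s by (simp add: optimal_scale_def)
  have c: "0 < c" using o s by (simp add: c_def)
  \<comment> \<open>The stationarity condition of the minimisation.\<close>
  have stat: "d * ?o powr \<theta> = c * 2 / \<theta>"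
  proof -
    have "?o powr \<theta> * ?o\<^sup>2 = ?o powr (\<theta> + 2)" using o by (simp add: powr_add)
    also have "\<dots> = 2 * s / (d * \<theta>)" using d \<theta> s by (simp add: optimal_scale_def powr_powr)
    finally have "?o powr \<theta> * ?o\<^sup>2 = 2 * s / (d * \<theta>)" .
    then have "?o powr \<theta> = 2 * s / (d * \<theta>) / ?o\<^sup>2"
      using o d \<theta> by (intro nonzero_eq_divide_eq[THEN iffD2]) simp_all
    then show ?thesis using d by (simp add: c_def mult.commute)
  qed
  define t where "t = a / ?o"
  have t: "0 < t" "a = ?o * t" using a o by (simp_all add: t_def)
  have "psi d \<theta> * s powr (\<theta> / (\<theta> + 2)) = c / \<theta> * (2 + \<theta>)"
    unfolding psi_attained[OF d \<theta> s, symmetric] stat c_def[symmetric] using \<theta> by (simp add: field_simps)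
  also have "\<dots> \<le> c / \<theta> * (2 * t powr \<theta> + \<theta> / t\<^sup>2)"
    using powr_inequality[OF t(1) \<theta>] c \<theta> by (intro mult_left_mono) auto
  also have "\<dots> = d * ?o powr \<theta> * t powr \<theta> + c / t\<^sup>2" unfolding stat using \<theta> t by (simp add: field_simps)
  also have "\<dots> = d * a powr \<theta> + s / a\<^sup>2"
    unfolding t(2) using o t by (simp add: powr_mult power_mult_distrib c_def)
  finally show ?thesis .
qed

context gaussian_process
begin

lemma scale_rate_lower_bound:
  assumes d: "0 < d" and \<theta>: "0 < \<theta>" and a: "0 \<le> a"
  shows "ereal (psi d \<theta>) * powr_ereal (ereal (1 / 2) * rkhs_sqnorm M T U (path_diff T z b)) (\<theta> / (\<theta> + 2))
    \<le> ereal (d * a powr \<theta>) + J_rate M T U z a b"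
proof (cases "rkhs_sqnorm M T U (path_diff T z b)")
  case (real s)
  then have s: "0 \<le> s" using rkhs_sqnorm_nonneg[of M T U "path_diff T z b"] by simp
  have J0: "0 \<le> J_rate M T U z a b"
    using s real by (auto simp: J_rate_def)
  show ?thesis
  proof (cases "s = 0 \<or> a = 0")
    case True
    show ?thesis
    proof (cases "s = 0")
      case True
      have "0 \<le> ereal (d * a powr \<theta>) + J_rate M T U z a b"
        using d J0 by (intro add_nonneg_nonneg) simp_all
      then show ?thesis using True real by (simp add: powr_ereal_def zero_ereal_def)
    next
      case False
      then have "path_diff T z b \<noteq> path_zero T" using real rkhs_sqnorm_zero by auto
      then show ?thesis using True False by (simp add: J_rate_def)
    qed
  next
    case False
    with a s have "0 < a" "0 < s / 2" by auto
    then show ?thesis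
      using psi_lower_bound[OF d \<theta>, of "s / 2" a] real by (simp add: J_rate_def powr_ereal_def)
  qed
next
  case PInf
  then have "path_diff T z b \<noteq> path_zero T" using rkhs_sqnorm_zero by auto
  then have "J_rate M T U z a b = \<infinity>" using PInf a by (auto simp: J_rate_def)
  then show ?thesis by simp
next
  case MInf
  then show ?thesis using rkhs_sqnorm_nonneg[of M T U "path_diff T z b"] by simp
qed

text \<open>If the norm vanishes, the two paths coincide and \<open>a = 0\<close> is optimal; if it is infinite, so is
  every value, and \<open>a = 1\<close> is as good as any other scale.\<close>

lemma scale_rate_attained:
  assumes d: "0 < d" and \<theta>: "0 < \<theta>"
  shows "\<exists>a\<ge>0. ereal (d * a powr \<theta>) + J_rate M T U z a b =
    ereal (psi d \<theta>) * powr_ereal (ereal (1 / 2) * rkhs_sqnorm M T U (path_diff T z b)) (\<theta> / (\<theta> + 2))"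
proof (cases "rkhs_sqnorm M T U (path_diff T z b)")
  case (real s)
  then have s: "0 \<le> s" using rkhs_sqnorm_nonneg[of M T U "path_diff T z b"] by simp
  show ?thesis
  proof (cases "s = 0")
    case True
    then have "path_diff T z b = path_zero T" using real rkhs_sqnorm_eq_zero_imp by (simp add: zero_ereal_def)
    then show ?thesis
      using True real by (intro exI[of _ 0]) (simp add: J_rate_def powr_ereal_def zero_ereal_def)
  next
    case False
    with s have s2: "0 < s / 2" by simp
    have "0 < optimal_scale d \<theta> (s / 2)" using d \<theta> s2 by (simp add: optimal_scale_def)
    then show ?thesis
      using psi_attained[OF d \<theta> s2] real
      by (intro exI[of _ "optimal_scale d \<theta> (s / 2)"]) (simp add: J_rate_def powr_ereal_def)
  qed
next
  case PInf
  then show ?thesis using psi_pos[OF d \<theta>]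
    by (intro exI[of _ 1]) (simp add: J_rate_def powr_ereal_def)
next
  case MInf
  then show ?thesis using rkhs_sqnorm_nonneg[of M T U "path_diff T z b"] by simp
qed

end

section \<open>The scaling and shifting map\<close>

definition scale_shift :: "real \<Rightarrow> real ^ 'p \<Rightarrow> (real \<Rightarrow> real ^ 'p) \<Rightarrow> (real \<Rightarrow> real ^ 'p) \<Rightarrow> real \<Rightarrow> real ^ 'p::finite" where
  "scale_shift T a b x = (\<lambda>t\<in>{0..T}. \<chi> i. a $ i * x t $ i + b t $ i)"

lemma scale_shift_in_path_space:
  assumes "b \<in> topspace (path_space T)" "x \<in> topspace (path_space T)"
  shows "scale_shift T a b x \<in> topspace (path_space T)"
  unfolding scale_shift_def using assms
  by (intro restrict_in_path_space continuous_intros) (auto simp: topspace_path_space)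

lemma norm_componentwise_product_le:
  "norm (\<chi> i. u $ i * v $ i :: real ^ 'p::finite) \<le> norm u * norm v"
proof -
  have "norm (\<chi> i. u $ i * v $ i :: real ^ 'p) \<le> norm (norm u *\<^sub>R v)"
    by (rule norm_le_componentwise_cart) (simp add: abs_mult mult_right_mono component_le_norm_cart)
  then show ?thesis by simp
qed

lemma continuous_map_scale_shift:
  "continuous_map (prod_topology (prod_topology nonneg_orthant (path_space T)) (path_space T)) (path_space T)
     (\<lambda>((a, b), x). scale_shift T a b x :: real \<Rightarrow> real ^ 'p::finite)"
proof (rule continuous_map_to_path_space)
  show "(\<lambda>((a, b), x). scale_shift T a b x) \<in> topspace (prod_topology (prod_topology nonneg_orthant (path_space T)) (path_space T))
      \<rightarrow> topspace (path_space T :: (real \<Rightarrow> real ^ 'p) topology)"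
    using scale_shift_in_path_space by auto
next
  fix w :: "((real ^ 'p) \<times> (real \<Rightarrow> real ^ 'p)) \<times> (real \<Rightarrow> real ^ 'p)" and \<epsilon> :: real
  assume w: "w \<in> topspace (prod_topology (prod_topology nonneg_orthant (path_space T)) (path_space T :: (real \<Rightarrow> real ^ 'p) topology))"
    and \<epsilon>: "0 < \<epsilon>"
  obtain a b x where w_eq: "w = ((a, b), x)" by (metis surj_pair)
  have a: "a \<in> topspace nonneg_orthant" and b: "b \<in> topspace (path_space T)" and x: "x \<in> topspace (path_space T)"
    using w by (auto simp: w_eq)
  have "compact (x ` {0..T})" using x by (intro compact_continuous_image) (auto simp: topspace_path_space)
  then obtain K where K: "0 < K" "\<And>t. t \<in> {0..T} \<Longrightarrow> norm (x t) \<le> K"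
    by (metis bounded_pos compact_imp_bounded imageI)
  \<comment> \<open>In \<open>(a x + b) - (a' x' + b') = (a - a') x + a' (x - x') + (b - b')\<close> the three terms are at most
    \<open>\<delta> K\<close>, \<open>(norm a + 1) \<delta>\<close> and \<open>\<delta>\<close>.\<close>
  define L where "L = K + norm a + 2"
  have L: "0 < L" using K(1) norm_ge_zero[of a] unfolding L_def by linarith
  define \<delta> where "\<delta> = min 1 (\<epsilon> / L)"
  have \<delta>: "0 < \<delta>" "\<delta> \<le> 1" "\<delta> * L \<le> \<epsilon>" using \<epsilon> L by (auto simp: \<delta>_def min_def field_simps)
  let ?O = "topspace nonneg_orthant \<inter> ball a \<delta>"
  let ?U = "(?O \<times> path_ball T b \<delta>) \<times> path_ball T x \<delta>"
  have O: "openin nonneg_orthant ?O"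
    by (auto simp: nonneg_orthant_def openin_open)
  have "openin (prod_topology (prod_topology nonneg_orthant (path_space T)) (path_space T)) ?U"
    by (intro openin_prod_Times_iff[THEN iffD2] disjI2 conjI O openin_path_ball)
  moreover have "w \<in> ?U"
    using a b x \<delta>(1) by (auto simp: w_eq intro!: path_ballI[of _ _ _ 0])
  moreover have "dist (scale_shift T a b x t) (scale_shift T a' b' x' t) \<le> \<epsilon>"
    if U: "((a', b'), x') \<in> ?U" and t: "t \<in> {0..T}" for a' b' x' t
  proof -
    have da: "norm (a - a') \<le> \<delta>" using U by (simp add: dist_norm)
    have dx: "norm (x t - x' t) \<le> \<delta>" using U path_ballD[of x' T x \<delta> t] t by (simp add: dist_norm)
    have db: "norm (b t - b' t) \<le> \<delta>" using U path_ballD[of b' T b \<delta> t] t by (simp add: dist_norm)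
    have "norm a' \<le> norm a + norm (a - a')" using norm_triangle_sub[of a' a] by (simp add: norm_minus_commute)
    then have a': "norm a' \<le> norm a + 1" using da \<delta>(2) by simp
    have "scale_shift T a b x t - scale_shift T a' b' x' t =
        (\<chi> i. (a - a') $ i * x t $ i) + (\<chi> i. a' $ i * (x t - x' t) $ i) + (b t - b' t)"
      using t by (simp add: scale_shift_def vec_eq_iff algebra_simps)
    then have "dist (scale_shift T a b x t) (scale_shift T a' b' x' t) \<le>
        norm (\<chi> i. (a - a') $ i * x t $ i) + norm (\<chi> i. a' $ i * (x t - x' t) $ i) + norm (b t - b' t)"
      by (simp only: dist_norm) (intro norm_triangle_le add_mono order_refl norm_triangle_ineq)
    also have "\<dots> \<le> \<delta> * K + (norm a + 1) * \<delta> + \<delta>"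
    proof (intro add_mono db)
      show "norm (\<chi> i. (a - a') $ i * x t $ i) \<le> \<delta> * K"
        using norm_componentwise_product_le[of "a - a'" "x t"] mult_mono[OF da K(2)[OF t]] \<delta>(1) by simp
      show "norm (\<chi> i. a' $ i * (x t - x' t) $ i) \<le> (norm a + 1) * \<delta>"
        using norm_componentwise_product_le[of a' "x t - x' t"] mult_mono[OF a' dx] by simp
    qed
    also have "\<dots> = \<delta> * L" by (simp add: L_def algebra_simps)
    also have "\<dots> \<le> \<epsilon>" by (fact \<delta>(3))
    finally show ?thesis .
  qed
  ultimately show "\<exists>U. openin (prod_topology (prod_topology nonneg_orthant (path_space T)) (path_space T)) U \<and> w \<in> U \<and>
      (\<forall>v\<in>U. \<forall>t\<in>{0..T}. dist ((\<lambda>((a, b), x). scale_shift T a b x) w t) ((\<lambda>((a, b), x). scale_shift T a b x) v t) \<le> \<epsilon>)"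
    by (intro exI[of _ ?U]) (auto simp: w_eq)
qed

section \<open>The rate function of the scaled and shifted process\<close>

lemma (in gaussian_process) J_rate_of_scaled:
  assumes h: "h \<in> extensional {0..T}" and a: "0 \<le> a" and eq: "path_diff T z b = (\<lambda>t\<in>{0..T}. a * h t)"
  shows "J_rate M T U z a b = (if a = 0 then 0 else ereal (1 / 2) * rkhs_sqnorm M T U h)"
proof (cases "a = 0")
  case True
  then show ?thesis by (simp add: J_rate_def eq path_zero_def)
next
  case False
  with a have "0 < a" by simp
  have "ereal (1 / (2 * a\<^sup>2)) * (ereal (a\<^sup>2) * rkhs_sqnorm M T U h) = ereal (1 / 2) * rkhs_sqnorm M T U h"
    using \<open>0 < a\<close> by (simp add: mult.assoc[symmetric])
  then show ?thesis
    using \<open>0 < a\<close> by (simp add: J_rate_def eq rkhs_sqnorm_scale[OF _ h])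
qed

lemma joint_rate_split:
  "joint_rate N T U d \<theta> I_B ((a, b), z) =
     (ereal (\<Sum>i\<in>UNIV. d i * (a $ i) powr \<theta> i) + I_B b) +
     (\<Sum>i\<in>UNIV. J_rate (N i) T (U i) (coord_path T i z) (a $ i) (coord_path T i b))"
  by (simp add: joint_rate_def sum.distrib add_ac flip: sum_ereal)

lemma path_diff_scale_shift:
  "path_diff T (coord_path T i (scale_shift T a b x)) (coord_path T i b) =
     (\<lambda>t\<in>{0..T}. a $ i * coord_path T i x t)"
  by (auto simp: path_diff_def coord_path_def scale_shift_def restrict_def)

lemma coord_path_extensional: "coord_path T i x \<in> extensional {0..T}"
  by (simp add: coord_path_def)

lemma J_rate_infinite:
  assumes "a = 0" "path_diff T z b \<noteq> path_zero T"
  shows "J_rate M T U z a b = \<infinity>"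
  using assms by (simp add: J_rate_def)

text \<open>The witness for the fibre over \<open>((a, b), z)\<close> is \<open>(z - b) / a\<close> in the coordinates with
  positive scale. In the others the scaled process is invisible, and the zero path, which costs
  nothing, is optimal. If \<open>z\<close> and \<open>b\<close> differ in a coordinate of scale zero, the fibre is empty and
  both sides are infinite.\<close>

lemma joint_rate_fibre_inf:
  fixes a :: "real ^ 'p::finite"
  assumes G: "\<And>i. gaussian_process (N i) T (U i)"
    and a: "a \<in> topspace nonneg_orthant" and b: "b \<in> topspace (path_space T)"
    and z: "z \<in> topspace (path_space T)"
  shows "joint_rate N T U d \<theta> I_B ((a, b), z) =
    (INF w\<in>{w \<in> topspace (prod_topology (prod_topology nonneg_orthant (path_space T)) (path_space T)).
        (\<lambda>((a, b), x). ((a, b), scale_shift T a b x)) w = ((a, b), z)}.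
      (\<lambda>(p, x). (\<lambda>(a, b). ereal (\<Sum>i\<in>UNIV. d i * (a $ i) powr \<theta> i) + I_B b) p +
        (\<Sum>i\<in>UNIV. ereal (1 / 2) * rkhs_sqnorm (N i) T (U i) (coord_path T i x))) w)"
    (is "?J = (INF w\<in>?F. ?I w)")
proof (rule antisym)
  interpret G: gaussian_process "N i" T "U i" for i by (rule G)
  have a0: "0 \<le> a $ i" for i using a by (simp add: nonneg_orthant_def)
  have J: "J_rate (N i) T (U i) (coord_path T i (scale_shift T a b x)) (a $ i) (coord_path T i b) =
      (if a $ i = 0 then 0 else ereal (1 / 2) * rkhs_sqnorm (N i) T (U i) (coord_path T i x))" for i x
    by (rule G.J_rate_of_scaled[OF coord_path_extensional a0 path_diff_scale_shift])
  show "?J \<le> (INF w\<in>?F. ?I w)"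
  proof (rule INF_greatest)
    fix w assume "w \<in> ?F"
    then obtain x where w: "w = ((a, b), x)" and zx: "z = scale_shift T a b x"
      by auto
    have "J_rate (N i) T (U i) (coord_path T i z) (a $ i) (coord_path T i b) \<le>
        ereal (1 / 2) * rkhs_sqnorm (N i) T (U i) (coord_path T i x)" for i
      unfolding zx J using rkhs_sqnorm_nonneg[of "N i" T "U i" "coord_path T i x"] by simp
    then show "?J \<le> ?I w"
      unfolding joint_rate_split w by (simp only: prod.case) (intro add_left_mono sum_mono)
  qed
  show "(INF w\<in>?F. ?I w) \<le> ?J"
  proof (cases "\<exists>i. a $ i = 0 \<and> path_diff T (coord_path T i z) (coord_path T i b) \<noteq> path_zero T")
    case True
    then obtain i where "a $ i = 0" "path_diff T (coord_path T i z) (coord_path T i b) \<noteq> path_zero T" by blast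
    then have "J_rate (N i) T (U i) (coord_path T i z) (a $ i) (coord_path T i b) = \<infinity>"
      by (rule J_rate_infinite)
    then have "(\<Sum>i\<in>UNIV. J_rate (N i) T (U i) (coord_path T i z) (a $ i) (coord_path T i b)) = \<infinity>"
      unfolding sum_Pinfty by (intro conjI bexI[of _ i]) simp_all
    then have "?J = \<infinity>" unfolding joint_rate_split by simp
    then show ?thesis by simp
  next
    case False
    then have eq: "z t $ i = b t $ i" if "a $ i = 0" "t \<in> {0..T}" for i t
    proof -
      have "path_diff T (coord_path T i z) (coord_path T i b) t = path_zero T t" using False that(1) by auto
      then show ?thesis using that(2) by (simp add: path_diff_def coord_path_def path_zero_def)
    qed
    define x where "x = (\<lambda>t\<in>{0..T}. \<chi> i. if a $ i = 0 then 0 else (z t $ i - b t $ i) / a $ i)"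
    have x: "x \<in> topspace (path_space T)"
      unfolding x_def
    proof (intro restrict_in_path_space continuous_on_vec_lambda)
      show "continuous_on {0..T} (\<lambda>t. if a $ i = 0 then 0 else (z t $ i - b t $ i) / a $ i)" for i
        using b z by (cases "a $ i = 0") (auto simp: topspace_path_space intro!: continuous_intros)
    qed
    have zx: "scale_shift T a b x = z"
    proof
      fix t
      show "scale_shift T a b x t = z t"
      proof (cases "t \<in> {0..T}")
        case True
        then show ?thesis using eq by (auto simp: scale_shift_def x_def vec_eq_iff)
      next
        case False
        then show ?thesis using z by (auto simp: scale_shift_def topspace_path_space extensional_def)
      qed
    qed
    have "ereal (1 / 2) * rkhs_sqnorm (N i) T (U i) (coord_path T i x) =
        J_rate (N i) T (U i) (coord_path T i z) (a $ i) (coord_path T i b)" for i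
    proof (cases "a $ i = 0")
      case True
      then have "coord_path T i x = path_zero T" by (auto simp: coord_path_def x_def path_zero_def)
      then show ?thesis using True J[of i x] zx G.rkhs_sqnorm_zero by simp
    next
      case False
      then show ?thesis using J[of i x] zx by simp
    qed
    then have "?I ((a, b), x) = ?J" unfolding joint_rate_split by simp
    moreover have "((a, b), x) \<in> ?F" using a b x zx by simp
    ultimately show ?thesis by (metis (no_types, lifting) INF_lower)
  qed
qed

lemma joint_rate_cases:
  assumes a: "a \<in> topspace nonneg_orthant"
  shows "joint_rate N T U d \<theta> I_B ((a, b), z) =
    (if \<forall>i\<in>{i. a $ i = 0}. path_diff T (coord_path T i z) (coord_path T i b) = path_zero T
     then I_B b + (\<Sum>i\<in>{i. a $ i > 0}. ereal (d i * (a $ i) powr \<theta> i) +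
       ereal (1 / (2 * (a $ i)\<^sup>2)) *
         rkhs_sqnorm (N i) T (U i) (path_diff T (coord_path T i z) (coord_path T i b)))
     else \<infinity>)"
proof (cases "\<forall>i\<in>{i. a $ i = 0}. path_diff T (coord_path T i z) (coord_path T i b) = path_zero T")
  case True
  have a0: "0 \<le> a $ i" for i using a by (simp add: nonneg_orthant_def)
  have "(\<Sum>i\<in>UNIV. ereal (d i * (a $ i) powr \<theta> i) +
         J_rate (N i) T (U i) (coord_path T i z) (a $ i) (coord_path T i b)) =
       (\<Sum>i\<in>{i. a $ i > 0}. ereal (d i * (a $ i) powr \<theta> i) +
         J_rate (N i) T (U i) (coord_path T i z) (a $ i) (coord_path T i b))"
  proof (rule sum.mono_neutral_right)
    show "\<forall>i\<in>UNIV - {i. a $ i > 0}. ereal (d i * (a $ i) powr \<theta> i) +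
        J_rate (N i) T (U i) (coord_path T i z) (a $ i) (coord_path T i b) = 0"
    proof
      fix i assume "i \<in> UNIV - {i. a $ i > 0}"
      then have "a $ i = 0" using a0[of i] by simp
      then show "ereal (d i * (a $ i) powr \<theta> i) +
        J_rate (N i) T (U i) (coord_path T i z) (a $ i) (coord_path T i b) = 0"
        using True by (simp add: J_rate_def zero_ereal_def)
    qed
  qed auto
  also have "\<dots> = (\<Sum>i\<in>{i. a $ i > 0}. ereal (d i * (a $ i) powr \<theta> i) +
       ereal (1 / (2 * (a $ i)\<^sup>2)) *
         rkhs_sqnorm (N i) T (U i) (path_diff T (coord_path T i z) (coord_path T i b)))"
    by (intro sum.cong) (auto simp: J_rate_def)
  finally show ?thesis unfolding if_P[OF True] by (simp add: joint_rate_def)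
next
  case False
  then obtain i where "a $ i = 0" "path_diff T (coord_path T i z) (coord_path T i b) \<noteq> path_zero T" by blast
  then have "J_rate (N i) T (U i) (coord_path T i z) (a $ i) (coord_path T i b) = \<infinity>"
    by (rule J_rate_infinite)
  then have "(\<Sum>i\<in>UNIV. J_rate (N i) T (U i) (coord_path T i z) (a $ i) (coord_path T i b)) = \<infinity>"
    unfolding sum_Pinfty by (intro conjI bexI[of _ i]) simp_all
  then show ?thesis unfolding if_not_P[OF False] joint_rate_split by simp
qed

text \<open>The scales of different coordinates can be optimised separately, and every one of these
  minima is attained.\<close>

lemma joint_rate_inf_over_scales:
  fixes z :: "real \<Rightarrow> real ^ 'p::finite"
  assumes G: "\<And>i. gaussian_process (N i) T (U i)" and d: "\<And>i. 0 < d i" and \<theta>: "\<And>i. 0 < \<theta> i"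
  shows "(INF (a, b)\<in>topspace nonneg_orthant \<times> topspace (path_space T). joint_rate N T U d \<theta> I_B ((a, b), z)) =
    (INF b\<in>topspace (path_space T). I_B b + (\<Sum>i\<in>UNIV. ereal (psi (d i) (\<theta> i)) *
      powr_ereal (ereal (1 / 2) * rkhs_sqnorm (N i) T (U i) (path_diff T (coord_path T i z) (coord_path T i b)))
        (\<theta> i / (\<theta> i + 2))))"
    (is "?L = (INF b\<in>_. I_B b + (\<Sum>i\<in>UNIV. ?g i b))")
proof (rule antisym)
  interpret G: gaussian_process "N i" T "U i" for i by (rule G)
  show "(INF b\<in>topspace (path_space T). I_B b + (\<Sum>i\<in>UNIV. ?g i b)) \<le> ?L"
  proof (rule INF_greatest)
    fix p :: "(real ^ 'p) \<times> (real \<Rightarrow> real ^ 'p)"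
    assume p: "p \<in> topspace nonneg_orthant \<times> topspace (path_space T)"
    obtain a b where ab: "p = (a, b)" "a \<in> topspace nonneg_orthant" "b \<in> topspace (path_space T)"
      using p by auto
    have a0: "0 \<le> a $ i" for i using ab(2) by (simp add: nonneg_orthant_def)
    have "(INF b\<in>topspace (path_space T). I_B b + (\<Sum>i\<in>UNIV. ?g i b)) \<le> I_B b + (\<Sum>i\<in>UNIV. ?g i b)"
      using ab(3) by (rule INF_lower)
    also have "\<dots> \<le> joint_rate N T U d \<theta> I_B ((a, b), z)"
      unfolding joint_rate_def prod.case
      by (intro add_left_mono sum_mono G.scale_rate_lower_bound d \<theta> a0)
    finally show "(INF b\<in>topspace (path_space T). I_B b + (\<Sum>i\<in>UNIV. ?g i b)) \<le>
        (case p of (a, b) \<Rightarrow> joint_rate N T U d \<theta> I_B ((a, b), z))" by (simp add: ab(1))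
  qed
  show "?L \<le> (INF b\<in>topspace (path_space T). I_B b + (\<Sum>i\<in>UNIV. ?g i b))"
  proof (rule INF_greatest)
    fix b :: "real \<Rightarrow> real ^ 'p" assume b: "b \<in> topspace (path_space T)"
    have "\<forall>i. \<exists>x\<ge>0. ereal (d i * x powr \<theta> i) + J_rate (N i) T (U i) (coord_path T i z) x (coord_path T i b) = ?g i b"
      by (intro allI G.scale_rate_attained d \<theta>)
    from choice[OF this] obtain f where f: "\<forall>i. 0 \<le> f i \<and>
      ereal (d i * f i powr \<theta> i) + J_rate (N i) T (U i) (coord_path T i z) (f i) (coord_path T i b) = ?g i b" ..
    let ?a = "\<chi> i. f i"
    have "?a \<in> topspace nonneg_orthant" using f by (simp add: nonneg_orthant_def)
    then have "?L \<le> (case (?a, b) of (a, b) \<Rightarrow> joint_rate N T U d \<theta> I_B ((a, b), z))"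
      using b by (intro INF_lower) simp
    also have "\<dots> = I_B b + (\<Sum>i\<in>UNIV. ?g i b)"
      using f by (simp add: joint_rate_def)
    finally show "?L \<le> I_B b + (\<Sum>i\<in>UNIV. ?g i b)" .
  qed
qed

section \<open>The large deviation principles\<close>

lemma indep_rvs_coordinates:
  assumes M: "prob_space M"
    and indep: "indep_rvs M (PiM UNIV (\<lambda>n::nat. N1)) (\<lambda>\<omega> n. Y1 n \<omega>) (PiM UNIV (\<lambda>n::nat. N2)) (\<lambda>\<omega> n. Y2 n \<omega>)"
  shows "Y1 n \<in> measurable M N1" and "Y2 n \<in> measurable M N2"
    and "S1 \<in> sets N1 \<Longrightarrow> S2 \<in> sets N2 \<Longrightarrow>
      measure M {\<omega> \<in> space M. Y1 n \<omega> \<in> S1 \<and> Y2 n \<omega> \<in> S2} =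
      measure M {\<omega> \<in> space M. Y1 n \<omega> \<in> S1} * measure M {\<omega> \<in> space M. Y2 n \<omega> \<in> S2}"
proof -
  interpret prob_space M by fact
  have m1: "(\<lambda>\<omega> n. Y1 n \<omega>) \<in> measurable M (PiM UNIV (\<lambda>n. N1))"
    and m2: "(\<lambda>\<omega> n. Y2 n \<omega>) \<in> measurable M (PiM UNIV (\<lambda>n. N2))"
    and ind: "indep_set {(\<lambda>\<omega> n. Y1 n \<omega>) -` S \<inter> space M |S. S \<in> sets (PiM UNIV (\<lambda>n. N1))}
       {(\<lambda>\<omega> n. Y2 n \<omega>) -` S \<inter> space M |S. S \<in> sets (PiM UNIV (\<lambda>n. N2))}"
    using indep by (auto simp: indep_rvs_def)
  show "Y1 n \<in> measurable M N1"
    using measurable_compose[OF m1 measurable_component_singleton[of n]] by simp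
  show "Y2 n \<in> measurable M N2"
    using measurable_compose[OF m2 measurable_component_singleton[of n]] by simp
  assume S1: "S1 \<in> sets N1" and S2: "S2 \<in> sets N2"
  let ?C1 = "(\<lambda>f. f n) -` S1 \<inter> space (PiM UNIV (\<lambda>n. N1))"
  let ?C2 = "(\<lambda>f. f n) -` S2 \<inter> space (PiM UNIV (\<lambda>n. N2))"
  have C1: "?C1 \<in> sets (PiM UNIV (\<lambda>n. N1))"
    by (intro measurable_sets[OF _ S1] measurable_component_singleton) simp
  have C2: "?C2 \<in> sets (PiM UNIV (\<lambda>n. N2))"
    by (intro measurable_sets[OF _ S2] measurable_component_singleton) simp
  have e1: "(\<lambda>\<omega> n. Y1 n \<omega>) -` ?C1 \<inter> space M = {\<omega> \<in> space M. Y1 n \<omega> \<in> S1}"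
    using measurable_space[OF m1] by auto
  have e2: "(\<lambda>\<omega> n. Y2 n \<omega>) -` ?C2 \<inter> space M = {\<omega> \<in> space M. Y2 n \<omega> \<in> S2}"
    using measurable_space[OF m2] by auto
  have "prob ({\<omega> \<in> space M. Y1 n \<omega> \<in> S1} \<inter> {\<omega> \<in> space M. Y2 n \<omega> \<in> S2}) =
      prob {\<omega> \<in> space M. Y1 n \<omega> \<in> S1} * prob {\<omega> \<in> space M. Y2 n \<omega> \<in> S2}"
  proof (rule indep_setD[OF ind])
    show "{\<omega> \<in> space M. Y1 n \<omega> \<in> S1} \<in> {(\<lambda>\<omega> n. Y1 n \<omega>) -` S \<inter> space M |S. S \<in> sets (PiM UNIV (\<lambda>n. N1))}"
      using C1 e1[symmetric] by (intro CollectI exI[of _ ?C1] conjI)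
    show "{\<omega> \<in> space M. Y2 n \<omega> \<in> S2} \<in> {(\<lambda>\<omega> n. Y2 n \<omega>) -` S \<inter> space M |S. S \<in> sets (PiM UNIV (\<lambda>n. N2))}"
      using C2 e2[symmetric] by (intro CollectI exI[of _ ?C2] conjI)
  qed
  moreover have "{\<omega> \<in> space M. Y1 n \<omega> \<in> S1} \<inter> {\<omega> \<in> space M. Y2 n \<omega> \<in> S2} =
      {\<omega> \<in> space M. Y1 n \<omega> \<in> S1 \<and> Y2 n \<omega> \<in> S2}" by auto
  ultimately show "prob {\<omega> \<in> space M. Y1 n \<omega> \<in> S1 \<and> Y2 n \<omega> \<in> S2} =
      prob {\<omega> \<in> space M. Y1 n \<omega> \<in> S1} * prob {\<omega> \<in> space M. Y2 n \<omega> \<in> S2}" by simp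
qed

lemma metrizable_nonneg_orthant: "metrizable_space nonneg_orthant"
  unfolding nonneg_orthant_def by (intro metrizable_space_subtopology metrizable_space_euclidean)

lemma second_countable_nonneg_orthant: "second_countable nonneg_orthant"
  unfolding nonneg_orthant_def by (intro second_countable_subtopology second_countable_euclidean)


theorem corollary3p4:
  fixes T :: real
    and M :: "'w measure"
    and X B Z :: "nat \<Rightarrow> 'w \<Rightarrow> real \<Rightarrow> real ^ 'p::finite"
    and A :: "nat \<Rightarrow> 'w \<Rightarrow> real ^ 'p"
    and \<gamma> :: "nat \<Rightarrow> real"
    and N :: "'p \<Rightarrow> 'v measure"
    and U :: "'p \<Rightarrow> 'v \<Rightarrow> real \<Rightarrow> real"
    and k :: "'p \<Rightarrow> real \<Rightarrow> real \<Rightarrow> real"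
    and d \<theta> :: "'p \<Rightarrow> real"
    and I_B :: "(real \<Rightarrow> real ^ 'p) \<Rightarrow> ereal"
  assumes T: "0 < T"
    and M: "prob_space M"
    and U_prob: "\<And>i. prob_space (N i)"
    and U_gauss: "\<And>i. centered_gaussian_process (N i) T (U i)"
    and U_cov: "\<And>i. has_covariance (N i) T (U i) (k i)"
    and X_gauss: "\<And>n. centered_gaussian_process M T (X n)"
    and X_zero: "\<And>n. AE \<omega> in M. X n \<omega> 0 = 0"
    and X_indep_components: "\<And>n. prob_space.indep_vars M (\<lambda>i. borel_of (path_space T))
        (\<lambda>i \<omega>. coord_path T i (X n \<omega>)) UNIV"
    and X_good: "good_rate_function (path_space T)
        (\<lambda>h. \<Sum>i\<in>UNIV. ereal (1 / 2) * rkhs_sqnorm (N i) T (U i) (coord_path T i h))"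
    and X_ldp: "random_ldp M (path_space T) X \<gamma>
        (\<lambda>h. \<Sum>i\<in>UNIV. ereal (1 / 2) * rkhs_sqnorm (N i) T (U i) (coord_path T i h))"
    and AB_X_indep: "indep_rvs M
        (PiM UNIV (\<lambda>n. borel_of (prod_topology nonneg_orthant (path_space T)))) (\<lambda>\<omega> n. (A n \<omega>, B n \<omega>))
        (PiM UNIV (\<lambda>n. borel_of (path_space T))) (\<lambda>\<omega> n. X n \<omega>)"
    and Z_def: "\<And>n \<omega>. Z n \<omega> = (\<lambda>t\<in>{0..T}. \<chi> i. A n \<omega> $ i * X n \<omega> t $ i + B n \<omega> t $ i)"
    and d_\<theta>_pos: "\<And>i. 0 < d i" "\<And>i. 0 < \<theta> i"
    and A_pos: "\<And>n i. AE \<omega> in M. 0 < A n \<omega> $ i"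
    and A_indep_components: "\<And>n. prob_space.indep_vars M (\<lambda>i. borel) (\<lambda>i \<omega>. A n \<omega> $ i) UNIV"
    and A_good: "\<And>i. good_rate_function (top_of_set {0..}) (\<lambda>x. ereal (d i * x powr \<theta> i))"
    and A_ldp: "\<And>i. random_ldp M (top_of_set {0..}) (\<lambda>n \<omega>. A n \<omega> $ i) \<gamma> (\<lambda>x. ereal (d i * x powr \<theta> i))"
    and B_good: "good_rate_function (path_space T) I_B"
    and B_ldp: "random_ldp M (path_space T) B \<gamma> I_B"
    and A_B_indep: "indep_rvs M
        (PiM UNIV (\<lambda>n. borel_of nonneg_orthant)) (\<lambda>\<omega> n. A n \<omega>)
        (PiM UNIV (\<lambda>n. borel_of (path_space T))) (\<lambda>\<omega> n. B n \<omega>)"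
  shows "random_ldp M
           (prod_topology (prod_topology nonneg_orthant (path_space T)) (path_space T))
           (\<lambda>n \<omega>. ((A n \<omega>, B n \<omega>), Z n \<omega>)) \<gamma> (joint_rate N T U d \<theta> I_B)
    \<and> (\<forall>a \<in> topspace nonneg_orthant. \<forall>b \<in> topspace (path_space T). \<forall>z \<in> topspace (path_space T).
         joint_rate N T U d \<theta> I_B ((a, b), z) =
           (if \<forall>i\<in>{i. a $ i = 0}. path_diff T (coord_path T i z) (coord_path T i b) = path_zero T
            then I_B b + (\<Sum>i\<in>{i. a $ i > 0}. ereal (d i * (a $ i) powr \<theta> i) +
                   ereal (1 / (2 * (a $ i)\<^sup>2)) *
                     rkhs_sqnorm (N i) T (U i) (path_diff T (coord_path T i z) (coord_path T i b)))
            else \<infinity>))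
    \<and> random_ldp M (path_space T) Z \<gamma>
         (\<lambda>z. INF (a, b) \<in> topspace nonneg_orthant \<times> topspace (path_space T).
                joint_rate N T U d \<theta> I_B ((a, b), z))
    \<and> good_rate_function (path_space T)
         (\<lambda>z. INF (a, b) \<in> topspace nonneg_orthant \<times> topspace (path_space T).
                joint_rate N T U d \<theta> I_B ((a, b), z))
    \<and> (\<forall>z \<in> topspace (path_space T).
         (INF (a, b) \<in> topspace nonneg_orthant \<times> topspace (path_space T).
            joint_rate N T U d \<theta> I_B ((a, b), z)) =
         (INF b \<in> topspace (path_space T). I_B b +
            (\<Sum>i\<in>UNIV. ereal (psi (d i) (\<theta> i)) *
               powr_ereal (ereal (1 / 2) *
                   rkhs_sqnorm (N i) T (U i) (path_diff T (coord_path T i z) (coord_path T i b)))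
                 (\<theta> i / (\<theta> i + 2)))))"
proof -
  let ?O = "nonneg_orthant :: (real ^ 'p) topology"
  let ?C = "path_space T :: (real \<Rightarrow> real ^ 'p) topology"
  let ?E = "prod_topology (prod_topology ?O ?C) ?C"
  let ?IA = "\<lambda>a :: real ^ 'p. ereal (\<Sum>i\<in>UNIV. d i * (a $ i) powr \<theta> i)"
  let ?IX = "\<lambda>h. \<Sum>i\<in>UNIV. ereal (1 / 2) * rkhs_sqnorm (N i) T (U i) (coord_path T i h)"
  let ?IAB = "\<lambda>(a, b). ?IA a + I_B b"
  let ?F = "\<lambda>((a, b), x). ((a, b), scale_shift T a b x)"
  have G: "gaussian_process (N i) T (U i)" for i
    using U_prob U_gauss by (simp add: gaussian_process_def gaussian_process_axioms_def)
  have met: "metrizable_space (prod_topology ?O ?C)" "metrizable_space ?E"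
    by (simp_all add: metrizable_space_prod_topology metrizable_nonneg_orthant metrizable_path_space)
  have A_meas: "A n \<in> measurable M (borel_of ?O)" for n
    by (rule indep_rvs_coordinates(1)[OF M A_B_indep])
  have A_vec: "random_ldp M ?O A \<gamma> ?IA"
    by (rule ldp_independent_vector[OF M A_meas A_indep_components A_ldp A_good])
  have A_vec_good: "good_rate_function ?O ?IA"
    by (rule good_rate_function_orthant_sum[OF A_good])
  have AB_good: "good_rate_function (prod_topology ?O ?C) ?IAB"
    by (rule good_rate_function_product[OF A_vec_good B_good])
  have AB_meas: "(\<lambda>\<omega>. (A n \<omega>, B n \<omega>)) \<in> measurable M (borel_of (prod_topology ?O ?C))" for n
    by (rule indep_rvs_coordinates(1)[OF M AB_X_indep])
  have AB_ldp: "random_ldp M (prod_topology ?O ?C) (\<lambda>n \<omega>. (A n \<omega>, B n \<omega>)) \<gamma> ?IAB"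
    by (rule ldp_independent_product[OF M A_vec B_ldp A_vec_good B_good _ _ AB_meas
          indep_rvs_coordinates(3)[OF M A_B_indep]])
      (simp_all add: metrizable_imp_regular_space metrizable_nonneg_orthant metrizable_path_space)
  have ABX_meas: "(\<lambda>\<omega>. ((A n \<omega>, B n \<omega>), X n \<omega>)) \<in> measurable M (borel_of ?E)" for n
    by (intro measurable_Pair_borel_of AB_meas random_ldp_measurable[OF M X_ldp] second_countable_path_space)
      (simp add: second_countable_prod_topology second_countable_nonneg_orthant second_countable_path_space)
  have ABX_ldp: "random_ldp M ?E (\<lambda>n \<omega>. ((A n \<omega>, B n \<omega>), X n \<omega>)) \<gamma> (\<lambda>(p, x). ?IAB p + ?IX x)"
    by (rule ldp_independent_product[OF M AB_ldp X_ldp AB_good X_good _ _ ABX_meas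
          indep_rvs_coordinates(3)[OF M AB_X_indep]])
      (simp_all add: metrizable_imp_regular_space met metrizable_path_space)
  have ABX_good: "good_rate_function ?E (\<lambda>(p, x). ?IAB p + ?IX x)"
    by (rule good_rate_function_product[OF AB_good X_good])
  have cont: "continuous_map ?E ?E ?F"
  proof -
    have c: "continuous_map ?E ?E (\<lambda>w. (fst w, (\<lambda>((a, b), x). scale_shift T a b x) w))"
      by (intro continuous_map_pairedI continuous_map_fst continuous_map_scale_shift)
    show ?thesis by (rule back_subst[of "continuous_map ?E ?E", OF c]) auto
  qed
  have fibre: "joint_rate N T U d \<theta> I_B y =
      (INF w\<in>{w \<in> topspace ?E. ?F w = y}. (\<lambda>(p, x). ?IAB p + ?IX x) w)" if y: "y \<in> topspace ?E" for y
  proof -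
    obtain a b z where abz: "y = ((a, b), z)" by (metis surj_pair)
    then have "a \<in> topspace ?O" "b \<in> topspace ?C" "z \<in> topspace ?C" using y by auto
    then show ?thesis unfolding abz by (rule joint_rate_fibre_inf[where N = N and U = U, OF G])
  qed
  have Z_eq: "?F ((A n \<omega>, B n \<omega>), X n \<omega>) = ((A n \<omega>, B n \<omega>), Z n \<omega>)" for n \<omega>
    by (simp add: Z_def scale_shift_def)
  note joint = contraction_principle[OF M ABX_ldp ABX_good cont metrizable_imp_Hausdorff_space[OF met(2)] fibre,
    unfolded Z_eq]
  have IZ: "(INF (a, b)\<in>topspace ?O \<times> topspace ?C. joint_rate N T U d \<theta> I_B ((a, b), z)) =
      (INF w\<in>{w \<in> topspace ?E. snd w = z}. joint_rate N T U d \<theta> I_B w)" if z: "z \<in> topspace ?C" for z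
  proof -
    have "{w \<in> topspace ?E. snd w = z} = (\<lambda>p. (p, z)) ` (topspace ?O \<times> topspace ?C)" using z by auto
    then show ?thesis by (simp add: image_image case_prod_beta)
  qed
  note Z_rate = contraction_principle[OF M joint continuous_map_snd
      metrizable_imp_Hausdorff_space[OF metrizable_path_space] IZ, unfolded snd_conv]
  show ?thesis
    using joint(1) Z_rate joint_rate_cases joint_rate_inf_over_scales[where N = N and U = U, OF G d_\<theta>_pos]
    by (intro conjI ballI)
qed

end
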